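(* Let $G$ be a connected real reductive group of split rank $1$ with finite center, let $K$ be a maximal compact subgroup with corresponding Cartan involution $\theta$, let $P$ be a non-trivial proper parabolic subgroup of $G$ with unipotent radical $N$, and let $G=\bar NAK$ be an Iwasawa decomposition of $G$, where $\bar N=\theta(N)$ and $A$ normalizes $N$. Then for all $r\in\mathbb{R}$, $$\int_{[N,N]}a(n)^{-\rho}\,\bigl(1+\log (a(n)^{\rho})\bigr)^{r}\,dn<\infty .$$
   Context: For $g\in G$ write $g=\bar n\,a(g)\,k$ with $\bar n\in\bar N$, $a(g)\in A$, $k\in K$. For $a\in A$, $a^{\rho}=\bigl(\det \mathrm{Ad}(a)|_{\mathrm{Lie}(N)}\bigr)^{1/2}$ and $a^{-\rho}=(a^\rho)^{-1}$. $[N,N]$ is the commutator subgroup of $N$ and $dn$ is a Haar measure on $[N,N]$. *)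

theory Defs
  imports "HOL-Analysis.Analysis" "HOL-Algebra.Generated_Groups" "HOL-Algebra.Group_Action"
begin

section \<open>Matrices, matrix Lie algebras, and linear algebra on subspaces\<close>

text \<open>The times operation on vectors is not the matrix product, so the library's exponential
  series does not apply to matrices.\<close>

definition mat_pow :: "'a::comm_ring_1^'n^'n \<Rightarrow> nat \<Rightarrow> 'a^'n^'n" where
  "mat_pow X k = (((**) X) ^^ k) (mat 1)"

definition mat_exp :: "real^'n^'n \<Rightarrow> real^'n^'n" where
  "mat_exp X = (\<Sum>k. (1 / fact k) *\<^sub>R mat_pow X k)"

definition bracket :: "'a::comm_ring_1^'n^'n \<Rightarrow> 'a^'n^'n \<Rightarrow> 'a^'n^'n" where
  "bracket X Y = X ** Y - Y ** X"

definition some_basis :: "'v::real_vector set \<Rightarrow> 'v set" where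
  "some_basis V = (SOME B. independent B \<and> span B = V)"

definition trace_on :: "'v::real_vector set \<Rightarrow> ('v \<Rightarrow> 'v) \<Rightarrow> real" where
  "trace_on V f = (let B = some_basis V in \<Sum>b\<in>B. representation B (f b) b)"

definition det_on :: "'v::real_vector set \<Rightarrow> ('v \<Rightarrow> 'v) \<Rightarrow> real" where
  "det_on V f = (let B = some_basis V in
     \<Sum>\<sigma> | \<sigma> permutes B. of_int (sign \<sigma>) * (\<Prod>b\<in>B. representation B (f b) (\<sigma> b)))"

definition killing_form :: "(real^'n^'n) set \<Rightarrow> real^'n^'n \<Rightarrow> real^'n^'n \<Rightarrow> real" where
  "killing_form \<gg> X Y = trace_on \<gg> (\<lambda>Z. bracket X (bracket Y Z))"

definition abelian_subspace :: "(real^'n^'n) set \<Rightarrow> (real^'n^'n) set \<Rightarrow> bool" where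
  "abelian_subspace V \<aa> \<longleftrightarrow> subspace \<aa> \<and> \<aa> \<subseteq> V \<and> (\<forall>X\<in>\<aa>. \<forall>Y\<in>\<aa>. bracket X Y = 0)"

definition maximal_abelian_subspace :: "(real^'n^'n) set \<Rightarrow> (real^'n^'n) set \<Rightarrow> bool" where
  "maximal_abelian_subspace V \<aa> \<longleftrightarrow> abelian_subspace V \<aa> \<and>
     (\<forall>\<bb>. abelian_subspace V \<bb> \<longrightarrow> \<aa> \<subseteq> \<bb> \<longrightarrow> \<bb> = \<aa>)"


section \<open>Real reductive groups\<close>

definition self_adjoint_algebraic_group :: "(real^'n^'n) set \<Rightarrow> bool" where
  "self_adjoint_algebraic_group R \<longleftrightarrow>
     (\<exists>F. (\<forall>f\<in>F. real_polynomial_function f) \<and> R = {X. invertible X \<and> (\<forall>f\<in>F. f X = 0)}) \<and>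
     mat 1 \<in> R \<and> (\<forall>X\<in>R. \<forall>Y\<in>R. X ** Y \<in> R) \<and> (\<forall>X\<in>R. matrix_inv X \<in> R) \<and>
     (\<forall>X\<in>R. transpose X \<in> R)"

text \<open>A real reductive group in the sense of Wallach: a topological group \<open>G\<close> with a finite covering
  homomorphism \<open>p\<close> onto an open subgroup of a self-adjoint real algebraic group of real matrices.
  The topology of \<open>G\<close> is the subspace topology of its carrier. Since \<open>p\<close> is a covering, it
  identifies the Lie algebra of \<open>G\<close> with that of \<open>p G\<close>, which is a Lie algebra of matrices; all
  Lie algebras below are expressed through this identification.\<close>

definition real_reductive_group ::
    "('g::topological_space, 'm) monoid_scheme \<Rightarrow> ('g \<Rightarrow> real^'n^'n) \<Rightarrow> bool" where
  "real_reductive_group G p \<longleftrightarrow> group G \<and>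
     continuous_on (carrier G \<times> carrier G) (\<lambda>(x, y). x \<otimes>\<^bsub>G\<^esub> y) \<and>
     continuous_on (carrier G) (\<lambda>x. inv\<^bsub>G\<^esub> x) \<and>
     (\<forall>x\<in>carrier G. \<forall>y\<in>carrier G. p (x \<otimes>\<^bsub>G\<^esub> y) = p x ** p y) \<and>
     finite {x \<in> carrier G. p x = mat 1} \<and>
     covering_space (carrier G) p (p ` carrier G) \<and>
     (\<exists>R. self_adjoint_algebraic_group R \<and> openin (top_of_set R) (p ` carrier G))"

definition group_center :: "('g, 'm) monoid_scheme \<Rightarrow> 'g set" where
  "group_center G = {z \<in> carrier G. \<forall>x\<in>carrier G. z \<otimes>\<^bsub>G\<^esub> x = x \<otimes>\<^bsub>G\<^esub> z}"

definition one_parameter_subgroup ::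
    "('g::topological_space, 'm) monoid_scheme \<Rightarrow> ('g \<Rightarrow> real^'n^'n) \<Rightarrow> real^'n^'n \<Rightarrow> (real \<Rightarrow> 'g) \<Rightarrow> bool"
  where
  "one_parameter_subgroup G p X \<gamma> \<longleftrightarrow> continuous_on UNIV \<gamma> \<and> (\<forall>t. \<gamma> t \<in> carrier G) \<and>
     (\<forall>s t. \<gamma> (s + t) = \<gamma> s \<otimes>\<^bsub>G\<^esub> \<gamma> t) \<and> (\<forall>t. p (\<gamma> t) = mat_exp (t *\<^sub>R X))"

text \<open>The Lie algebra of a closed subgroup \<open>H\<close> (of \<open>G\<close> itself if \<open>H = carrier G\<close>).\<close>

definition lie_algebra ::
    "('g::topological_space, 'm) monoid_scheme \<Rightarrow> ('g \<Rightarrow> real^'n^'n) \<Rightarrow> 'g set \<Rightarrow> (real^'n^'n) set" where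
  "lie_algebra G p H = {X. \<exists>\<gamma>. one_parameter_subgroup G p X \<gamma> \<and> range \<gamma> \<subseteq> H}"

definition group_exp ::
    "('g::topological_space, 'm) monoid_scheme \<Rightarrow> ('g \<Rightarrow> real^'n^'n) \<Rightarrow> real^'n^'n \<Rightarrow> 'g" where
  "group_exp G p X = (THE \<gamma>. one_parameter_subgroup G p X \<gamma>) 1"

definition Ad :: "('g, 'm) monoid_scheme \<Rightarrow> ('g \<Rightarrow> real^'n^'n) \<Rightarrow> 'g \<Rightarrow> real^'n^'n \<Rightarrow> real^'n^'n" where
  "Ad G p x X = p x ** X ** p (inv\<^bsub>G\<^esub> x)"


section \<open>Maximal compact subgroups, Cartan involutions, split rank\<close>

definition maximal_compact_subgroup ::
    "('g::topological_space, 'm) monoid_scheme \<Rightarrow> 'g set \<Rightarrow> bool" where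
  "maximal_compact_subgroup G K \<longleftrightarrow> subgroup K G \<and> compact K \<and>
     (\<forall>L. subgroup L G \<longrightarrow> compact L \<longrightarrow> K \<subseteq> L \<longrightarrow> L = K)"

definition lie_differential ::
    "('g::topological_space, 'm) monoid_scheme \<Rightarrow> ('g \<Rightarrow> real^'n^'n) \<Rightarrow> ('g \<Rightarrow> 'g) \<Rightarrow>
     real^'n^'n \<Rightarrow> real^'n^'n" where
  "lie_differential G p \<theta> X = (THE Y. Y \<in> lie_algebra G p (carrier G) \<and>
     (\<forall>t. \<theta> (group_exp G p (t *\<^sub>R X)) = group_exp G p (t *\<^sub>R Y)))"

text \<open>The Killing form is the appropriate invariant form here because a connected reductive group
  with finite center is semisimple.\<close>

definition cartan_involution ::
    "('g::topological_space, 'm) monoid_scheme \<Rightarrow> ('g \<Rightarrow> real^'n^'n) \<Rightarrow> 'g set \<Rightarrow> ('g \<Rightarrow> 'g) \<Rightarrow> bool" where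
  "cartan_involution G p K \<theta> \<longleftrightarrow> \<theta> \<in> hom G G \<and> continuous_on (carrier G) \<theta> \<and>
     (\<forall>x\<in>carrier G. \<theta> (\<theta> x) = x) \<and> {x \<in> carrier G. \<theta> x = x} = K \<and>
     (let \<gg> = lie_algebra G p (carrier G) in
       \<forall>X\<in>\<gg>. X \<noteq> 0 \<longrightarrow> - killing_form \<gg> X (lie_differential G p \<theta> X) > 0)"

definition cartan_minus_space ::
    "('g::topological_space, 'm) monoid_scheme \<Rightarrow> ('g \<Rightarrow> real^'n^'n) \<Rightarrow> ('g \<Rightarrow> 'g) \<Rightarrow> (real^'n^'n) set" where
  "cartan_minus_space G p \<theta> =
     {X \<in> lie_algebra G p (carrier G). lie_differential G p \<theta> X = - X}"

text \<open>This does not depend on the Cartan involution, as all of them are conjugate.\<close>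

definition split_rank ::
    "('g::topological_space, 'm) monoid_scheme \<Rightarrow> ('g \<Rightarrow> real^'n^'n) \<Rightarrow> ('g \<Rightarrow> 'g) \<Rightarrow> nat" where
  "split_rank G p \<theta> = Max {dim \<aa> | \<aa>. abelian_subspace (cartan_minus_space G p \<theta>) \<aa>}"


section \<open>Parabolic subgroups and unipotent radicals\<close>

definition complexification :: "(real^'n^'n) set \<Rightarrow> (complex^'n^'n) set" where
  "complexification V = {Z. (\<chi> i j. Re (Z $ i $ j)) \<in> V \<and> (\<chi> i j. Im (Z $ i $ j)) \<in> V}"

text \<open>The matrix \<open>mat c ** X\<close> is the scalar multiple of \<open>X\<close> by \<open>c\<close>.\<close>

definition complex_lie_subalgebra :: "(complex^'n^'n) set \<Rightarrow> bool" where
  "complex_lie_subalgebra \<ss> \<longleftrightarrow> 0 \<in> \<ss> \<and> (\<forall>X\<in>\<ss>. \<forall>Y\<in>\<ss>. X + Y \<in> \<ss> \<and> bracket X Y \<in> \<ss>) \<and>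
     (\<forall>c. \<forall>X\<in>\<ss>. mat c ** X \<in> \<ss>)"

text \<open>For a complex subspace the real span of the brackets is already a complex subspace.\<close>

definition derived_subalgebra :: "(complex^'n^'n) set \<Rightarrow> (complex^'n^'n) set" where
  "derived_subalgebra \<ss> = span {bracket X Y | X Y. X \<in> \<ss> \<and> Y \<in> \<ss>}"

definition solvable_subalgebra :: "(complex^'n^'n) set \<Rightarrow> bool" where
  "solvable_subalgebra \<ss> \<longleftrightarrow> complex_lie_subalgebra \<ss> \<and> (\<exists>k. (derived_subalgebra ^^ k) \<ss> = {0})"

definition borel_subalgebra :: "(complex^'n^'n) set \<Rightarrow> (complex^'n^'n) set \<Rightarrow> bool" where
  "borel_subalgebra \<gg>\<^sub>C \<bb> \<longleftrightarrow> solvable_subalgebra \<bb> \<and> \<bb> \<subseteq> \<gg>\<^sub>C \<and>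
     (\<forall>\<cc>. solvable_subalgebra \<cc> \<longrightarrow> \<cc> \<subseteq> \<gg>\<^sub>C \<longrightarrow> \<bb> \<subseteq> \<cc> \<longrightarrow> \<cc> = \<bb>)"

definition parabolic_subalgebra :: "(real^'n^'n) set \<Rightarrow> (real^'n^'n) set \<Rightarrow> bool" where
  "parabolic_subalgebra \<gg> \<qq> \<longleftrightarrow> subspace \<qq> \<and> \<qq> \<subseteq> \<gg> \<and> (\<forall>X\<in>\<qq>. \<forall>Y\<in>\<qq>. bracket X Y \<in> \<qq>) \<and>
     (\<exists>\<bb>. borel_subalgebra (complexification \<gg>) \<bb> \<and> \<bb> \<subseteq> complexification \<qq>)"

definition parabolic_subgroup ::
    "('g::topological_space, 'm) monoid_scheme \<Rightarrow> ('g \<Rightarrow> real^'n^'n) \<Rightarrow> 'g set \<Rightarrow> bool" where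
  "parabolic_subgroup G p P \<longleftrightarrow> (\<exists>\<qq>. parabolic_subalgebra (lie_algebra G p (carrier G)) \<qq> \<and>
     P = {x \<in> carrier G. Ad G p x ` \<qq> = \<qq>})"

definition unipotent_element :: "('g \<Rightarrow> real^'n^'n) \<Rightarrow> 'g \<Rightarrow> bool" where
  "unipotent_element p x \<longleftrightarrow> (\<exists>k. mat_pow (p x - mat 1) k = 0)"

definition connected_normal_unipotent ::
    "('g::topological_space, 'm) monoid_scheme \<Rightarrow> ('g \<Rightarrow> real^'n^'n) \<Rightarrow> 'g set \<Rightarrow> 'g set \<Rightarrow> bool" where
  "connected_normal_unipotent G p P U \<longleftrightarrow>
     U \<lhd> (G\<lparr>carrier := P\<rparr>) \<and> connected U \<and> (\<forall>x\<in>U. unipotent_element p x)"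

definition unipotent_radical ::
    "('g::topological_space, 'm) monoid_scheme \<Rightarrow> ('g \<Rightarrow> real^'n^'n) \<Rightarrow> 'g set \<Rightarrow> 'g set \<Rightarrow> bool" where
  "unipotent_radical G p P N \<longleftrightarrow> connected_normal_unipotent G p P N \<and>
     (\<forall>U. connected_normal_unipotent G p P U \<longrightarrow> U \<subseteq> N)"


section \<open>Iwasawa decompositions\<close>

text \<open>Linear functionals on \<open>\<aa>\<close> are represented by linear functionals on the whole matrix space;
  only their restrictions to \<open>\<aa>\<close> matter.\<close>

definition root_space ::
    "(real^'n^'n) set \<Rightarrow> (real^'n^'n) set \<Rightarrow> (real^'n^'n \<Rightarrow> real) \<Rightarrow> (real^'n^'n) set" where
  "root_space \<gg> \<aa> \<alpha> = {X \<in> \<gg>. \<forall>H\<in>\<aa>. bracket H X = \<alpha> H *\<^sub>R X}"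

definition restricted_root ::
    "(real^'n^'n) set \<Rightarrow> (real^'n^'n) set \<Rightarrow> (real^'n^'n \<Rightarrow> real) \<Rightarrow> bool" where
  "restricted_root \<gg> \<aa> \<alpha> \<longleftrightarrow> linear \<alpha> \<and> (\<exists>H\<in>\<aa>. \<alpha> H \<noteq> 0) \<and> root_space \<gg> \<aa> \<alpha> \<noteq> {0}"

text \<open>A positive system consists of the roots that are positive on a regular element \<open>H\<close>.\<close>

definition regular_element :: "(real^'n^'n) set \<Rightarrow> (real^'n^'n) set \<Rightarrow> real^'n^'n \<Rightarrow> bool" where
  "regular_element \<gg> \<aa> H \<longleftrightarrow> H \<in> \<aa> \<and> (\<forall>\<alpha>. restricted_root \<gg> \<aa> \<alpha> \<longrightarrow> \<alpha> H \<noteq> 0)"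

definition positive_root_sum ::
    "(real^'n^'n) set \<Rightarrow> (real^'n^'n) set \<Rightarrow> real^'n^'n \<Rightarrow> (real^'n^'n) set" where
  "positive_root_sum \<gg> \<aa> H =
     span (\<Union>\<alpha>\<in>{\<alpha>. restricted_root \<gg> \<aa> \<alpha> \<and> \<alpha> H > 0}. root_space \<gg> \<aa> \<alpha>)"

definition iwasawa_decomposition ::
    "('g::topological_space, 'm) monoid_scheme \<Rightarrow> ('g \<Rightarrow> real^'n^'n) \<Rightarrow> ('g \<Rightarrow> 'g) \<Rightarrow>
     'g set \<Rightarrow> 'g set \<Rightarrow> 'g set \<Rightarrow> bool" where
  "iwasawa_decomposition G p \<theta> V A K \<longleftrightarrow>
     (\<exists>\<aa> H. maximal_abelian_subspace (cartan_minus_space G p \<theta>) \<aa> \<and> A = group_exp G p ` \<aa> \<and>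
        regular_element (lie_algebra G p (carrier G)) \<aa> H \<and>
        V = group_exp G p ` positive_root_sum (lie_algebra G p (carrier G)) \<aa> H) \<and>
     bij_betw (\<lambda>(v, a, k). v \<otimes>\<^bsub>G\<^esub> a \<otimes>\<^bsub>G\<^esub> k) (V \<times> A \<times> K) (carrier G)"

definition iwasawa_A ::
    "('g, 'm) monoid_scheme \<Rightarrow> 'g set \<Rightarrow> 'g set \<Rightarrow> 'g set \<Rightarrow> 'g \<Rightarrow> 'g" where
  "iwasawa_A G V A K x = (THE a. a \<in> A \<and> (\<exists>v\<in>V. \<exists>k\<in>K. x = v \<otimes>\<^bsub>G\<^esub> a \<otimes>\<^bsub>G\<^esub> k))"

definition rho_power ::
    "('g::topological_space, 'm) monoid_scheme \<Rightarrow> ('g \<Rightarrow> real^'n^'n) \<Rightarrow> 'g set \<Rightarrow> 'g \<Rightarrow> real" where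
  "rho_power G p N a = sqrt (det_on (lie_algebra G p N) (Ad G p a))"


section \<open>Haar measures\<close>

definition haar_measure ::
    "('g::topological_space, 'm) monoid_scheme \<Rightarrow> 'g set \<Rightarrow> 'g measure \<Rightarrow> bool" where
  "haar_measure G H \<mu> \<longleftrightarrow> sets \<mu> = sets (restrict_space borel H) \<and> emeasure \<mu> H \<noteq> 0 \<and>
     (\<forall>h\<in>H. \<forall>B\<in>sets \<mu>. emeasure \<mu> (h <#\<^bsub>G\<^esub> B) = emeasure \<mu> B) \<and>
     (\<forall>C. compact C \<longrightarrow> C \<subseteq> H \<longrightarrow> emeasure \<mu> C < \<infinity>) \<and>
     (\<forall>B\<in>sets \<mu>. emeasure \<mu> B = (INF U\<in>{U. openin (top_of_set H) U \<and> B \<subseteq> U}. emeasure \<mu> U)) \<and>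
     (\<forall>U. openin (top_of_set H) U \<longrightarrow>
        emeasure \<mu> U = (SUP C\<in>{C. compact C \<and> C \<subseteq> U}. emeasure \<mu> C))"

end

theory Submission
  imports Defs
begin

text \<open>
  In rank one the restricted roots are contained in \<open>{\<plusminus>\<alpha>, \<plusminus>2\<alpha>}\<close>: a root vector \<open>Z\<close>, its image \<open>\<theta>Z\<close> and
  \<open>[Z, \<theta>Z] \<in> \<aa>\<close> span a copy of \<open>sl(2)\<close>, so the ratio of two roots is a half-integer in both
  directions. Hence \<open>[N, N]\<close> is a vector group \<open>\<theta> (exp \<zz>)\<close> with \<open>\<zz>\<close> inside the root space of
  \<open>2\<alpha>\<close>. Let \<open>Q X = - B(X, \<theta>X)\<close>, which is \<open>K\<close>-invariant. For \<open>n = \<theta> (exp Z)\<close> and \<open>F\<close> in the root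
  space of \<open>2\<alpha>\<close>, the Iwasawa decomposition gives \<open>Q (Ad(n\<inverse>) F) = a(n)\<^bsup>-4\<alpha>\<^esup> Q F\<close>. For \<open>F = Z\<close> the
  left-hand side is a polynomial in \<open>Q Z\<close>, and the result is \<open>a(n)\<^bsup>-2\<alpha>\<^esup> = 1 + c Q Z\<close>. (The positive
  roots are those of \<open>\<theta> N\<close>, so \<open>a(n)\<^sup>\<rho>\<close> is a positive power of this.) With \<open>p\<close>, \<open>q\<close> the root
  multiplicities, \<open>a(n)\<^sup>\<rho>\<close> grows like \<open>|Z|\<^bsup>q + p/2\<^esup>\<close>, while the volume of a ball of radius \<open>r\<close>
  in \<open>[N, N]\<close> grows at most like \<open>r\<^sup>q\<close>, and \<open>p > 0\<close> unless \<open>[N, N]\<close> is trivial.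
\<close>

section \<open>The matrix exponential\<close>

text \<open>The covering \<open>p\<close> need not be injective, so an identity between matrices
  does not give one in \<open>G\<close>. Every statement about \<open>group_exp\<close> therefore
  goes through continuous one-parameter subgroups, which are determined by their image under
  \<open>p\<close>, and through a local section \<open>\<sigma>\<close> of \<open>p\<close>. No
  smooth structure is given: \<open>\<theta>\<close> is a continuous automorphism, its differential
  is a definite description, and linearity on the Lie algebra has to be extracted from limits of
  products.

  The Haar measure is never identified with Lebesgue measure. An upper bound for the measure of
  large balls is enough, and translates of one small compact ball supply it; this needs continuity
  of the exponential only near 0. Likewise the Iwasawa decomposition is only a bijection, so
  measurability of the height comes from the continuous function
  \<open>x \<mapsto> Q (Ad G p (inv x) F)\<close>.

  \<open>lie_algebra G p N\<close> is defined by the one-parameter subgroups inside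
  \<open>N\<close>, so the determinant in \<open>rho_power\<close> can be computed only after the
  exponential is known to be injective on the nilpotent algebra.\<close>

lemma matrix_add_rdistrib: "(A + B) ** C = A ** C + B ** (C :: 'a::semiring_1^'p^'n)"
  by (vector matrix_matrix_mult_def sum.distrib[symmetric] field_simps)

lemma bounded_bilinear_matrix_mult: "bounded_bilinear ((**) :: real^'n^'n \<Rightarrow> real^'n^'n \<Rightarrow> real^'n^'n)"
proof -
  have "bilinear ((**) :: real^'n^'n \<Rightarrow> real^'n^'n \<Rightarrow> real^'n^'n)"
    by (auto simp: bilinear_def linear_iff matrix_add_ldistrib matrix_add_rdistrib
        matrix_scalar_ac scalar_matrix_assoc[symmetric])
  then show ?thesis by (simp add: bilinear_conv_bounded_bilinear)
qed

interpretation mm: bounded_bilinear "(**) :: real^'n^'n \<Rightarrow> real^'n^'n \<Rightarrow> real^'n^'n"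
  by (rule bounded_bilinear_matrix_mult)

text \<open>Square matrices with the operator norm form a Banach algebra. They need a type of their own
  because the norm and the product of the vector type are others.\<close>

typedef (overloaded) ('n::finite) sqm = "UNIV :: (real^'n^'n) set"
  morphisms of_sqm to_sqm by simp

setup_lifting type_definition_sqm

instantiation sqm :: (finite) real_normed_algebra_1
begin

lift_definition zero_sqm :: "'a sqm" is 0 .
lift_definition one_sqm :: "'a sqm" is "mat 1" .
lift_definition plus_sqm :: "'a sqm \<Rightarrow> 'a sqm \<Rightarrow> 'a sqm" is "(+)" .
lift_definition minus_sqm :: "'a sqm \<Rightarrow> 'a sqm \<Rightarrow> 'a sqm" is "(-)" .
lift_definition uminus_sqm :: "'a sqm \<Rightarrow> 'a sqm" is uminus .
lift_definition times_sqm :: "'a sqm \<Rightarrow> 'a sqm \<Rightarrow> 'a sqm" is "(**)" .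
lift_definition scaleR_sqm :: "real \<Rightarrow> 'a sqm \<Rightarrow> 'a sqm" is "scaleR" .
lift_definition norm_sqm :: "'a sqm \<Rightarrow> real" is "\<lambda>A. onorm ((*v) A)" .
definition dist_sqm :: "'a sqm \<Rightarrow> 'a sqm \<Rightarrow> real" where "dist_sqm x y = norm (x - y)"
definition sgn_sqm :: "'a sqm \<Rightarrow> 'a sqm" where "sgn_sqm x = inverse (norm x) *\<^sub>R x"
definition uniformity_sqm :: "('a sqm \<times> 'a sqm) filter"
  where "uniformity_sqm = (INF e\<in>{0 <..}. principal {(x, y). dist x y < e})"
definition open_sqm :: "'a sqm set \<Rightarrow> bool"
  where "open_sqm U \<longleftrightarrow> (\<forall>x\<in>U. \<forall>\<^sub>F (x', y) in uniformity. x' = x \<longrightarrow> y \<in> U)"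

instance
proof
  fix a b c :: "'a sqm" and r s :: real
  show "dist a b = norm (a - b)" by (rule dist_sqm_def)
  show "sgn a = inverse (norm a) *\<^sub>R a" by (rule sgn_sqm_def)
  show "(norm a = 0) = (a = 0)"
    by transfer (auto simp: onorm_eq_0 matrix_eq)
  have "(*v) (A + B) = (\<lambda>x. A *v x + B *v x)" for A B :: "real^'a^'a"
    by (simp add: fun_eq_iff algebra_simps)
  then show "norm (a + b) \<le> norm a + norm b"
    by transfer (simp add: onorm_triangle)
  have "(*v) (r *\<^sub>R A) = (\<lambda>x. r *\<^sub>R (A *v x))" for A :: "real^'a^'a"
    by (simp add: fun_eq_iff scaleR_matrix_vector_assoc)
  then show "norm (r *\<^sub>R a) = \<bar>r\<bar> * norm a"
    by transfer (simp add: onorm_scaleR)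
  have "(*v) (A ** B) = (*v) A \<circ> (*v) B" for A B :: "real^'a^'a"
    by (simp add: fun_eq_iff matrix_vector_mul_assoc)
  then show "norm (a * b) \<le> norm a * norm b"
    by transfer (simp add: onorm_compose)
  have "(*v) (mat 1) = (\<lambda>x::real^'a. x)"
    by (simp add: fun_eq_iff)
  then show "norm (1::'a sqm) = 1"
    by transfer (simp add: onorm_id)
  show "0 \<noteq> (1::'a sqm)"
    by transfer (simp add: vec_eq_iff mat_def)
  show "(uniformity :: ('a sqm \<times> 'a sqm) filter) = (INF e\<in>{0 <..}. principal {(x, y). dist x y < e})"
    by (rule uniformity_sqm_def)
  show "open U = (\<forall>x\<in>U. \<forall>\<^sub>F (x', y) in uniformity. x' = x \<longrightarrow> y \<in> U)" for U :: "'a sqm set"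
    by (rule open_sqm_def)
qed (transfer; simp add: matrix_mul_assoc matrix_add_ldistrib matrix_add_rdistrib algebra_simps
      matrix_scalar_ac scalar_matrix_assoc)+

end

lemma linear_to_sqm: "linear to_sqm"
  by (intro linearI) (simp_all add: plus_sqm.abs_eq scaleR_sqm.abs_eq eq_onp_same_args)

lemma bounded_linear_to_sqm: "bounded_linear to_sqm"
  using linear_to_sqm by (rule linear_conv_bounded_linear[THEN iffD1])

text \<open>Each entry is at most the operator norm, and the constant counts the entries. Together
  with \<open>bounded_linear_to_sqm\<close> this lets limits, series and derivatives pass between
  matrices and the Banach algebra.\<close>

lemma bounded_linear_of_sqm: "bounded_linear of_sqm"
proof (rule bounded_linear_intro[where K = "real CARD('a) * real CARD('a)"])
  fix x :: "'a sqm"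
  have c: "\<bar>of_sqm x $ i $ j\<bar> \<le> norm x" for i j
    by transfer (rule matrix_component_le_onorm)
  have "norm (of_sqm x) \<le> (\<Sum>i\<in>UNIV. norm (of_sqm x $ i))"
    unfolding norm_vec_def by (rule L2_set_le_sum) simp
  also have "\<dots> \<le> (\<Sum>i\<in>(UNIV::'a set). \<Sum>j\<in>UNIV. \<bar>of_sqm x $ i $ j\<bar>)"
    by (intro sum_mono norm_le_l1_cart)
  also have "\<dots> \<le> (\<Sum>i\<in>(UNIV::'a set). \<Sum>j\<in>(UNIV::'a set). norm x)"
    by (intro sum_mono c)
  finally show "norm (of_sqm x) \<le> norm x * (real CARD('a) * real CARD('a))"
    by (simp add: algebra_simps)
qed (simp_all add: plus_sqm.rep_eq scaleR_sqm.rep_eq)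

instance sqm :: (finite) banach
proof
  fix X :: "nat \<Rightarrow> 'a sqm"
  assume "Cauchy X"
  then have "Cauchy (\<lambda>n. of_sqm (X n))"
    by (rule bounded_linear.Cauchy[OF bounded_linear_of_sqm])
  then obtain L where "(\<lambda>n. of_sqm (X n)) \<longlonglongrightarrow> L"
    using Cauchy_convergent_iff convergent_def by blast
  then have "(\<lambda>n. to_sqm (of_sqm (X n))) \<longlonglongrightarrow> to_sqm L"
    by (rule bounded_linear.tendsto[OF bounded_linear_to_sqm])
  then show "convergent X"
    by (auto simp: of_sqm_inverse convergent_def)
qed

lemma to_sqm_mult: "to_sqm (A ** B) = to_sqm A * to_sqm B"
  by (simp add: times_sqm.abs_eq eq_onp_same_args)

lemma to_sqm_one: "to_sqm (mat 1) = 1"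
  by (simp add: one_sqm_def)

lemma of_sqm_to_sqm [simp]: "of_sqm (to_sqm A) = A"
  by (simp add: to_sqm_inverse)

lemma to_sqm_eq_iff [simp]: "to_sqm A = to_sqm B \<longleftrightarrow> A = B"
  by (metis of_sqm_to_sqm)

lemma to_sqm_pow: "to_sqm (mat_pow A k) = to_sqm A ^ k"
  by (induction k) (simp_all add: mat_pow_def to_sqm_one to_sqm_mult)

lemma to_sqm_exp: "to_sqm (mat_exp A) = exp (to_sqm A)"
proof -
  interpret bounded_linear to_sqm by (rule bounded_linear_to_sqm)
  interpret o: bounded_linear of_sqm by (rule bounded_linear_of_sqm)
  have "summable (\<lambda>k. to_sqm A ^ k /\<^sub>R fact k)"
    by (rule summable_exp_generic)
  then have "summable (\<lambda>k. of_sqm (to_sqm A ^ k /\<^sub>R fact k))"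
    by (rule o.summable)
  then have *: "summable (\<lambda>k. (1 / fact k) *\<^sub>R mat_pow A k)"
    by (simp add: to_sqm_pow[symmetric] o.scaleR divide_inverse)
  show ?thesis
    unfolding mat_exp_def suminf[OF *] exp_def
    by (simp add: scaleR to_sqm_pow divide_inverse)
qed

lemma mat_exp_eq: "mat_exp A = of_sqm (exp (to_sqm A))"
  by (metis of_sqm_to_sqm to_sqm_exp)

lemmas to_sqm_linear_simps = linear_simps[OF bounded_linear_to_sqm]

lemma mat_exp_0 [simp]: "mat_exp 0 = mat 1"
  by (simp add: mat_exp_eq to_sqm_linear_simps one_sqm.rep_eq)

lemma mat_exp_add:
  assumes "X ** Y = Y ** X"
  shows "mat_exp (X + Y) = mat_exp X ** mat_exp Y"
proof -
  have "to_sqm X * to_sqm Y = to_sqm Y * to_sqm X"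
    using arg_cong[OF assms, of to_sqm] unfolding to_sqm_mult .
  from exp_add_commuting[OF this] show ?thesis
    by (simp add: mat_exp_eq to_sqm_linear_simps times_sqm.rep_eq)
qed

lemma mat_exp_scaleR_add: "mat_exp ((s + t) *\<^sub>R X) = mat_exp (s *\<^sub>R X) ** mat_exp (t *\<^sub>R X)"
  unfolding scaleR_left_distrib
  by (rule mat_exp_add) (simp add: mm.scaleR_left mm.scaleR_right)

lemma mat_exp_minus_left [simp]: "mat_exp (- X) ** mat_exp X = mat 1"
  using mat_exp_add[of "- X" X] by (simp add: mm.minus_left mm.minus_right)

lemma mat_exp_minus_right [simp]: "mat_exp X ** mat_exp (- X) = mat 1"
  using mat_exp_add[of X "- X"] by (simp add: mm.minus_left mm.minus_right)

lemma invertible_mat_exp: "invertible (mat_exp X)"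
  using invertible_def mat_exp_minus_left mat_exp_minus_right by blast

lemma has_vector_derivative_mat_exp:
  "((\<lambda>t. mat_exp (t *\<^sub>R X)) has_vector_derivative X ** mat_exp (t *\<^sub>R X)) (at t within S)"
proof -
  have "((\<lambda>t. exp (t *\<^sub>R to_sqm X)) has_vector_derivative to_sqm X * exp (t *\<^sub>R to_sqm X)) (at t within S)"
    by (rule has_vector_derivative_at_within[OF exp_scaleR_has_vector_derivative_left])
  from bounded_linear.has_vector_derivative[OF bounded_linear_of_sqm this] show ?thesis
    by (simp add: mat_exp_eq to_sqm_linear_simps times_sqm.rep_eq)
qed

lemma mat_exp_commute: "X ** mat_exp (t *\<^sub>R X) = mat_exp (t *\<^sub>R X) ** X"
proof -
  have "to_sqm (X ** mat_exp (t *\<^sub>R X)) = to_sqm (mat_exp (t *\<^sub>R X) ** X)"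
    by (simp add: to_sqm_mult to_sqm_exp to_sqm_linear_simps exp_times_scaleR_commute del: to_sqm_eq_iff)
  then show ?thesis by simp
qed

text \<open>On a ball of radius \<open>R\<close> the series is dominated by the scalar exponential
  series at \<open>R\<close>, so it converges uniformly there.\<close>

lemma continuous_on_exp_banach: "continuous_on UNIV (exp :: 'a::{real_normed_algebra_1,banach} \<Rightarrow> 'a)"
proof -
  have "continuous_on (ball 0 R) (exp :: 'a \<Rightarrow> 'a)" for R
  proof (rule uniform_limit_theorem)
    have "norm (x ^ n /\<^sub>R fact n) \<le> R ^ n /\<^sub>R fact n" if "x \<in> ball 0 R" for n and x :: 'a
      using that by (auto simp: divide_simps intro!: order.trans[OF norm_power_ineq] power_mono)
    from Weierstrass_m_test[OF this summable_exp_generic]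
    show "uniform_limit (ball 0 R) (\<lambda>n x. \<Sum>k<n. x ^ k /\<^sub>R fact k) (exp :: 'a \<Rightarrow> 'a) sequentially"
      unfolding exp_def .
  qed (auto intro!: always_eventually continuous_intros)
  then have "isCont (exp :: 'a \<Rightarrow> 'a) x" for x
    using continuous_on_eq_continuous_at[of "ball 0 (norm x + 1)" "exp :: 'a \<Rightarrow> 'a"] by force
  then show ?thesis by (simp add: continuous_on_eq_continuous_at)
qed

lemma continuous_on_mat_exp_UNIV: "continuous_on UNIV mat_exp"
proof -
  have "continuous_on UNIV (\<lambda>X. of_sqm (exp (to_sqm X)))"
    by (intro bounded_linear.continuous_on[OF bounded_linear_of_sqm]
        continuous_on_compose2[OF continuous_on_exp_banach]
        bounded_linear.continuous_on[OF bounded_linear_to_sqm]) auto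
  then show ?thesis by (simp add: mat_exp_eq[abs_def])
qed

lemma continuous_on_mat_exp [continuous_intros]:
  "continuous_on S f \<Longrightarrow> continuous_on S (\<lambda>x. mat_exp (f x))"
  by (rule continuous_on_compose2[OF continuous_on_mat_exp_UNIV]) auto

lemma tendsto_mat_exp [tendsto_intros]:
  "(f \<longlongrightarrow> L) F \<Longrightarrow> ((\<lambda>x. mat_exp (f x)) \<longlongrightarrow> mat_exp L) F"
  by (rule continuous_on_tendsto_compose[OF continuous_on_mat_exp_UNIV]) auto

section \<open>Powers near the identity and the limit formula for the exponential\<close>

lemma norm_power_minus_one_le:
  fixes a :: "'a::real_normed_algebra_1"
  assumes "norm (a - 1) \<le> d"
  shows "norm (a ^ j - 1) \<le> (1 + d) ^ j - 1"
proof (induction j)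
  case (Suc j)
  have d: "norm a \<le> 1 + d"
    using norm_triangle_ineq[of "a - 1" 1] assms by simp
  have "a ^ Suc j - 1 = a * (a ^ j - 1) + (a - 1)"
    by (simp add: algebra_simps)
  then have "norm (a ^ Suc j - 1) \<le> norm a * norm (a ^ j - 1) + norm (a - 1)"
    by (metis norm_triangle_le add_right_mono norm_mult_ineq)
  also have "\<dots> \<le> (1 + d) * ((1 + d) ^ j - 1) + d"
    using Suc d assms by (intro add_mono mult_mono) (auto intro: order_trans[OF norm_ge_zero])
  finally show ?case by (simp add: algebra_simps)
qed simp

lemma norm_power_diff_le:
  fixes a b :: "'a::real_normed_algebra_1"
  assumes "norm a \<le> c" "norm b \<le> c" "1 \<le> c"
  shows "norm (a ^ n - b ^ n) \<le> real n * c ^ n * norm (a - b)"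
proof (induction n)
  case (Suc n)
  have "a ^ Suc n - b ^ Suc n = a * (a ^ n - b ^ n) + (a - b) * b ^ n"
    by (simp add: algebra_simps)
  then have "norm (a ^ Suc n - b ^ Suc n) \<le> norm (a * (a ^ n - b ^ n)) + norm ((a - b) * b ^ n)"
    by (simp only: norm_triangle_ineq)
  also have "\<dots> \<le> norm a * norm (a ^ n - b ^ n) + norm (a - b) * norm (b ^ n)"
    by (intro add_mono norm_mult_ineq)
  also have "\<dots> \<le> c * (real n * c ^ n * norm (a - b)) + norm (a - b) * c ^ n"
    using Suc assms by (intro add_mono mult_mono order_trans[OF norm_power_ineq] power_mono) auto
  also have "\<dots> \<le> c * (real n * c ^ n * norm (a - b)) + norm (a - b) * c ^ Suc n"
    using assms by (intro add_left_mono mult_left_mono) auto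
  finally show ?case by (simp add: algebra_simps)
qed simp

lemma exp_div_power_banach:
  fixes x :: "'a::{real_normed_algebra_1,banach}"
  shows "exp (t *\<^sub>R x) ^ n = exp ((real n * t) *\<^sub>R x)"
proof (induction n)
  case (Suc n)
  have "(real (Suc n) * t) *\<^sub>R x = t *\<^sub>R x + (real n * t) *\<^sub>R x"
    by (simp add: algebra_simps)
  then show ?case
    using Suc by (simp add: exp_add_commuting del: of_nat_Suc)
qed simp

text \<open>In this form uniqueness of limits identifies generators, closed sets can be tested along
  sequences, and derivatives can be compared with limits of \<open>k\<close>-th powers.\<close>

lemma has_vector_derivative_imp_sequence:
  fixes f :: "real \<Rightarrow> 'a::real_normed_vector"
  assumes "(f has_vector_derivative D) (at 0)"
  shows "(\<lambda>k. real k *\<^sub>R (f (1 / real k) - f 0)) \<longlonglongrightarrow> D"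
proof -
  have "((\<lambda>h. norm (f (0 + h) - f 0 - h *\<^sub>R D) / norm h) \<longlongrightarrow> 0) (at 0)"
    using assms by (simp add: has_vector_derivative_def has_derivative_at)
  moreover have "norm (f (0 + h) - f 0 - h *\<^sub>R D) / norm h = norm ((1 / (h - 0)) *\<^sub>R (f h - f 0) - D)"
    if "h \<noteq> 0" for h :: real
  proof -
    have "(1 / (h - 0)) *\<^sub>R (f h - f 0) - D = (1 / h) *\<^sub>R (f (0 + h) - f 0 - h *\<^sub>R D)"
      using that by (simp add: scaleR_diff_right)
    then show ?thesis
      by (simp add: divide_inverse mult.commute)
  qed
  then have "\<forall>\<^sub>F h in at 0. norm (f (0 + h) - f 0 - h *\<^sub>R D) / norm h = norm ((1 / (h - 0)) *\<^sub>R (f h - f 0) - D)"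
    by (simp add: eventually_at_filter)
  ultimately have "((\<lambda>h. norm ((1 / (h - 0)) *\<^sub>R (f h - f 0) - D)) \<longlongrightarrow> 0) (at 0)"
    by (rule Lim_transform_eventually)
  then have "((\<lambda>h. (1 / (h - 0)) *\<^sub>R (f h - f 0)) \<longlongrightarrow> D) (at 0)"
    by (simp add: tendsto_norm_zero_iff LIM_zero_iff)
  moreover have "filterlim (\<lambda>k::nat. 1 / real k) (at 0) sequentially"
    by (rule filterlim_atI) (auto simp: lim_1_over_n eventually_sequentially intro!: exI[of _ 1])
  ultimately have "(\<lambda>k. (1 / (1 / real k - 0)) *\<^sub>R (f (1 / real k) - f 0)) \<longlonglongrightarrow> D"
    by (rule filterlim_compose)
  then show ?thesis by simp
qed

text \<open>Compare \<open>m k\<close> with \<open>exp (x/k)\<close>. Both have norm at most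
  \<open>exp (C/k)\<close>, so their \<open>k\<close>-th powers differ by at most
  \<open>exp C\<close> times \<open>k\<close> times the norm of their difference, and this tends to
  0 because the two agree to first order.\<close>

lemma power_tendsto_exp:
  fixes m :: "nat \<Rightarrow> 'a::{real_normed_algebra_1,banach}"
  assumes "(\<lambda>k. real k *\<^sub>R (m k - 1)) \<longlonglongrightarrow> x"
  shows "(\<lambda>k. m k ^ k) \<longlonglongrightarrow> exp x"
proof -
  define e where "e k = exp ((1 / real k) *\<^sub>R x)" for k
  have "(\<lambda>k. real k *\<^sub>R (e k - 1)) \<longlonglongrightarrow> x"
    using has_vector_derivative_imp_sequence[OF exp_scaleR_has_vector_derivative_right[of x 0 UNIV]]
    by (simp add: e_def)
  from tendsto_diff[OF assms this]
  have "(\<lambda>k. real k *\<^sub>R (m k - e k)) \<longlonglongrightarrow> 0"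
    by (simp add: scaleR_diff_right[symmetric])
  from tendsto_norm_zero[OF this]
  have lim0: "(\<lambda>k. real k * norm (m k - e k)) \<longlonglongrightarrow> 0"
    by simp
  obtain C0 where C0: "\<And>k. norm (real k *\<^sub>R (m k - 1)) \<le> C0"
    using convergent_imp_Bseq[of "\<lambda>k. real k *\<^sub>R (m k - 1)"] assms
    by (auto simp: Bseq_def convergent_def)
  define C where "C = max C0 (norm x)"
  have C: "0 \<le> C" by (simp add: C_def le_max_iff_disj)
  have bound: "norm (m k ^ k - exp x) \<le> exp C * (real k * norm (m k - e k))" if "k > 0" for k
  proof -
    have "real k * norm (m k - 1) \<le> C"
      using C0[of k] by (simp add: C_def)
    then have "norm (m k - 1) \<le> C / real k"
      using that by (simp add: field_simps)
    then have "norm (m k) \<le> 1 + C / real k"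
      using norm_triangle_ineq[of "m k - 1" 1] by simp
    then have 1: "norm (m k) \<le> exp (C / real k)"
      using exp_ge_add_one_self[of "C / real k"] by linarith
    have "norm (e k) \<le> exp (norm x / real k)"
      using norm_exp[of "(1 / real k) *\<^sub>R x"] by (simp add: e_def)
    also have "\<dots> \<le> exp (C / real k)"
      by (simp add: C_def divide_right_mono)
    finally have 2: "norm (e k) \<le> exp (C / real k)" .
    have "norm (m k ^ k - e k ^ k) \<le> real k * exp (C / real k) ^ k * norm (m k - e k)"
      using 1 2 C by (intro norm_power_diff_le) auto
    moreover have "e k ^ k = exp x"
      using that by (simp add: e_def exp_div_power_banach)
    moreover have "exp (C / real k) ^ k = exp C"
      using that by (simp add: exp_of_nat_mult[symmetric])
    ultimately show ?thesis by (simp add: algebra_simps)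
  qed
  have "(\<lambda>k. m k ^ k - exp x) \<longlonglongrightarrow> 0"
  proof (rule Lim_null_comparison)
    show "\<forall>\<^sub>F k in sequentially. norm (m k ^ k - exp x) \<le> exp C * (real k * norm (m k - e k))"
      using bound by (auto simp: eventually_sequentially intro!: exI[of _ 1])
    show "(\<lambda>k. exp C * (real k * norm (m k - e k))) \<longlonglongrightarrow> 0"
      using tendsto_mult_right_zero[OF lim0] by simp
  qed
  then show ?thesis by (simp add: LIM_zero_iff)
qed

lemma mat_pow_Suc: "mat_pow A (Suc n) = A ** mat_pow A n"
  by (simp add: mat_pow_def)

lemma mat_pow_0 [simp]: "mat_pow A 0 = mat 1"
  by (simp add: mat_pow_def)

lemma mat_pow_tendsto_mat_exp:
  assumes "(\<lambda>k. real k *\<^sub>R (M k - mat 1)) \<longlonglongrightarrow> X"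
  shows "(\<lambda>k. mat_pow (M k) k) \<longlonglongrightarrow> mat_exp X"
proof -
  have "(\<lambda>k. to_sqm (real k *\<^sub>R (M k - mat 1))) \<longlonglongrightarrow> to_sqm X"
    by (rule bounded_linear.tendsto[OF bounded_linear_to_sqm assms])
  then have "(\<lambda>k. real k *\<^sub>R (to_sqm (M k) - 1)) \<longlonglongrightarrow> to_sqm X"
    by (simp add: to_sqm_linear_simps to_sqm_one)
  from bounded_linear.tendsto[OF bounded_linear_of_sqm power_tendsto_exp[OF this]]
  show ?thesis
    by (simp add: to_sqm_pow[symmetric] to_sqm_exp[symmetric])
qed

text \<open>The local section is multiplicative only inside a ball around the identity, so all
  intermediate powers, not only the \<open>k\<close>-th, must stay there uniformly in
  \<open>k\<close>.\<close>

lemma mat_pow_near_one: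
  assumes "0 < \<epsilon>"
  obtains \<delta> where "0 < \<delta>" "\<And>(A::real^'n^'n) j k. norm (real k *\<^sub>R (A - mat 1)) < \<delta> \<Longrightarrow> j \<le> k \<Longrightarrow> norm (mat_pow A j - mat 1) < \<epsilon>"
proof -
  obtain K1 where K1: "0 < K1" "\<And>x::real^'n^'n. norm (to_sqm x) \<le> norm x * K1"
    using bounded_linear.pos_bounded[OF bounded_linear_to_sqm] by blast
  obtain K2 where K2: "0 < K2" "\<And>x::'n sqm. norm (of_sqm x) \<le> norm x * K2"
    using bounded_linear.pos_bounded[OF bounded_linear_of_sqm] by blast
  have "((\<lambda>t. (exp t - 1) * K2) \<longlongrightarrow> (exp 0 - 1) * K2) (at (0::real))"
    by (intro tendsto_intros)
  then have "\<forall>\<^sub>F t in at (0::real). (exp t - 1) * K2 < \<epsilon>"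
    using assms by (simp add: order_tendstoD)
  then obtain d where d: "d > 0" "\<And>t::real. t \<noteq> 0 \<Longrightarrow> \<bar>t\<bar> < d \<Longrightarrow> (exp t - 1) * K2 < \<epsilon>"
    by (auto simp: eventually_at dist_real_def)
  show ?thesis
  proof
    show "0 < (d / 2) / K1" using d K1 by simp
    fix A :: "real^'n^'n" and j k :: nat
    assume A: "norm (real k *\<^sub>R (A - mat 1)) < (d / 2) / K1" and jk: "j \<le> k"
    show "norm (mat_pow A j - mat 1) < \<epsilon>"
    proof (cases "k = 0")
      case True
      then show ?thesis using jk assms by simp
    next
      case False
      define \<eta> where "\<eta> = (d / 2) / real k"
      have "norm (to_sqm A - 1) \<le> norm (A - mat 1) * K1"
        using K1(2)[of "A - mat 1"] by (simp add: to_sqm_linear_simps to_sqm_one)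
      also have "\<dots> \<le> \<eta>"
        using A[unfolded norm_scaleR] K1(1) False by (simp add: \<eta>_def field_simps)
      finally have *: "norm (to_sqm A ^ j - 1) \<le> (1 + \<eta>) ^ j - 1"
        by (rule norm_power_minus_one_le)
      have "(1 + \<eta>) ^ j \<le> (1 + \<eta>) ^ k"
        using jk d by (intro power_increasing) (auto simp: \<eta>_def)
      also have "\<dots> \<le> exp \<eta> ^ k"
        using d by (intro power_mono) (auto simp: \<eta>_def)
      also have "\<dots> = exp (d / 2)"
        using False by (simp add: \<eta>_def exp_of_nat_mult[symmetric])
      finally have "norm (to_sqm (mat_pow A j - mat 1)) \<le> exp (d / 2) - 1"
        using * by (simp add: to_sqm_linear_simps to_sqm_one to_sqm_pow)
      then have "norm (mat_pow A j - mat 1) \<le> (exp (d / 2) - 1) * K2"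
        using K2(2)[of "to_sqm (mat_pow A j - mat 1)"] K2(1)
        by (smt (verit) mult_right_mono of_sqm_to_sqm)
      also have "\<dots> < \<epsilon>" using d(2)[of "d / 2"] d(1) by simp
      finally show ?thesis .
    qed
  qed
qed

section \<open>Conjugation by exponentials and the bracket\<close>

lemma mat_exp_conj:
  fixes P Q X :: "real^'n^'n"
  assumes "P ** Q = mat 1" "Q ** P = mat 1"
  shows "mat_exp (P ** X ** Q) = P ** mat_exp X ** Q"
proof -
  define p q x where "p = to_sqm P" and "q = to_sqm Q" and "x = to_sqm X"
  have qp: "q * p = 1" and pq: "p * q = 1"
    using assms by (simp_all add: p_def q_def to_sqm_mult[symmetric] to_sqm_one)
  have pw: "(p * x * q) ^ k = p * x ^ k * q" for k
  proof (induction k)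
    case (Suc k)
    have "(p * x * q) ^ Suc k = (p * x * q) * (p * x ^ k * q)"
      by (simp only: power_Suc Suc)
    also have "\<dots> = p * x * (q * p) * x ^ k * q"
      by (simp only: mult.assoc)
    finally show ?case by (simp only: qp mult.assoc power_Suc mult_1_left)
  qed (simp add: pq)
  have "exp (p * x * q) = (\<Sum>k. p * (x ^ k /\<^sub>R fact k) * q)"
    unfolding exp_def by (simp add: pw)
  also have "\<dots> = (\<Sum>k. p * (x ^ k /\<^sub>R fact k)) * q"
    by (rule suminf_mult2[symmetric]) (rule summable_mult[OF summable_exp_generic])
  also have "\<dots> = p * exp x * q"
    unfolding exp_def by (subst suminf_mult[OF summable_exp_generic]) simp
  finally have "to_sqm (mat_exp (P ** X ** Q)) = to_sqm (P ** mat_exp X ** Q)"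
    by (simp add: to_sqm_mult to_sqm_exp p_def q_def x_def)
  then show ?thesis by simp
qed


lemma constant_if_zero_vector_derivative:
  fixes f :: "real \<Rightarrow> 'a::real_normed_vector"
  assumes "\<And>t. (f has_vector_derivative 0) (at t)"
  shows "f t = f 0"
proof -
  have "\<exists>c. \<forall>x\<in>UNIV. f x = c"
    by (rule has_derivative_zero_constant)
       (use assms in \<open>auto simp: has_vector_derivative_def\<close>)
  then show ?thesis by auto
qed

text \<open>The equation \<open>g' = [X, g]\<close> has at most one solution with given
  \<open>g 0\<close>: undoing the conjugation turns \<open>g\<close> into a curve with zero
  derivative. Conjugates are then computed by exhibiting a solution instead of summing a
  series.\<close>

lemma mat_exp_conj_unique:
  fixes g :: "real \<Rightarrow> real^'n^'n"
  assumes g: "\<And>t. (g has_vector_derivative bracket X (g t)) (at t)"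
  shows "mat_exp (t *\<^sub>R X) ** g 0 ** mat_exp (- (t *\<^sub>R X)) = g t"
proof -
  define E where "E t = mat_exp (t *\<^sub>R X)" for t
  define F where "F t = mat_exp (t *\<^sub>R (- X))" for t
  have EF: "E t ** F t = mat 1" for t by (simp add: E_def F_def)
  have EX: "X ** E t = E t ** X" for t unfolding E_def by (rule mat_exp_commute)
  have FX: "X ** F t = F t ** X" for t
    using mat_exp_commute[of "- X" t] by (simp add: F_def mm.minus_left mm.minus_right)
  have dE: "(E has_vector_derivative X ** E t) (at t)" for t
    unfolding E_def by (rule has_vector_derivative_mat_exp)
  have dF: "(F has_vector_derivative (- X) ** F t) (at t)" for t
    unfolding F_def by (rule has_vector_derivative_mat_exp)
  have "((\<lambda>t. F t ** g t ** E t) has_vector_derivative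
      (F t ** g t) ** (X ** E t) + (F t ** bracket X (g t) + ((- X) ** F t) ** g t) ** E t) (at t)" for t
    by (intro mm.has_vector_derivative dE dF g)
  moreover have "(F t ** g t) ** (X ** E t) + (F t ** bracket X (g t) + ((- X) ** F t) ** g t) ** E t = 0" for t
    by (simp add: bracket_def mm.diff_right mm.diff_left mm.add_left mm.minus_left matrix_mul_assoc FX)
  ultimately have "((\<lambda>t. F t ** g t ** E t) has_vector_derivative 0) (at t)" for t
    by simp
  from constant_if_zero_vector_derivative[OF this, of t]
  have "F t ** g t ** E t = g 0" by (simp add: E_def F_def)
  moreover have "E t ** (F t ** g t ** E t) ** F t = (E t ** F t) ** g t ** (E t ** F t)"
    by (simp add: matrix_mul_assoc)
  ultimately have "E t ** g 0 ** F t = (E t ** F t) ** g t ** (E t ** F t)"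
    by simp
  then show ?thesis by (simp add: EF) (simp add: E_def F_def)
qed

lemma bracket_scaleR_left: "bracket (c *\<^sub>R X) Y = c *\<^sub>R bracket X (Y :: real^'n^'n)"
  by (simp add: bracket_def mm.scaleR_left mm.scaleR_right scaleR_diff_right)

lemma bracket_scaleR_right: "bracket X (c *\<^sub>R Y) = c *\<^sub>R bracket X (Y :: real^'n^'n)"
  by (simp add: bracket_def mm.scaleR_left mm.scaleR_right scaleR_diff_right)

lemma bracket_add_left: "bracket (X + Y) Z = bracket X Z + bracket Y (Z :: real^'n^'n)"
  by (simp add: bracket_def mm.add_left mm.add_right)

lemma bracket_add_right: "bracket X (Y + Z) = bracket X Y + bracket X (Z :: real^'n^'n)"
  by (simp add: bracket_def mm.add_left mm.add_right)

lemma bracket_minus_left: "bracket (- X) Y = - bracket X (Y :: real^'n^'n)"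
  by (simp add: bracket_def mm.minus_left mm.minus_right)

lemma bracket_zero [simp]: "bracket 0 Y = 0" "bracket X (0 :: real^'n^'n) = 0"
  by (simp_all add: bracket_def)

lemma bracket_self [simp]: "bracket X X = (0 :: real^'n^'n)"
  by (simp add: bracket_def)

lemma bracket_commute: "bracket X Y = - bracket Y (X :: real^'n^'n)"
  by (simp add: bracket_def)

lemma bracket_jacobi: "bracket X (bracket Y Z) = bracket (bracket X Y) Z + bracket Y (bracket X (Z :: real^'n^'n))"
  by (simp add: bracket_def mm.diff_left mm.diff_right matrix_mul_assoc)

lemma bounded_linear_bracket: "bounded_linear (bracket (X :: real^'n^'n))"
  by (rule linear_conv_bounded_linear[THEN iffD1])
     (auto intro!: linearI simp: bracket_add_right bracket_scaleR_right)

lemma mat_exp_conj_eigen: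
  fixes X Y :: "real^'n^'n"
  assumes "bracket X Y = c *\<^sub>R Y"
  shows "mat_exp X ** Y ** mat_exp (- X) = exp c *\<^sub>R Y"
proof -
  have "((\<lambda>t. exp (t * c) *\<^sub>R Y) has_vector_derivative bracket X (exp (t * c) *\<^sub>R Y)) (at t)" for t
    unfolding bracket_scaleR_right assms
    by (auto intro!: derivative_eq_intros simp: has_vector_derivative_def)
  from mat_exp_conj_unique[OF this, of 1] show ?thesis by simp
qed

lemma mat_exp_conj_nilpotent:
  fixes X Y :: "real^'n^'n"
  assumes "bracket X (bracket X (bracket X Y)) = 0"
  shows "mat_exp X ** Y ** mat_exp (- X) = Y + bracket X Y + (1/2) *\<^sub>R bracket X (bracket X Y)"
proof -
  have "((\<lambda>t. Y + t *\<^sub>R bracket X Y + (t\<^sup>2/2) *\<^sub>R bracket X (bracket X Y)) has_vector_derivative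
      bracket X (Y + t *\<^sub>R bracket X Y + (t\<^sup>2/2) *\<^sub>R bracket X (bracket X Y))) (at t)" for t
    unfolding bracket_scaleR_right bracket_add_right assms
    by (auto intro!: derivative_eq_intros simp: has_vector_derivative_def algebra_simps)
  from mat_exp_conj_unique[OF this, of 1] show ?thesis by (simp add: power2_eq_square)
qed

text \<open>The generator is the derivative at 0, so a short one-sided interval suffices; the proof
  of \<open>D_add\<close> provides no more than that.\<close>

lemma mat_exp_eq_near_zero_imp_eq:
  fixes X Y :: "real^'n^'n"
  assumes "0 < d" "\<And>t. 0 < t \<Longrightarrow> t < d \<Longrightarrow> mat_exp (t *\<^sub>R X) = mat_exp (t *\<^sub>R Y)"
  shows "X = Y"
proof -
  have D: "(\<lambda>k. real k *\<^sub>R (mat_exp ((1 / real k) *\<^sub>R Z) - mat 1)) \<longlonglongrightarrow> Z" for Z :: "real^'n^'n"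
    using has_vector_derivative_imp_sequence[OF has_vector_derivative_mat_exp[of Z 0 UNIV]] by simp
  have "\<forall>\<^sub>F k in sequentially. 1 / real k < d"
    using order_tendstoD(2)[OF lim_1_over_n assms(1)] .
  then have "\<forall>\<^sub>F k in sequentially. real k *\<^sub>R (mat_exp ((1 / real k) *\<^sub>R X) - mat 1)
      = real k *\<^sub>R (mat_exp ((1 / real k) *\<^sub>R Y) - mat 1)"
    using eventually_gt_at_top[of 0] by eventually_elim (simp add: assms(2))
  from LIMSEQ_unique[OF Lim_transform_eventually[OF D[of X] this] D[of Y]] show ?thesis .
qed

lemma continuous_one_parameter_mat_exp:
  fixes d :: "real \<Rightarrow> real^'n^'n"
  assumes cont: "continuous_on UNIV d" and hom: "\<And>s t. d (s + t) = d s ** d t" and d0: "d 0 = mat 1"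
  obtains Y where "\<And>t. d t = mat_exp (t *\<^sub>R Y)"
proof -
  \<comment> \<open>For small \<open>a\<close> the matrix \<open>I a - I 0\<close> is invertible, being close to a multiple of the identity,
    and \<open>d t (I a - I 0) = I (t + a) - I t\<close> shows that \<open>d\<close> is differentiable.\<close>
  define I where "I u = integral {-1..u} d" for u
  have c: "continuous_on S d" for S using cont continuous_on_subset by blast
  have int: "d integrable_on {a..b}" for a b
    by (rule integrable_continuous_interval[OF c])
  \<comment> \<open>The lower limit -1 in \<open>I\<close> keeps 0 in the interior, so the
    derivative there is two-sided.\<close>
  have dI: "(I has_vector_derivative d u) (at u)" if "-1 < u" for u
  proof -
    have "((\<lambda>u. integral {-1..u} d) has_vector_derivative d u) (at u within {-1..u+1})"
      by (rule integral_has_vector_derivative[OF c]) (use that in auto)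
    moreover have "at u within {-1..u+1} = at u"
      by (rule at_within_interior) (use that in auto)
    ultimately show ?thesis by (simp add: I_def[abs_def])
  qed
  have "(\<lambda>k. real k *\<^sub>R (I (1 / real k) - I 0)) \<longlonglongrightarrow> mat 1"
    using has_vector_derivative_imp_sequence[OF dI[of 0]] d0 by simp
  \<comment> \<open>The determinant is a polynomial in the entries, so its limit 1 gives
    invertibility for some large \<open>k\<close>.\<close>
  then have "(\<lambda>k. det (real k *\<^sub>R (I (1 / real k) - I 0))) \<longlonglongrightarrow> det (mat 1 :: real^'n^'n)"
    unfolding det_def by (intro tendsto_intros)
  then have "\<forall>\<^sub>F k in sequentially. 1/2 < det (real k *\<^sub>R (I (1 / real k) - I 0))"
    by (rule order_tendstoD) simp
  from eventually_happens'[OF _ eventually_conj[OF this eventually_gt_at_top[of 0]]]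
  obtain k where k: "k > 0" "det (real k *\<^sub>R (I (1 / real k) - I 0)) > 1/2" by auto
  define a where "a = 1 / real k"
  have a: "0 < a" using k by (simp add: a_def)
  have "invertible (real k *\<^sub>R (I a - I 0))"
    using k by (simp add: invertible_det_nz a_def)
  then obtain Q where Q: "(real k *\<^sub>R (I a - I 0)) ** Q = mat 1"
    by (auto simp: invertible_def)
  have sh: "d t ** (I a - I 0) = I (t + a) - I t" if "-1 < t" for t
  proof -
    have 1: "I (u + a) - I u = integral {u..u+a} d" if "-1 < u" for u
    proof -
      have "integral {-1..u} d + integral {u..u+a} d = integral {-1..u+a} d"
        using that a by (intro Henstock_Kurzweil_Integration.integral_combine int) auto
      then show ?thesis unfolding I_def by (metis add_diff_cancel_left')
    qed
    have "d t ** integral {0..a} d = integral {0..a} (\<lambda>s. d t ** d s)"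
      using integral_linear[OF int[of 0 a] mm.bounded_linear_right[of "d t"]] by (simp add: comp_def)
    also have "\<dots> = integral {0..a} (\<lambda>s. d (s + t))"
      by (simp add: hom[symmetric] add.commute)
    also have "\<dots> = integral {t..t+a} d"
      using integral_shift[OF c[of "{0+t..a+t}"]] by (simp add: comp_def add.commute)
    finally show ?thesis using 1[of 0] 1[of t] that by simp
  qed
  have dt: "d t = (real k *\<^sub>R (I (t + a) - I t)) ** Q" if "-1 < t" for t
  proof -
    have "d t = d t ** ((real k *\<^sub>R (I a - I 0)) ** Q)" by (simp add: Q)
    also have "\<dots> = (real k *\<^sub>R (d t ** (I a - I 0))) ** Q"
      by (simp add: matrix_mul_assoc mm.scaleR_left mm.scaleR_right)
    finally show ?thesis by (simp add: sh[OF that])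
  qed
  define Y where "Y = (real k *\<^sub>R (d a - d 0)) ** Q"
  have "((\<lambda>t. I (t + a)) has_vector_derivative d a) (at 0)"
    using vector_diff_chain_at[of "\<lambda>t. t + a" 1 0 I "d a"] dI[of a] a
    by (simp add: comp_def has_vector_derivative_add_const)
  then have "((\<lambda>t. (real k *\<^sub>R (I (t + a) - I t)) ** Q) has_vector_derivative Y) (at 0)"
    unfolding Y_def
    by (intro bounded_linear.has_vector_derivative[OF mm.bounded_linear_left]
       bounded_linear.has_vector_derivative[OF bounded_linear_scaleR_right] has_vector_derivative_diff dI) auto
  then have d'0: "(d has_vector_derivative Y) (at 0)"
    by (rule has_vector_derivative_transform_within_open[where S = "{-1<..}"]) (auto simp: dt)
  have d': "(d has_vector_derivative d t ** Y) (at t)" for t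
  proof -
    have "((\<lambda>x. d (x - t)) has_vector_derivative Y) (at t)"
      using vector_diff_chain_at[of "\<lambda>x. x - t" 1 t d Y] d'0
      by (simp add: comp_def has_vector_derivative_diff_const)
    then have "((\<lambda>x. d t ** d (x - t)) has_vector_derivative d t ** Y) (at t)"
      by (rule bounded_linear.has_vector_derivative[OF mm.bounded_linear_right])
    then show ?thesis by (simp add: hom[symmetric])
  qed
  have "((\<lambda>t. d t ** mat_exp (t *\<^sub>R (- Y))) has_vector_derivative
      d t ** ((- Y) ** mat_exp (t *\<^sub>R (- Y))) + (d t ** Y) ** mat_exp (t *\<^sub>R (- Y))) (at t)" for t
    by (intro mm.has_vector_derivative d' has_vector_derivative_mat_exp)
  then have "((\<lambda>t. d t ** mat_exp (t *\<^sub>R (- Y))) has_vector_derivative 0) (at t)" for t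
    by (simp add: mm.minus_left mm.minus_right matrix_mul_assoc)
  from constant_if_zero_vector_derivative[OF this]
  have "d t ** mat_exp (t *\<^sub>R (- Y)) ** mat_exp (t *\<^sub>R Y) = mat_exp (t *\<^sub>R Y)" for t by (simp add: d0)
  then have "d t = mat_exp (t *\<^sub>R Y)" for t
    by (simp add: matrix_mul_assoc[symmetric])
  then show ?thesis by (rule that)
qed

section \<open>The exponential map of a real reductive group\<close>

lemma one_parameter_pow:
  fixes \<gamma> :: "real \<Rightarrow> 'g"
  assumes "monoid G" "\<And>t. \<gamma> t \<in> carrier G" "\<And>s t. \<gamma> (s + t) = \<gamma> s \<otimes>\<^bsub>G\<^esub> \<gamma> t" "\<gamma> 0 = \<one>\<^bsub>G\<^esub>"
  shows "\<gamma> t [^]\<^bsub>G\<^esub> (m::nat) = \<gamma> (real m * t)"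
proof (induction m)
  case 0
  then show ?case using assms by (simp add: monoid.nat_pow_0)
next
  case (Suc m)
  then show ?case using assms(3)[of "real m * t" t] assms(1)
    by (simp add: monoid.nat_pow_Suc algebra_simps)
qed

locale real_reductive =
  fixes G :: "('g::topological_space, 'm) monoid_scheme" (structure)
    and p :: "'g \<Rightarrow> real^'n^'n" and R :: "(real^'n^'n) set"
  assumes reductive: "real_reductive_group G p"
    and self_adjoint: "self_adjoint_algebraic_group R"
    and open_image: "openin (top_of_set R) (p ` carrier G)"
begin

sublocale group G
  using reductive by (simp add: real_reductive_group_def)

lemma mult_continuous: "continuous_on (carrier G \<times> carrier G) (\<lambda>(x, y). x \<otimes> y)"
  using reductive by (simp add: real_reductive_group_def)

lemma inv_continuous: "continuous_on (carrier G) (\<lambda>x. inv x)"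
  using reductive by (simp add: real_reductive_group_def)

lemma p_mult: "x \<in> carrier G \<Longrightarrow> y \<in> carrier G \<Longrightarrow> p (x \<otimes> y) = p x ** p y"
  using reductive by (simp add: real_reductive_group_def)

lemma covering: "covering_space (carrier G) p (p ` carrier G)"
  using reductive by (simp add: real_reductive_group_def)

lemma p_continuous: "continuous_on (carrier G) p"
  using covering by (rule covering_space_imp_continuous)

lemma p_in_R: "x \<in> carrier G \<Longrightarrow> p x \<in> R"
  using openin_imp_subset[OF open_image] by auto

lemma R_invertible: "M \<in> R \<Longrightarrow> invertible M"
  using self_adjoint by (auto simp: self_adjoint_algebraic_group_def)

lemma R_mult: "M \<in> R \<Longrightarrow> M' \<in> R \<Longrightarrow> M ** M' \<in> R"
  using self_adjoint by (auto simp: self_adjoint_algebraic_group_def)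

lemma R_one: "mat 1 \<in> R"
  using self_adjoint by (auto simp: self_adjoint_algebraic_group_def)

lemma R_pow: "M \<in> R \<Longrightarrow> mat_pow M k \<in> R"
  by (induction k) (auto simp: mat_pow_Suc R_one R_mult)

text \<open>Polynomial equations pass to the limit; invertibility does not, so it is assumed of the
  limit.\<close>

lemma R_limit:
  assumes "f \<longlonglongrightarrow> M" "\<And>k::nat. f k \<in> R" "invertible M"
  shows "M \<in> R"
proof -
  obtain F where F: "\<forall>h\<in>F. real_polynomial_function h" "R = {X. invertible X \<and> (\<forall>h\<in>F. h X = 0)}"
    using self_adjoint by (auto simp: self_adjoint_algebraic_group_def)
  have "h M = 0" if "h \<in> F" for h
  proof -
    have "isCont h M"
      using F(1) that by (auto intro: continuous_real_polymonial_function)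
    then have "(\<lambda>k. h (f k)) \<longlonglongrightarrow> h M"
      by (rule isCont_tendsto_compose[OF _ assms(1)])
    moreover have "h (f k) = 0" for k using assms(2) F(2) that by auto
    ultimately show ?thesis using LIMSEQ_unique[of "\<lambda>k. 0" 0 "h M"] by simp
  qed
  then show ?thesis using assms(3) F(2) by auto
qed

lemma p_one [simp]: "p \<one> = mat 1"
proof -
  have "invertible (p \<one>)" by (simp add: R_invertible p_in_R)
  then obtain Q where Q: "p \<one> ** Q = mat 1" "Q ** p \<one> = mat 1" by (auto simp: invertible_def)
  have "p \<one> = p \<one> ** p \<one>" using p_mult[of \<one> \<one>] by simp
  then have "Q ** p \<one> = Q ** p \<one> ** p \<one>" by (metis matrix_mul_assoc)
  then show ?thesis by (simp add: Q)
qed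

lemma p_inv_left [simp]: "x \<in> carrier G \<Longrightarrow> p (inv x) ** p x = mat 1"
  using p_mult[of "inv x" x] by simp

lemma p_inv_right [simp]: "x \<in> carrier G \<Longrightarrow> p x ** p (inv x) = mat 1"
  using p_mult[of x "inv x"] by simp

lemma p_pow: "x \<in> carrier G \<Longrightarrow> p (x [^] (k::nat)) = mat_pow (p x) k"
proof (induction k)
  case (Suc k)
  then have "p (x [^] Suc k) = p (x \<otimes> x [^] k)"
    by (subst nat_pow_Suc2) auto
  then show ?case
    using Suc by (simp add: p_mult mat_pow_Suc)
qed simp

lemma mult_continuous_on:
  assumes "continuous_on S f" "continuous_on S g" "\<And>x. x \<in> S \<Longrightarrow> f x \<in> carrier G" "\<And>x. x \<in> S \<Longrightarrow> g x \<in> carrier G"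
  shows "continuous_on S (\<lambda>x. f x \<otimes> g x)"
  using continuous_on_compose2[OF mult_continuous continuous_on_Pair[OF assms(1,2)]] assms(3,4) by auto

lemma pow_continuous_on:
  assumes "continuous_on S f" "\<And>x. x \<in> S \<Longrightarrow> f x \<in> carrier G"
  shows "continuous_on S (\<lambda>x. f x [^] (k::nat))"
  by (induction k) (auto intro!: mult_continuous_on assms)

text \<open>The covering gives an inverse of \<open>p\<close> from an open \<open>W\<close> to a
  sheet \<open>T\<close>, and \<open>W\<close> is open in \<open>R\<close> because the image of
  \<open>p\<close> is; so a whole ball of \<open>R\<close> is available. For multiplicativity
  \<open>T\<close> is shrunk to \<open>T1\<close> with products in \<open>T\<close>: both sides of
  the identity then lie in \<open>T\<close>, where \<open>p\<close> is injective, and have the same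
  image.\<close>

lemma local_section_exists:
  obtains \<sigma> \<epsilon> U where "0 < (\<epsilon>::real)"
    "\<And>M. M \<in> R \<Longrightarrow> norm (M - mat 1) < \<epsilon> \<Longrightarrow> \<sigma> M \<in> carrier G \<and> p (\<sigma> M) = M"
    "continuous_on {M \<in> R. norm (M - mat 1) < \<epsilon>} \<sigma>"
    "\<And>M M'. M \<in> R \<Longrightarrow> norm (M - mat 1) < \<epsilon> \<Longrightarrow> M' \<in> R \<Longrightarrow> norm (M' - mat 1) < \<epsilon> \<Longrightarrow>
        norm (M ** M' - mat 1) < \<epsilon> \<Longrightarrow> \<sigma> (M ** M') = \<sigma> M \<otimes> \<sigma> M'"
    "openin (top_of_set (carrier G)) U" "\<one> \<in> U"
    "\<And>x. x \<in> U \<Longrightarrow> norm (p x - mat 1) < \<epsilon> \<and> \<sigma> (p x) = x"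
proof -
  obtain T W \<sigma> where T: "\<one> \<in> T" "openin (top_of_set (carrier G)) T"
    and W: "p \<one> \<in> W" "openin (top_of_set (p ` carrier G)) W" and hom: "homeomorphism T W p \<sigma>"
    by (rule covering_space_local_homeomorphism[OF covering one_closed])
  have TG: "T \<subseteq> carrier G" using T(2) openin_imp_subset by blast
  have WR: "openin (top_of_set R) W"
    by (rule openin_trans[OF W(2) open_image])
  have \<sigma>1: "\<sigma> (mat 1) = \<one>"
    using homeomorphism_apply1[OF hom T(1)] by simp
  have inj: "x = y" if "x \<in> T" "y \<in> T" "p x = p y" for x y
    by (rule trans[OF homeomorphism_apply1[OF hom that(1), symmetric]])
       (simp only: that(3) homeomorphism_apply1[OF hom that(2)])
  define V where "V = {z \<in> carrier G \<times> carrier G. (\<lambda>(x, y). x \<otimes> y) z \<in> T}"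
  have "openin (top_of_set (carrier G \<times> carrier G)) V"
  proof -
    have "V = carrier G \<times> carrier G \<inter> (\<lambda>(x, y). x \<otimes> y) -` T"
      by (auto simp: V_def)
    moreover have "(\<lambda>(x, y). x \<otimes> y) \<in> carrier G \<times> carrier G \<rightarrow> carrier G"
      by auto
    ultimately show ?thesis
      using continuous_openin_preimage[OF mult_continuous _ T(2)] by (simp only:)
  qed
  then obtain V' where V': "open V'" "V = (carrier G \<times> carrier G) \<inter> V'"
    by (auto simp: openin_open)
  have "(\<one>, \<one>) \<in> V" using T(1) by (simp add: V_def)
  then have "(\<one>, \<one>) \<in> V'" by (simp add: V'(2))
  from open_prod_elim[OF V'(1) this]
  obtain A B where AB': "open A" "open B" "(\<one>, \<one>) \<in> A \<times> B" "A \<times> B \<subseteq> V'" .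
  then have AB: "open A" "open B" "\<one> \<in> A" "\<one> \<in> B" "A \<times> B \<subseteq> V'"
    by (simp_all only: mem_Sigma_iff)
  define T1 where "T1 = T \<inter> (A \<inter> B)"
  have T1: "openin (top_of_set (carrier G)) T1" "\<one> \<in> T1"
    unfolding T1_def using T AB by (auto intro!: openin_Int_open[OF T(2) open_Int])
  have T1mult: "x \<otimes> y \<in> T" if "x \<in> T1" "y \<in> T1" for x y
  proof -
    have "(x, y) \<in> A \<times> B" "x \<in> carrier G" "y \<in> carrier G"
      using that TG by (auto simp: T1_def)
    then have "(x, y) \<in> V" unfolding V'(2) using AB(5) by blast
    then show ?thesis by (simp add: V_def)
  qed
  have "openin (top_of_set T) T1"
    by (rule openin_subset_trans[OF T1(1) _ TG]) (simp add: T1_def)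
  then have "openin (top_of_set W) (W \<inter> \<sigma> -` T1)"
    using hom by (intro continuous_openin_preimage[of W \<sigma> T]) (auto simp: homeomorphism_def)
  then have "openin (top_of_set R) (W \<inter> \<sigma> -` T1)"
    by (rule openin_trans[OF _ WR])
  moreover have "mat 1 \<in> W \<inter> \<sigma> -` T1" using W(1) \<sigma>1 T1(2) by simp
  ultimately obtain \<epsilon> where \<epsilon>: "0 < \<epsilon>" "\<And>M. M \<in> R \<Longrightarrow> dist M (mat 1) < \<epsilon> \<Longrightarrow> M \<in> W \<inter> \<sigma> -` T1"
    unfolding openin_euclidean_subtopology_iff by meson
  then have W1: "M \<in> W" "\<sigma> M \<in> T1" if "M \<in> R" "norm (M - mat 1) < \<epsilon>" for M
    using that by (auto simp: dist_norm)
  have sec: "\<sigma> M \<in> carrier G \<and> p (\<sigma> M) = M" if "M \<in> R" "norm (M - mat 1) < \<epsilon>" for M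
    using W1[OF that] homeomorphism_apply2[OF hom] TG by (auto simp: T1_def)
  have secmult: "\<sigma> (M ** M') = \<sigma> M \<otimes> \<sigma> M'" if "M \<in> R" "norm (M - mat 1) < \<epsilon>" "M' \<in> R" "norm (M' - mat 1) < \<epsilon>"
      "norm (M ** M' - mat 1) < \<epsilon>" for M M'
    proof (rule inj)
      have "M ** M' \<in> R" by (simp add: R_mult that)
      then show "\<sigma> (M ** M') \<in> T" using W1(2)[of "M ** M'"] that by (simp add: T1_def)
      show "\<sigma> M \<otimes> \<sigma> M' \<in> T" using W1(2) that T1mult by blast
      show "p (\<sigma> (M ** M')) = p (\<sigma> M \<otimes> \<sigma> M')"
        using sec[of "M ** M'"] sec[of M] sec[of M'] that \<open>M ** M' \<in> R\<close> by (simp add: p_mult)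
    qed
  define U where "U = T \<inter> (carrier G \<inter> p -` ball (mat 1) \<epsilon>)"
  show ?thesis
  proof
    show "continuous_on {M \<in> R. norm (M - mat 1) < \<epsilon>} \<sigma>"
      using hom W1(1) by (auto simp: homeomorphism_def intro: continuous_on_subset)
    show "openin (top_of_set (carrier G)) U"
      unfolding U_def
      by (intro openin_Int T continuous_openin_preimage_gen[OF p_continuous]) simp
    show "\<one> \<in> U" using T \<epsilon> by (simp add: U_def)
    show "norm (p x - mat 1) < \<epsilon> \<and> \<sigma> (p x) = x" if "x \<in> U" for x
      using that homeomorphism_apply1[OF hom] by (auto simp: U_def dist_norm norm_minus_commute)
  qed (fact \<epsilon>(1) sec secmult)+
qed

end

lemma mat_pow_mat_exp: "mat_pow (mat_exp (t *\<^sub>R X)) m = mat_exp ((real m * t) *\<^sub>R X)"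
proof (induction m)
  case (Suc m)
  have "mat_exp (t *\<^sub>R X) ** mat_exp ((real m * t) *\<^sub>R X) = mat_exp ((t + real m * t) *\<^sub>R X)"
    by (rule mat_exp_scaleR_add[symmetric])
  then show ?case by (simp add: mat_pow_Suc Suc algebra_simps)
qed simp

text \<open>Here \<open>\<sigma>\<close> is a local inverse of the covering near the identity, and a local homomorphism.\<close>

locale reductive_section = real_reductive G p R
  for G :: "('g::topological_space, 'm) monoid_scheme" (structure)
    and p :: "'g \<Rightarrow> real^'n^'n" and R +
  fixes \<sigma> :: "real^'n^'n \<Rightarrow> 'g" and \<epsilon> :: real and U :: "'g set"
  assumes eps_pos: "0 < \<epsilon>"
    and section_props: "\<And>M. M \<in> R \<Longrightarrow> norm (M - mat 1) < \<epsilon> \<Longrightarrow> \<sigma> M \<in> carrier G \<and> p (\<sigma> M) = M"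
    and section_continuous: "continuous_on {M \<in> R. norm (M - mat 1) < \<epsilon>} \<sigma>"
    and section_mult: "\<And>M M'. M \<in> R \<Longrightarrow> norm (M - mat 1) < \<epsilon> \<Longrightarrow> M' \<in> R \<Longrightarrow> norm (M' - mat 1) < \<epsilon> \<Longrightarrow>
        norm (M ** M' - mat 1) < \<epsilon> \<Longrightarrow> \<sigma> (M ** M') = \<sigma> M \<otimes> \<sigma> M'"
    and U_open: "openin (top_of_set (carrier G)) U" and one_in_U: "\<one> \<in> U"
    and U_section: "\<And>x. x \<in> U \<Longrightarrow> norm (p x - mat 1) < \<epsilon> \<and> \<sigma> (p x) = x"
begin

abbreviation \<gg> :: "(real^'n^'n) set" where "\<gg> \<equiv> lie_algebra G p (carrier G)"

abbreviation E :: "real^'n^'n \<Rightarrow> 'g" where "E \<equiv> group_exp G p"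

lemma section_one: "\<sigma> (mat 1) = \<one>"
  using U_section[OF one_in_U] by simp

section \<open>Lifting one-parameter groups of matrices to \<open>G\<close>\<close>

lemma hom_zero:
  assumes "\<And>t. \<gamma> t \<in> carrier G" "\<And>s t::real. \<gamma> (s + t) = \<gamma> s \<otimes> \<gamma> t"
  shows "\<gamma> 0 = \<one>"
proof -
  have "\<gamma> 0 \<otimes> \<gamma> 0 = \<gamma> 0 \<otimes> \<one>" using assms(2)[of 0 0] assms(1)[of 0] by simp
  then show ?thesis using assms(1)[of 0] by (simp del: r_one)
qed

lemma eventually_in_U:
  fixes \<gamma> :: "'b::topological_space \<Rightarrow> 'g"
  assumes "continuous_on S \<gamma>" "\<And>t. t \<in> S \<Longrightarrow> \<gamma> t \<in> carrier G" "open S" "a \<in> S" "\<gamma> a = \<one>"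
  shows "\<forall>\<^sub>F t in nhds a. \<gamma> t \<in> U"
proof -
  have "openin (top_of_set S) (S \<inter> \<gamma> -` U)"
    using continuous_openin_preimage[OF assms(1) _ U_open] assms(2) by blast
  then have "open (S \<inter> \<gamma> -` U)"
    using assms(3) by (simp add: openin_open_eq)
  moreover have "a \<in> S \<inter> \<gamma> -` U" using assms(4,5) one_in_U by simp
  ultimately have "\<forall>\<^sub>F t in nhds a. t \<in> S \<inter> \<gamma> -` U"
    by (rule eventually_nhds_in_open)
  then show ?thesis by (rule eventually_mono) simp
qed

lemma one_parameter_near_zero:
  assumes "continuous_on UNIV \<gamma>" "\<And>t. \<gamma> t \<in> carrier G" "\<And>s t::real. \<gamma> (s + t) = \<gamma> s \<otimes> \<gamma> t"
  obtains d where "0 < d" "\<And>t. \<bar>t\<bar> < d \<Longrightarrow> \<gamma> t \<in> U"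
proof -
  have "\<forall>\<^sub>F t in nhds 0. \<gamma> t \<in> U"
    by (rule eventually_in_U[OF assms(1)]) (simp_all add: assms hom_zero)
  then show ?thesis using that by (auto simp: eventually_nhds_metric dist_real_def)
qed

text \<open>Near 0 both curves are \<open>\<sigma>\<close> of the same matrix; the value at
  \<open>t\<close> is the \<open>m\<close>-th power of the value at \<open>t/m\<close>, which is
  near 0 for large \<open>m\<close>.\<close>

lemma one_parameter_unique:
  assumes 1: "continuous_on UNIV \<gamma>" "\<And>t. \<gamma> t \<in> carrier G" "\<And>s t::real. \<gamma> (s + t) = \<gamma> s \<otimes> \<gamma> t"
    and 2: "continuous_on UNIV \<gamma>'" "\<And>t. \<gamma>' t \<in> carrier G" "\<And>s t::real. \<gamma>' (s + t) = \<gamma>' s \<otimes> \<gamma>' t"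
    and p: "\<And>t. p (\<gamma> t) = p (\<gamma>' t)"
  shows "\<gamma> t = \<gamma>' t"
proof -
  obtain d where d: "0 < d" "\<And>t. \<bar>t\<bar> < d \<Longrightarrow> \<gamma> t \<in> U" 
    using one_parameter_near_zero[OF 1] by blast
  obtain d' where d': "0 < d'" "\<And>t. \<bar>t\<bar> < d' \<Longrightarrow> \<gamma>' t \<in> U" 
    using one_parameter_near_zero[OF 2] by blast
  have near: "\<gamma> s = \<gamma>' s" if "\<bar>s\<bar> < d" "\<bar>s\<bar> < d'" for s
  proof -
    have "\<gamma> s = \<sigma> (p (\<gamma> s))" using U_section[OF d(2)] that by simp
    also have "\<dots> = \<gamma>' s" using U_section[OF d'(2)] that p by simp
    finally show ?thesis .
  qed
  define c where "c = min d d'"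
  have c: "0 < c" "c \<le> d" "c \<le> d'" using d(1) d'(1) by (auto simp: c_def)
  obtain m :: nat where m': "\<bar>t\<bar> / c < real m" using reals_Archimedean2 by blast
  have "0 \<le> \<bar>t\<bar> / c" using c(1) by simp
  then have "0 < real m" using m' by linarith
  then have m: "m > 0" "\<bar>t\<bar> / real m < c" using m' c(1) by (auto simp: field_simps)
  have "\<gamma> t = \<gamma> (t / real m) [^] m"
    using m one_parameter_pow[OF monoid_axioms 1(2,3) hom_zero[OF 1(2,3)]] by simp
  also have "\<gamma> (t / real m) = \<gamma>' (t / real m)" using near[of "t / real m"] m c by simp
  also have "\<gamma>' (t / real m) [^] m = \<gamma>' t"
    using m one_parameter_pow[OF monoid_axioms 2(2,3) hom_zero[OF 2(2,3)]] by simp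
  finally show ?thesis .
qed

lemma section_pow:
  assumes "M \<in> R" "\<And>i. i \<le> k \<Longrightarrow> norm (mat_pow M i - mat 1) < \<epsilon>"
  shows "j \<le> k \<Longrightarrow> \<sigma> (mat_pow M j) = \<sigma> M [^] j"
proof (induction j)
  case (Suc j)
  have M: "norm (M - mat 1) < \<epsilon>" using assms(2)[of 1] Suc by (simp add: mat_pow_def)
  have "\<sigma> (mat_pow M (Suc j)) = \<sigma> M \<otimes> \<sigma> (mat_pow M j)"
    unfolding mat_pow_Suc
    using assms(2)[of j] assms(2)[of "Suc j"] Suc M assms(1)
    by (intro section_mult R_pow) (auto simp: mat_pow_Suc)
  also have "\<dots> = \<sigma> M [^] Suc j"
    using Suc section_props[OF assms(1) M] by (subst nat_pow_Suc2) auto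
  finally show ?case .
qed (simp add: section_one)

lemma one_parameter_exists:
  assumes X: "\<And>t. mat_exp (t *\<^sub>R X) \<in> R"
  shows "\<exists>\<gamma>. one_parameter_subgroup G p X \<gamma>"
proof -
  have "\<forall>\<^sub>F t in nhds 0. norm (mat_exp (t *\<^sub>R X) - mat 1) < \<epsilon>"
  proof -
    have "((\<lambda>t. norm (mat_exp (t *\<^sub>R X) - mat 1)) \<longlongrightarrow> norm (mat_exp (0 *\<^sub>R X) - mat 1)) (nhds 0)"
      by (intro tendsto_intros filterlim_ident)
    then show ?thesis using eps_pos by (simp add: order_tendstoD)
  qed
  then obtain d where d: "0 < d" "\<And>t. \<bar>t\<bar> < d \<Longrightarrow> norm (mat_exp (t *\<^sub>R X) - mat 1) < \<epsilon>"
    by (auto simp: eventually_nhds_metric dist_real_def)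
  define \<tau> where "\<tau> = d / 2"
  have \<tau>: "0 < \<tau>" "\<And>t. \<bar>t\<bar> \<le> \<tau> \<Longrightarrow> norm (mat_exp (t *\<^sub>R X) - mat 1) < \<epsilon>"
    using d by (auto simp: \<tau>_def)
  define \<gamma>0 where "\<gamma>0 t = \<sigma> (mat_exp (t *\<^sub>R X))" for t
  have \<gamma>0c: "\<gamma>0 t \<in> carrier G" and p\<gamma>0: "p (\<gamma>0 t) = mat_exp (t *\<^sub>R X)" if "\<bar>t\<bar> \<le> \<tau>" for t
    using section_props[OF X \<tau>(2)[OF that]] by (simp_all add: \<gamma>0_def)
  have \<gamma>0_add: "\<gamma>0 (s + t) = \<gamma>0 s \<otimes> \<gamma>0 t" if "\<bar>s\<bar> \<le> \<tau>" "\<bar>t\<bar> \<le> \<tau>" "\<bar>s + t\<bar> \<le> \<tau>" for s t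
    unfolding \<gamma>0_def mat_exp_scaleR_add
    by (rule section_mult) (use that \<tau>(2) X in \<open>auto simp: mat_exp_scaleR_add[symmetric]\<close>)
  have \<gamma>0_pow: "\<gamma>0 t [^] m = \<gamma>0 (real m * t)" if "real m * \<bar>t\<bar> \<le> \<tau>" for m t
    using that
  proof (induction m)
    case 0
    then show ?case by (simp add: \<gamma>0_def section_one)
  next
    case (Suc m)
    have le: "real m * \<bar>t\<bar> \<le> \<tau>" "\<bar>t\<bar> \<le> \<tau>"
    proof -
      have "real m * \<bar>t\<bar> + \<bar>t\<bar> \<le> \<tau>" using Suc.prems by (simp add: algebra_simps)
      moreover have "0 \<le> real m * \<bar>t\<bar>" by simp
      ultimately show "real m * \<bar>t\<bar> \<le> \<tau>" "\<bar>t\<bar> \<le> \<tau>" by linarith+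
    qed
    have "\<gamma>0 (real m * t + t) = \<gamma>0 (real m * t) \<otimes> \<gamma>0 t"
    proof (rule \<gamma>0_add)
      have "\<bar>real m * t + t\<bar> = real (Suc m) * \<bar>t\<bar>"
        by (metis abs_mult abs_of_nat of_nat_Suc ring_class.ring_distribs(2) mult_1 add.commute)
      then show "\<bar>real m * t + t\<bar> \<le> \<tau>" using Suc.prems by simp
    qed (use le in \<open>auto simp: abs_mult\<close>)
    then show ?case using Suc.IH le by (simp add: algebra_simps)
  qed
  \<comment> \<open>The local one-parameter group \<open>\<gamma>0\<close> on \<open>[-\<tau>, \<tau>]\<close> extends by \<open>\<gamma> t = \<gamma>0 (t / m)\<^sup>m\<close> for any large \<open>m\<close>.\<close>
  define n where "n t = nat \<lceil>\<bar>t\<bar> / \<tau>\<rceil> + 1" for t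
  have n: "\<bar>t\<bar> \<le> real (n t) * \<tau>" "n t > 0" for t
  proof -
    have "\<bar>t\<bar> / \<tau> \<le> real (n t)" unfolding n_def by linarith
    then show "\<bar>t\<bar> \<le> real (n t) * \<tau>" using \<tau>(1) by (simp add: field_simps)
  qed (simp add: n_def)
  define \<gamma> where "\<gamma> t = \<gamma>0 (t / real (n t)) [^] n t" for t
  \<comment> \<open>Independence of the subdivision: \<open>m\<close> and \<open>n t\<close> are
    each compared with their product, a common refinement.\<close>
  have two: "\<gamma>0 (t / real m) [^] m = \<gamma>0 (t / real (m * k)) [^] (m * k)"
    if "m > 0" "k > 0" "\<bar>t\<bar> \<le> real m * \<tau>" for t and m k :: nat
  proof -
    have a: "real k * \<bar>t / real (m * k)\<bar> \<le> \<tau>"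
      using that by (simp add: abs_mult divide_simps mult.commute)
    have "\<bar>t / real (m * k)\<bar> \<le> real k * \<bar>t / real (m * k)\<bar>"
      using that mult_right_mono[of 1 "real k" "\<bar>t / real (m * k)\<bar>"] by simp
    then have "\<gamma>0 (t / real (m * k)) \<in> carrier G" using a by (intro \<gamma>0c) linarith
    then have "\<gamma>0 (t / real (m * k)) [^] (m * k) = (\<gamma>0 (t / real (m * k)) [^] k) [^] m"
      by (simp add: nat_pow_pow mult.commute)
    also have "\<gamma>0 (t / real (m * k)) [^] k = \<gamma>0 (t / real m)"
      using \<gamma>0_pow[OF a] that by simp
    finally show ?thesis by simp
  qed
  have \<gamma>_eq: "\<gamma> t = \<gamma>0 (t / real m) [^] m" if "m > 0" "\<bar>t\<bar> \<le> real m * \<tau>" for t m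
    using two[of m "n t" t] two[of "n t" m t] n[of t] that by (simp add: \<gamma>_def mult.commute)
  have small: "\<bar>t / real m\<bar> \<le> \<tau>" if "m > 0" "\<bar>t\<bar> \<le> real m * \<tau>" for t and m :: nat
    using that by (simp add: divide_simps mult.commute)
  have "one_parameter_subgroup G p X \<gamma>"
    unfolding one_parameter_subgroup_def
  proof (intro conjI allI)
    show "\<gamma> t \<in> carrier G" for t
      unfolding \<gamma>_def using small[OF n(2,1)] \<gamma>0c by blast
    show "p (\<gamma> t) = mat_exp (t *\<^sub>R X)" for t
      unfolding \<gamma>_def using small[OF n(2,1), of t] \<gamma>0c p\<gamma>0 n(2)[of t]
      by (simp add: p_pow mat_pow_mat_exp)
    show "\<gamma> (s + t) = \<gamma> s \<otimes> \<gamma> t" for s t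
    proof -
      define m where "m = n s + n t"
      have "0 \<le> real (n s) * \<tau>" "0 \<le> real (n t) * \<tau>" using \<tau>(1) by simp_all
      then have m: "m > 0" "\<bar>s\<bar> \<le> real m * \<tau>" "\<bar>t\<bar> \<le> real m * \<tau>" "\<bar>s + t\<bar> \<le> real m * \<tau>"
        using n(1)[of s] n(1)[of t] n(2)[of s] by (auto simp: m_def algebra_simps)
      define x y where "x = \<gamma>0 (s / real m)" and "y = \<gamma>0 (t / real m)"
      have xy: "x \<in> carrier G" "y \<in> carrier G" using small m \<gamma>0c by (auto simp: x_def y_def)
      have sm: "\<bar>s / real m\<bar> \<le> \<tau>" "\<bar>t / real m\<bar> \<le> \<tau>" "\<bar>s / real m + t / real m\<bar> \<le> \<tau>"
        "\<bar>t / real m + s / real m\<bar> \<le> \<tau>"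
        using small[OF m(1,2)] small[OF m(1,3)] small[OF m(1,4)]
        by (simp_all add: add_divide_distrib add.commute)
      \<comment> \<open>Both orders give \<open>\<gamma>0\<close> of the same real number, so
        \<open>x\<close> and \<open>y\<close> commute and the \<open>m\<close>-th power of the
        product splits.\<close>
      have a: "\<gamma>0 ((s + t) / real m) = x \<otimes> y" "\<gamma>0 ((t + s) / real m) = y \<otimes> x"
        unfolding add_divide_distrib x_def y_def
        by (rule \<gamma>0_add[OF sm(1,2,3)], rule \<gamma>0_add[OF sm(2,1,4)])
      then have "x \<otimes> y = y \<otimes> x" by (simp add: add.commute)
      then have "(x \<otimes> y) [^] m = x [^] m \<otimes> y [^] m"
        using xy by (rule pow_mult_distrib)
      then show ?thesis
        using \<gamma>_eq[OF m(1,2)] \<gamma>_eq[OF m(1,3)] \<gamma>_eq[OF m(1,4)] a(1) by (simp add: x_def y_def)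
    qed
    show "continuous_on UNIV \<gamma>"
    proof -
      have "isCont \<gamma> t" for t
      proof -
        \<comment> \<open>One more than \<open>n t\<close> makes the bound strict, so the same
          \<open>m\<close> serves on a neighbourhood of \<open>t\<close>.\<close>
        define m where "m = n t + 1"
        have m: "m > 0" "\<bar>t\<bar> < real m * \<tau>" using n(1)[of t] \<tau>(1) by (auto simp: m_def algebra_simps)
        define S where "S = {- (real m * \<tau>)<..<real m * \<tau>}"
        have S: "open S" "t \<in> S" using m by (auto simp: S_def)
        have c0: "continuous_on S (\<lambda>s. \<gamma>0 (s / real m))"
          unfolding \<gamma>0_def
        proof (rule continuous_on_compose2[OF section_continuous])
          show "continuous_on S (\<lambda>s. mat_exp ((s / real m) *\<^sub>R X))"
            by (intro continuous_intros) (use m in auto)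
          show "(\<lambda>s. mat_exp ((s / real m) *\<^sub>R X)) ` S \<subseteq> {M \<in> R. norm (M - mat 1) < \<epsilon>}"
            using X \<tau>(2) small[OF m(1)] by (auto simp: S_def)
        qed
        have "continuous_on S (\<lambda>s. \<gamma>0 (s / real m) [^] m)"
          by (rule pow_continuous_on[OF c0]) (use small[OF m(1)] \<gamma>0c in \<open>auto simp: S_def\<close>)
        then have "continuous_on S \<gamma>"
          by (rule continuous_on_eq) (use \<gamma>_eq[OF m(1)] in \<open>auto simp: S_def\<close>)
        then show ?thesis using S by (simp add: continuous_on_eq_continuous_at)
      qed
      then show ?thesis by (simp add: continuous_on_eq_continuous_at)
    qed
  qed
  then show ?thesis by blast
qed

end

section \<open>The product formula and the bracket as limits\<close>

lemma mat_exp_mult_vector_derivative: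
  "((\<lambda>t. mat_exp (t *\<^sub>R X) ** mat_exp (t *\<^sub>R Y)) has_vector_derivative X + Y) (at 0)"
  using mm.has_vector_derivative[OF has_vector_derivative_mat_exp[of X 0 UNIV]
      has_vector_derivative_mat_exp[of Y 0 UNIV]]
  by (simp add: add.commute)

lemma mat_exp_mult_sequence:
  "(\<lambda>k. real k *\<^sub>R (mat_exp ((1 / real k) *\<^sub>R X) ** mat_exp ((1 / real k) *\<^sub>R Y) - mat 1)) \<longlonglongrightarrow> X + Y"
  using has_vector_derivative_imp_sequence[OF mat_exp_mult_vector_derivative[of X Y]] by simp

lemma mat_exp_trotter:
  "(\<lambda>k. mat_pow (mat_exp ((1 / real k) *\<^sub>R X) ** mat_exp ((1 / real k) *\<^sub>R Y)) k) \<longlonglongrightarrow> mat_exp (X + Y)"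
  by (rule mat_pow_tendsto_mat_exp[OF mat_exp_mult_sequence])

text \<open>With the bracket as such a limit, a closed subspace stable under these conjugations is
  stable under brackets, and a bounded linear map that intertwines conjugations preserves
  brackets.\<close>

lemma mat_exp_conj_sequence:
  "(\<lambda>k. real k *\<^sub>R (mat_exp ((1 / real k) *\<^sub>R X) ** Y ** mat_exp (- ((1 / real k) *\<^sub>R X)) - Y)) \<longlonglongrightarrow> bracket X Y"
proof -
  have "((\<lambda>t. mat_exp (t *\<^sub>R X) ** Y) has_vector_derivative (X ** mat_exp (0 *\<^sub>R X)) ** Y) (at 0)"
    by (rule bounded_linear.has_vector_derivative[OF mm.bounded_linear_left has_vector_derivative_mat_exp])
  then have "((\<lambda>t. mat_exp (t *\<^sub>R X) ** Y ** mat_exp (t *\<^sub>R (- X))) has_vector_derivative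
      (mat_exp (0 *\<^sub>R X) ** Y) ** ((- X) ** mat_exp (0 *\<^sub>R (- X))) +
      ((X ** mat_exp (0 *\<^sub>R X)) ** Y) ** mat_exp (0 *\<^sub>R (- X))) (at 0)"
    by (rule mm.has_vector_derivative[OF _ has_vector_derivative_mat_exp])
  from has_vector_derivative_imp_sequence[OF this]
  show ?thesis by (simp add: bracket_def mm.minus_right)
qed

section \<open>The Lie algebra of \<open>G\<close> and rules for its exponential\<close>

context reductive_section
begin

text \<open>A condition on matrices alone, and with \<open>R\<close> in place of the image of
  \<open>p\<close>: openness of the image enters here, through the lift in
  \<open>one_parameter_exists\<close>.\<close>

lemma mem_lie_algebra: "X \<in> \<gg> \<longleftrightarrow> (\<forall>t. mat_exp (t *\<^sub>R X) \<in> R)"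
proof
  assume "X \<in> \<gg>"
  then obtain \<gamma> where "one_parameter_subgroup G p X \<gamma>" by (auto simp: lie_algebra_def)
  then show "\<forall>t. mat_exp (t *\<^sub>R X) \<in> R"
    using p_in_R by (metis one_parameter_subgroup_def)
next
  assume "\<forall>t. mat_exp (t *\<^sub>R X) \<in> R"
  then obtain \<gamma> where "one_parameter_subgroup G p X \<gamma>" using one_parameter_exists by blast
  then show "X \<in> \<gg>" by (auto simp: lie_algebra_def one_parameter_subgroup_def)
qed

text \<open>Resolves the definite description in \<open>group_exp\<close>: lifts are unique, and
  \<open>s \<mapsto> \<gamma> (s * t)\<close> lifts the group generated by
  \<open>t *\<^sub>R X\<close>.\<close>

lemma E_scaleR_one_parameter:
  assumes \<gamma>: "one_parameter_subgroup G p X \<gamma>"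
  shows "E (t *\<^sub>R X) = \<gamma> t"
proof -
  have "one_parameter_subgroup G p (t *\<^sub>R X) (\<lambda>s. \<gamma> (s * t))"
    using \<gamma> unfolding one_parameter_subgroup_def
    by (auto simp: distrib_right intro!: continuous_intros continuous_on_compose2[of UNIV \<gamma>])
  moreover have "\<delta> = \<delta>'" if "one_parameter_subgroup G p Y \<delta>" "one_parameter_subgroup G p Y \<delta>'" for \<delta> \<delta>' Y
    using that one_parameter_unique[of \<delta> \<delta>'] unfolding one_parameter_subgroup_def by (intro ext) auto
  ultimately have "(THE \<gamma>. one_parameter_subgroup G p (t *\<^sub>R X) \<gamma>) = (\<lambda>s. \<gamma> (s * t))"
    by (intro the_equality) blast+
  then show ?thesis by (simp add: group_exp_def)
qed

lemma E_one_parameter: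
  assumes "X \<in> \<gg>"
  shows "one_parameter_subgroup G p X (\<lambda>t. E (t *\<^sub>R X))"
proof -
  obtain \<gamma> where \<gamma>: "one_parameter_subgroup G p X \<gamma>" using assms by (auto simp: lie_algebra_def)
  then have "(\<lambda>t. E (t *\<^sub>R X)) = \<gamma>" using E_scaleR_one_parameter by blast
  then show ?thesis using \<gamma> by simp
qed

lemma E_scaleR_closed [simp]: "X \<in> \<gg> \<Longrightarrow> E (t *\<^sub>R X) \<in> carrier G"
  using E_one_parameter by (simp add: one_parameter_subgroup_def)

lemma E_closed [simp]: "X \<in> \<gg> \<Longrightarrow> E X \<in> carrier G"
  using E_scaleR_closed[of X 1] by simp

lemma E_scaleR_add: "X \<in> \<gg> \<Longrightarrow> E ((s + t) *\<^sub>R X) = E (s *\<^sub>R X) \<otimes> E (t *\<^sub>R X)"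
  using E_one_parameter unfolding one_parameter_subgroup_def by blast

lemma p_E_scaleR: "X \<in> \<gg> \<Longrightarrow> p (E (t *\<^sub>R X)) = mat_exp (t *\<^sub>R X)"
  using E_one_parameter by (simp add: one_parameter_subgroup_def)

lemma p_E: "X \<in> \<gg> \<Longrightarrow> p (E X) = mat_exp X"
  using p_E_scaleR[of X 1] by simp

lemma E_scaleR_continuous: "X \<in> \<gg> \<Longrightarrow> continuous_on UNIV (\<lambda>t. E (t *\<^sub>R X))"
  using E_one_parameter by (simp add: one_parameter_subgroup_def)

text \<open>The tool for identities in \<open>G\<close>: once a candidate is known to be a
  continuous one-parameter subgroup, equality of its matrices suffices.\<close>

lemma E_unique:
  assumes "continuous_on UNIV \<gamma>" "\<And>t. \<gamma> t \<in> carrier G" "\<And>s t. \<gamma> (s + t) = \<gamma> s \<otimes> \<gamma> t"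
    "\<And>t. p (\<gamma> t) = mat_exp (t *\<^sub>R X)"
  shows "X \<in> \<gg>" "E (t *\<^sub>R X) = \<gamma> t"
proof -
  have *: "one_parameter_subgroup G p X \<gamma>" using assms by (auto simp: one_parameter_subgroup_def)
  then show "E (t *\<^sub>R X) = \<gamma> t" by (rule E_scaleR_one_parameter)
  show "X \<in> \<gg>" using * assms by (auto simp: lie_algebra_def)
qed

lemma lie_algebra_zero: "0 \<in> \<gg>"
  by (simp add: mem_lie_algebra R_one)

lemma E_zero [simp]: "E 0 = \<one>"
  using hom_zero[of "\<lambda>t. E (t *\<^sub>R 0)"] E_scaleR_add[OF lie_algebra_zero] lie_algebra_zero by simp

lemma lie_algebra_scaleR: "X \<in> \<gg> \<Longrightarrow> c *\<^sub>R X \<in> \<gg>"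
  by (simp add: mem_lie_algebra)

text \<open>The approximants of the product formula lie in \<open>R\<close>, and their limit is
  invertible as an exponential.\<close>

lemma lie_algebra_add: 
  assumes "X \<in> \<gg>" "Y \<in> \<gg>"
  shows "X + Y \<in> \<gg>"
  unfolding mem_lie_algebra
proof
  fix t
  have "mat_pow (mat_exp ((1 / real k) *\<^sub>R (t *\<^sub>R X)) ** mat_exp ((1 / real k) *\<^sub>R (t *\<^sub>R Y))) k \<in> R" for k
    by (intro R_pow R_mult) (use assms in \<open>auto simp: mem_lie_algebra\<close>)
  from R_limit[OF mat_exp_trotter this invertible_mat_exp]
  show "mat_exp (t *\<^sub>R (X + Y)) \<in> R" by (simp add: scaleR_add_right)
qed

lemma lie_algebra_subspace: "subspace \<gg>"
  by (simp add: subspace_def lie_algebra_zero lie_algebra_add lie_algebra_scaleR)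

lemma lie_algebra_minus: "X \<in> \<gg> \<Longrightarrow> - X \<in> \<gg>"
  using lie_algebra_scaleR[of X "-1"] by simp

lemma lie_algebra_Ad:
  assumes "x \<in> carrier G" "X \<in> \<gg>"
  shows "Ad G p x X \<in> \<gg>"
  unfolding mem_lie_algebra
proof
  fix t
  have "mat_exp (p x ** (t *\<^sub>R X) ** p (inv x)) = p x ** mat_exp (t *\<^sub>R X) ** p (inv x)"
    by (rule mat_exp_conj) (use assms in auto)
  moreover have "p x ** mat_exp (t *\<^sub>R X) ** p (inv x) \<in> R"
    using assms by (auto intro!: R_mult p_in_R simp: mem_lie_algebra)
  ultimately show "mat_exp (t *\<^sub>R Ad G p x X) \<in> R"
    by (simp add: Ad_def mm.scaleR_left mm.scaleR_right)
qed

lemma E_minus: "X \<in> \<gg> \<Longrightarrow> E (- X) = inv (E X)"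
proof -
  assume X: "X \<in> \<gg>"
  have "E (- X) \<otimes> E X = \<one>"
    using E_scaleR_add[OF X, of "-1" 1] by simp
  then show ?thesis using X lie_algebra_minus by (metis E_closed inv_equality)
qed

lemma Ad_E: "X \<in> \<gg> \<Longrightarrow> Ad G p (E X) Y = mat_exp X ** Y ** mat_exp (- X)"
  by (simp add: Ad_def E_minus[symmetric] p_E lie_algebra_minus)

lemma lie_algebra_bracket:
  assumes "X \<in> \<gg>" "Y \<in> \<gg>"
  shows "bracket X Y \<in> \<gg>"
proof (rule closed_sequentially[OF closed_subspace[OF lie_algebra_subspace] _ mat_exp_conj_sequence])
  fix k
  have "mat_exp ((1 / real k) *\<^sub>R X) ** Y ** mat_exp (- ((1 / real k) *\<^sub>R X)) \<in> \<gg>"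
    using lie_algebra_Ad[OF E_closed assms(2), of "(1 / real k) *\<^sub>R X"] assms(1)
    by (simp add: Ad_E lie_algebra_scaleR)
  then show "real k *\<^sub>R (mat_exp ((1 / real k) *\<^sub>R X) ** Y ** mat_exp (- ((1 / real k) *\<^sub>R X)) - Y) \<in> \<gg>"
    using assms lie_algebra_subspace by (intro subspace_scale subspace_diff)
qed

lemma E_Ad:
  assumes "x \<in> carrier G" "X \<in> \<gg>"
  shows "x \<otimes> E X \<otimes> inv x = E (Ad G p x X)"
proof -
  have "E (1 *\<^sub>R Ad G p x X) = x \<otimes> E (1 *\<^sub>R X) \<otimes> inv x"
  proof (rule E_unique(2))
    show "continuous_on UNIV (\<lambda>t. x \<otimes> E (t *\<^sub>R X) \<otimes> inv x)"
      using assms by (intro mult_continuous_on E_scaleR_continuous continuous_on_const) auto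
    show "x \<otimes> E (t *\<^sub>R X) \<otimes> inv x \<in> carrier G" for t using assms by simp
    show "x \<otimes> E ((s + t) *\<^sub>R X) \<otimes> inv x = (x \<otimes> E (s *\<^sub>R X) \<otimes> inv x) \<otimes> (x \<otimes> E (t *\<^sub>R X) \<otimes> inv x)" for s t
    proof -
      have "inv x \<otimes> (x \<otimes> z) = z" if "z \<in> carrier G" for z
        using that assms by (simp add: m_assoc[symmetric])
      then show ?thesis using assms by (simp add: E_scaleR_add m_assoc)
    qed
    show "p (x \<otimes> E (t *\<^sub>R X) \<otimes> inv x) = mat_exp (t *\<^sub>R Ad G p x X)" for t
    proof -
      have "mat_exp (p x ** (t *\<^sub>R X) ** p (inv x)) = p x ** mat_exp (t *\<^sub>R X) ** p (inv x)"
        by (rule mat_exp_conj) (use assms in auto)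
      then show ?thesis
        using assms by (simp add: p_mult p_E_scaleR Ad_def mm.scaleR_left mm.scaleR_right)
    qed
  qed
  then show ?thesis by simp
qed

lemma E_commute:
  assumes "X \<in> \<gg>" "Y \<in> \<gg>" "bracket X Y = 0"
  shows "E X \<otimes> E Y = E Y \<otimes> E X"
proof -
  have "Ad G p (E X) Y = Y"
    using mat_exp_conj_eigen[of X Y 0] assms by (simp add: Ad_E)
  then have "E X \<otimes> E Y \<otimes> inv (E X) = E Y"
    using E_Ad[of "E X" Y] assms by simp
  then show ?thesis using assms by (metis E_closed inv_solve_right m_closed)
qed

lemma E_add:
  assumes "X \<in> \<gg>" "Y \<in> \<gg>" "bracket X Y = 0"
  shows "E (X + Y) = E X \<otimes> E Y"
proof -
  have XY: "X ** Y = Y ** X" using assms(3) by (simp add: bracket_def)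
  have "E (1 *\<^sub>R (X + Y)) = E (1 *\<^sub>R X) \<otimes> E (1 *\<^sub>R Y)"
  proof (rule E_unique(2))
    show "continuous_on UNIV (\<lambda>t. E (t *\<^sub>R X) \<otimes> E (t *\<^sub>R Y))"
      using assms by (intro mult_continuous_on E_scaleR_continuous) auto
    show "E (t *\<^sub>R X) \<otimes> E (t *\<^sub>R Y) \<in> carrier G" for t using assms by simp
    show "E ((s + t) *\<^sub>R X) \<otimes> E ((s + t) *\<^sub>R Y) = (E (s *\<^sub>R X) \<otimes> E (s *\<^sub>R Y)) \<otimes> (E (t *\<^sub>R X) \<otimes> E (t *\<^sub>R Y))" for s t
    proof -
      have "E (t *\<^sub>R X) \<otimes> E (s *\<^sub>R Y) = E (s *\<^sub>R Y) \<otimes> E (t *\<^sub>R X)"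
        using assms by (intro E_commute lie_algebra_scaleR) (auto simp: bracket_scaleR_left bracket_scaleR_right)
      then have "E (t *\<^sub>R X) \<otimes> (E (s *\<^sub>R Y) \<otimes> z) = E (s *\<^sub>R Y) \<otimes> (E (t *\<^sub>R X) \<otimes> z)" if "z \<in> carrier G" for z
        using that assms by (simp add: m_assoc[symmetric])
      then show ?thesis using assms by (simp add: E_scaleR_add m_assoc)
    qed
    show "p (E (t *\<^sub>R X) \<otimes> E (t *\<^sub>R Y)) = mat_exp (t *\<^sub>R (X + Y))" for t
    proof -
      have "(t *\<^sub>R X) ** (t *\<^sub>R Y) = (t *\<^sub>R Y) ** (t *\<^sub>R X)"
        by (simp only: mm.scaleR_left mm.scaleR_right XY)
      then show ?thesis
        using assms by (simp add: p_mult p_E_scaleR scaleR_add_right mat_exp_add)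
    qed
  qed
  then show ?thesis by simp
qed

text \<open>For a single \<open>X\<close> the section describes \<open>E (t *\<^sub>R X)\<close>
  only for \<open>t\<close> below a bound depending on \<open>X\<close>. Taking \<open>k\<close>-th
  powers along a segment that stays in the ball makes the radius independent of
  \<open>X\<close>.\<close>

lemma E_local:
  obtains d where "0 < d" "\<And>X. X \<in> \<gg> \<Longrightarrow> norm X < d \<Longrightarrow> norm (mat_exp X - mat 1) < \<epsilon> \<and> E X = \<sigma> (mat_exp X)"
proof -
  have "((\<lambda>X. norm (mat_exp X - mat 1 :: real^'n^'n)) \<longlongrightarrow> norm (mat_exp 0 - mat 1 :: real^'n^'n)) (nhds 0)"
    by (intro tendsto_intros filterlim_ident)
  then have "\<forall>\<^sub>F X in nhds 0. norm (mat_exp X - mat 1 :: real^'n^'n) < \<epsilon>"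
    using eps_pos by (simp add: order_tendstoD)
  then obtain d where d: "0 < d" "\<And>X::real^'n^'n. norm X < d \<Longrightarrow> norm (mat_exp X - mat 1) < \<epsilon>"
    by (auto simp: eventually_nhds_metric)
  show ?thesis
  proof
    show "0 < d" by (rule d(1))
    fix X assume X: "X \<in> \<gg>" "norm X < d"
    obtain c where c: "0 < c" "\<And>t. \<bar>t\<bar> < c \<Longrightarrow> E (t *\<^sub>R X) \<in> U"
      using one_parameter_near_zero[OF E_scaleR_continuous[OF X(1)]] X(1) E_scaleR_add by (metis E_scaleR_closed)
    obtain k :: nat where k: "k > 0" "1 / real k < c"
      using c(1) nat_approx_posE by (metis zero_less_Suc)
    define M where "M = mat_exp ((1 / real k) *\<^sub>R X)"
    have pM: "p (E ((1 / real k) *\<^sub>R X)) = M" using X by (simp add: M_def p_E_scaleR)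
    have EM: "E ((1 / real k) *\<^sub>R X) = \<sigma> M"
      using U_section[OF c(2), of "1 / real k"] k by (simp add: pM)
    have "norm (mat_pow M i - mat 1) < \<epsilon>" if "i \<le> k" for i
      unfolding M_def mat_pow_mat_exp
    proof (rule d(2))
      have "norm ((real i * (1 / real k)) *\<^sub>R X) \<le> 1 * norm X"
        unfolding norm_scaleR using that k by (intro mult_right_mono) (auto simp: divide_simps)
      then show "norm ((real i * (1 / real k)) *\<^sub>R X) < d" using X by simp
    qed
    then have "\<sigma> (mat_pow M k) = \<sigma> M [^] k"
      by (intro section_pow[of M k k]) (use X in \<open>auto simp: M_def mem_lie_algebra\<close>)
    also have "\<dots> = E X"
      using one_parameter_pow[OF monoid_axioms E_scaleR_closed[OF X(1)] E_scaleR_add[OF X(1)], of "1 / real k" k] k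
      by (simp add: EM[symmetric])
    finally have "\<sigma> (mat_exp X) = E X"
      using k by (simp add: M_def mat_pow_mat_exp)
    then show "norm (mat_exp X - mat 1) < \<epsilon> \<and> E X = \<sigma> (mat_exp X)"
      using d(2)[OF X(2)] by simp
  qed
qed

text \<open>The matrix formula is carried to \<open>G\<close> by \<open>\<sigma>\<close>, which
  turns the \<open>k\<close>-th matrix power into the \<open>k\<close>-th power in \<open>G\<close>
  as long as no intermediate power leaves the ball; hence the restriction to small
  \<open>X + Y\<close>.\<close>

lemma E_trotter:
  obtains d where "0 < d" "\<And>X Y. X \<in> \<gg> \<Longrightarrow> Y \<in> \<gg> \<Longrightarrow> norm (X + Y) < d \<Longrightarrow>
    (\<lambda>k. (E ((1 / real k) *\<^sub>R X) \<otimes> E ((1 / real k) *\<^sub>R Y)) [^] k) \<longlonglongrightarrow> E (X + Y)"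
proof -
  obtain d1 where d1: "0 < d1" "\<And>(A::real^'n^'n) j k. norm (real k *\<^sub>R (A - mat 1)) < d1 \<Longrightarrow> j \<le> k \<Longrightarrow>
      norm (mat_pow A j - mat 1) < \<epsilon>"
    using mat_pow_near_one[OF eps_pos, where 'n='n] by blast
  obtain d2 where d2: "0 < d2" "\<And>X. X \<in> \<gg> \<Longrightarrow> norm X < d2 \<Longrightarrow> norm (mat_exp X - mat 1) < \<epsilon> \<and> E X = \<sigma> (mat_exp X)"
    using E_local by blast
  show ?thesis
  proof
    show "0 < min d1 d2" using d1 d2 by simp
    fix X Y assume X: "X \<in> \<gg>" and Y: "Y \<in> \<gg>" and XY: "norm (X + Y) < min d1 d2"
    define c where "c t = E (t *\<^sub>R X) \<otimes> E (t *\<^sub>R Y)" for t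
    define M where "M k = mat_exp ((1 / real k) *\<^sub>R X) ** mat_exp ((1 / real k) *\<^sub>R Y)" for k
    have pc: "p (c (1 / real k)) = M k" for k
      using X Y by (simp add: c_def M_def p_mult p_E_scaleR)
    have MR: "M k \<in> R" for k using X Y by (auto simp: M_def mem_lie_algebra intro: R_mult)
    have "\<forall>\<^sub>F t in nhds 0. c t \<in> U"
      by (rule eventually_in_U[of UNIV])
         (use X Y in \<open>auto simp: c_def intro!: mult_continuous_on E_scaleR_continuous\<close>)
    then have ev1: "\<forall>\<^sub>F k in sequentially. c (1 / real k) \<in> U"
      by (rule eventually_compose_filterlim[OF _ lim_1_over_n])
    have "\<forall>\<^sub>F k in sequentially. norm (real k *\<^sub>R (M k - mat 1)) < d1"
      using order_tendstoD(2)[OF tendsto_norm[OF mat_exp_mult_sequence[of X Y]], of d1] XY by (simp add: M_def)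
    then have ev2: "\<forall>\<^sub>F k in sequentially. \<sigma> (mat_pow (M k) k) = c (1 / real k) [^] k \<and> norm (mat_pow (M k) k - mat 1) < \<epsilon>"
      using ev1
    proof eventually_elim
      case (elim k)
      have "\<sigma> (M k) = c (1 / real k)" using U_section[OF elim(2)] by (simp add: pc)
      moreover have "\<sigma> (mat_pow (M k) k) = \<sigma> (M k) [^] k"
        by (rule section_pow[of _ k]) (use MR d1(2)[OF elim(1)] in auto)
      ultimately show ?case using d1(2)[OF elim(1), of k] by simp
    qed
    have "(\<lambda>k. \<sigma> (mat_pow (M k) k)) \<longlonglongrightarrow> \<sigma> (mat_exp (X + Y))"
    proof (rule continuous_on_tendsto_compose[OF section_continuous])
      show "(\<lambda>k. mat_pow (M k) k) \<longlonglongrightarrow> mat_exp (X + Y)"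
        unfolding M_def by (rule mat_exp_trotter)
      show "mat_exp (X + Y) \<in> {M \<in> R. norm (M - mat 1) < \<epsilon>}"
        using lie_algebra_add[OF X Y] d2(2)[OF lie_algebra_add[OF X Y]] XY
        by (auto simp: mem_lie_algebra dest: spec[of _ 1])
      show "\<forall>\<^sub>F k in sequentially. mat_pow (M k) k \<in> {M \<in> R. norm (M - mat 1) < \<epsilon>}"
        using ev2 by eventually_elim (simp add: R_pow MR)
    qed
    then have "(\<lambda>k. c (1 / real k) [^] k) \<longlonglongrightarrow> \<sigma> (mat_exp (X + Y))"
      by (rule Lim_transform_eventually) (use ev2 in \<open>eventually_elim, simp\<close>)
    then show "(\<lambda>k. (E ((1 / real k) *\<^sub>R X) \<otimes> E ((1 / real k) *\<^sub>R Y)) [^] k) \<longlonglongrightarrow> E (X + Y)"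
      using d2(2)[OF lie_algebra_add[OF X Y]] XY by (simp add: c_def)
  qed
qed

end

section \<open>The differential of the Cartan involution\<close>

locale reductive_cartan = reductive_section G p R \<sigma> \<epsilon> U
  for G :: "('g::topological_space, 'm) monoid_scheme" (structure)
    and p :: "'g \<Rightarrow> real^'n^'n" and R \<sigma> \<epsilon> U +
  fixes K :: "'g set" and \<theta> :: "'g \<Rightarrow> 'g"
  assumes cartan: "cartan_involution G p K \<theta>"
begin

abbreviation D :: "real^'n^'n \<Rightarrow> real^'n^'n" where "D \<equiv> lie_differential G p \<theta>"

lemma theta_hom: "\<theta> \<in> hom G G"
  using cartan by (simp add: cartan_involution_def)

lemma theta_closed [simp]: "x \<in> carrier G \<Longrightarrow> \<theta> x \<in> carrier G"
  using theta_hom by (auto simp: hom_def)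

lemma theta_mult: "x \<in> carrier G \<Longrightarrow> y \<in> carrier G \<Longrightarrow> \<theta> (x \<otimes> y) = \<theta> x \<otimes> \<theta> y"
  using theta_hom by (auto simp: hom_def)

lemma theta_one [simp]: "\<theta> \<one> = \<one>"
  using hom_one[OF theta_hom] is_group by simp

lemma theta_inv: "x \<in> carrier G \<Longrightarrow> \<theta> (inv x) = inv (\<theta> x)"
  using group_hom.hom_inv[of G G \<theta>] theta_hom is_group by (simp add: group_hom_def group_hom_axioms_def)

lemma theta_pow: "x \<in> carrier G \<Longrightarrow> \<theta> (x [^] (k::nat)) = \<theta> x [^] k"
  by (induction k) (auto simp: theta_mult)

lemma theta_continuous: "continuous_on (carrier G) \<theta>"
  using cartan by (simp add: cartan_involution_def)

lemma theta_theta [simp]: "x \<in> carrier G \<Longrightarrow> \<theta> (\<theta> x) = x"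
  using cartan by (simp add: cartan_involution_def)

lemma fixed_K: "x \<in> K \<longleftrightarrow> x \<in> carrier G \<and> \<theta> x = x"
  using cartan by (auto simp: cartan_involution_def)

lemma killing_pos: "X \<in> \<gg> \<Longrightarrow> X \<noteq> 0 \<Longrightarrow> - killing_form \<gg> X (D X) > 0"
  using cartan by (auto simp: cartan_involution_def Let_def)

lemma theta_E_continuous: "X \<in> \<gg> \<Longrightarrow> continuous_on UNIV (\<lambda>t. \<theta> (E (t *\<^sub>R X)))"
  by (rule continuous_on_compose2[OF theta_continuous E_scaleR_continuous]) auto

lemma D_unique:
  assumes "X \<in> \<gg>" "Y \<in> \<gg>" "\<And>t. \<theta> (E (t *\<^sub>R X)) = E (t *\<^sub>R Y)"
  shows "D X = Y"
  unfolding lie_differential_def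
proof (rule the_equality)
  show "Y \<in> \<gg> \<and> (\<forall>t. \<theta> (E (t *\<^sub>R X)) = E (t *\<^sub>R Y))"
    using assms(2,3) by blast
  fix Z assume Z: "Z \<in> \<gg> \<and> (\<forall>t. \<theta> (E (t *\<^sub>R X)) = E (t *\<^sub>R Z))"
  have "mat_exp (t *\<^sub>R Z) = mat_exp (t *\<^sub>R Y)" for t
  proof -
    have "E (t *\<^sub>R Z) = \<theta> (E (t *\<^sub>R X))" using Z by simp
    also have "\<dots> = E (t *\<^sub>R Y)" by (rule assms(3))
    finally have "p (E (t *\<^sub>R Z)) = p (E (t *\<^sub>R Y))" by (rule arg_cong)
    then show ?thesis using Z assms(2) by (simp only: p_E_scaleR)
  qed
  then show "Z = Y" by (rule mat_exp_eq_near_zero_imp_eq[OF zero_less_one])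
qed

text \<open>Only continuity of \<open>\<theta>\<close> is available. The matrices
  \<open>p (\<theta> (E (t *\<^sub>R X)))\<close> form a continuous one-parameter group, and such a
  group is automatically an exponential.\<close>

lemma D_props:
  assumes X: "X \<in> \<gg>"
  shows "D X \<in> \<gg>" "\<theta> (E (t *\<^sub>R X)) = E (t *\<^sub>R D X)"
proof -
  have c: "continuous_on UNIV (\<lambda>t. p (\<theta> (E (t *\<^sub>R X))))"
    by (rule continuous_on_compose2[OF p_continuous theta_E_continuous[OF X]]) (use X in auto)
  have h: "\<theta> (E ((s + t) *\<^sub>R X)) = \<theta> (E (s *\<^sub>R X)) \<otimes> \<theta> (E (t *\<^sub>R X))" for s t
    using X by (simp add: E_scaleR_add theta_mult)
  obtain Y where Y: "\<And>t. p (\<theta> (E (t *\<^sub>R X))) = mat_exp (t *\<^sub>R Y)"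
    by (rule continuous_one_parameter_mat_exp[OF c]) (use X in \<open>auto simp: h p_mult\<close>)
  have Yg: "Y \<in> \<gg>"
    by (rule E_unique(1)[OF theta_E_continuous[OF X] _ h Y]) (use X in auto)
  have YE: "\<theta> (E (t *\<^sub>R X)) = E (t *\<^sub>R Y)" for t
    by (rule E_unique(2)[OF theta_E_continuous[OF X] _ h Y, symmetric]) (use X in auto)
  have "D X = Y" by (rule D_unique[OF X Yg YE])
  then show "D X \<in> \<gg>" "\<theta> (E (t *\<^sub>R X)) = E (t *\<^sub>R D X)" using Yg YE by auto
qed

lemma theta_E: "X \<in> \<gg> \<Longrightarrow> \<theta> (E X) = E (D X)"
  using D_props(2)[of X 1] by simp

lemma D_D [simp]:
  assumes X: "X \<in> \<gg>" shows "D (D X) = X"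
proof (rule D_unique)
  show "\<theta> (E (t *\<^sub>R D X)) = E (t *\<^sub>R X)" for t
    by (simp only: D_props(2)[OF X, symmetric] theta_theta[OF E_scaleR_closed[OF X]])
qed (use X D_props(1)[OF X] in auto)

lemma D_scaleR:
  assumes X: "X \<in> \<gg>" shows "D (c *\<^sub>R X) = c *\<^sub>R D X"
proof (rule D_unique)
  show "\<theta> (E (t *\<^sub>R c *\<^sub>R X)) = E (t *\<^sub>R c *\<^sub>R D X)" for t
    using D_props(2)[OF X, of "t * c"] by simp
qed (use X D_props(1)[OF X] lie_algebra_scaleR in auto)

lemma D_Ad:
  assumes x: "x \<in> carrier G" and X: "X \<in> \<gg>"
  shows "D (Ad G p x X) = Ad G p (\<theta> x) (D X)"
proof (rule D_unique)
  have "t *\<^sub>R Ad G p y Y = Ad G p y (t *\<^sub>R Y)" for t y Y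
    by (simp add: Ad_def mm.scaleR_left mm.scaleR_right)
  then show "\<theta> (E (t *\<^sub>R Ad G p x X)) = E (t *\<^sub>R Ad G p (\<theta> x) (D X))" for t
    using x X D_props[OF X]
    by (simp only: E_Ad[symmetric] lie_algebra_scaleR theta_mult theta_inv m_closed E_scaleR_closed inv_closed theta_closed)
qed (use x X D_props(1)[OF X] lie_algebra_Ad in auto)

text \<open>Additivity is not immediate from the definition of the differential: \<open>\<theta>\<close> is applied to the
  Trotter product formula in \<open>G\<close>.\<close>

lemma D_add:
  assumes X: "X \<in> \<gg>" and Y: "Y \<in> \<gg>"
  shows "D (X + Y) = D X + D Y"
proof -
  obtain d where d: "0 < d" "\<And>X Y. X \<in> \<gg> \<Longrightarrow> Y \<in> \<gg> \<Longrightarrow> norm (X + Y) < d \<Longrightarrow>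
    (\<lambda>k. (E ((1 / real k) *\<^sub>R X) \<otimes> E ((1 / real k) *\<^sub>R Y)) [^] k) \<longlonglongrightarrow> E (X + Y)"
    using E_trotter by blast
  have small: "mat_exp (D (X' + Y')) = mat_exp (D X' + D Y')"
    if X': "X' \<in> \<gg>" and Y': "Y' \<in> \<gg>" and n: "norm (X' + Y') < d" for X' Y'
  proof -
    define c where "c k = E ((1 / real k) *\<^sub>R X') \<otimes> E ((1 / real k) *\<^sub>R Y')" for k
    have c: "c k \<in> carrier G" for k using X' Y' by (simp add: c_def)
    have "(\<lambda>k. p (\<theta> (c k [^] k))) \<longlonglongrightarrow> p (\<theta> (E (X' + Y')))"
    proof (rule continuous_on_tendsto_compose[where f = "\<lambda>x. p (\<theta> x)" and s = "carrier G"])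
      show "continuous_on (carrier G) (\<lambda>x. p (\<theta> x))"
        by (rule continuous_on_compose2[OF p_continuous theta_continuous]) auto
    qed (use d(2)[OF X' Y' n] c lie_algebra_add[OF X' Y'] in \<open>simp_all add: c_def\<close>)
    moreover have "p (\<theta> (c k [^] k)) = mat_pow (mat_exp ((1 / real k) *\<^sub>R D X') ** mat_exp ((1 / real k) *\<^sub>R D Y')) k" for k
    proof -
      have "p (\<theta> (c k)) = mat_exp ((1 / real k) *\<^sub>R D X') ** mat_exp ((1 / real k) *\<^sub>R D Y')"
        unfolding c_def
        using X' Y' D_props(1)[OF X'] D_props(1)[OF Y']
        by (simp only: theta_mult E_scaleR_closed D_props(2)[OF X'] D_props(2)[OF Y'] p_mult p_E_scaleR)
      then show ?thesis
        using c by (simp only: theta_pow p_pow theta_closed)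
    qed
    ultimately have "(\<lambda>k. mat_pow (mat_exp ((1 / real k) *\<^sub>R D X') ** mat_exp ((1 / real k) *\<^sub>R D Y')) k)
        \<longlonglongrightarrow> p (\<theta> (E (X' + Y')))" by simp
    from LIMSEQ_unique[OF this mat_exp_trotter]
    have "p (\<theta> (E (X' + Y'))) = mat_exp (D X' + D Y')" .
    then show ?thesis
      using lie_algebra_add[OF X' Y'] D_props(1)[OF lie_algebra_add[OF X' Y']] by (simp only: theta_E p_E)
  qed
  \<comment> \<open>The product formula covers only sums of norm below \<open>d\<close>, so
    \<open>X\<close> and \<open>Y\<close> are scaled down and homogeneity of \<open>D\<close> is
    used; the added 1 avoids dividing by 0.\<close>
  define e where "e = d / (norm (X + Y) + 1)"
  have e: "0 < e" using d(1) by (simp add: e_def add_nonneg_pos)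
  show ?thesis
  proof (rule mat_exp_eq_near_zero_imp_eq[OF e])
    fix t :: real assume t: "0 < t" "t < e"
    have "norm (t *\<^sub>R X + t *\<^sub>R Y) = t * norm (X + Y)"
      using t by (simp add: scaleR_add_right[symmetric])
    also have "\<dots> \<le> t * (norm (X + Y) + 1)" using t by simp
    also have "\<dots> < d" using t(2) by (simp add: e_def less_divide_eq add_nonneg_pos)
    finally have "norm (t *\<^sub>R X + t *\<^sub>R Y) < d" .
    from small[OF lie_algebra_scaleR[OF X] lie_algebra_scaleR[OF Y] this]
    show "mat_exp (t *\<^sub>R D (X + Y)) = mat_exp (t *\<^sub>R (D X + D Y))"
      by (simp only: scaleR_add_right[symmetric] D_scaleR[OF lie_algebra_add[OF X Y]] D_scaleR[OF X] D_scaleR[OF Y])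
  qed
qed

text \<open>Off \<open>\<gg>\<close> the differential is an unspecified value. A bounded linear map
  that agrees with it on \<open>\<gg>\<close> can be moved through limits.\<close>

lemma D_linear_extension:
  obtains F where "bounded_linear F" "\<And>X. X \<in> \<gg> \<Longrightarrow> D X = F X"
proof -
  obtain B where B: "B \<subseteq> \<gg>" "independent B" "\<gg> \<subseteq> span B"
    by (rule basis_exists[of \<gg>])
  obtain F where F: "linear F" "\<And>x. x \<in> B \<Longrightarrow> F x = D x"
    using linear_independent_extend[OF B(2), of D] by blast
  have "D X = F X" if "X \<in> \<gg>" for X
  proof -
    have "X \<in> span B" using B(3) that by blast
    then have "X \<in> \<gg> \<and> D X = F X"
    proof (induction rule: span_induct_alt)
      case base
      then show ?case
        using D_scaleR[OF lie_algebra_zero, of 0] linear_0[OF F(1)] lie_algebra_zero by simp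
    next
      case (step c x y)
      have "x \<in> \<gg>" using B(1) step by blast
      then have "D (c *\<^sub>R x + y) = c *\<^sub>R F x + F y"
        using step F(2) by (simp only: D_add D_scaleR lie_algebra_scaleR)
      then show ?case
        using \<open>x \<in> \<gg>\<close> step by (simp add: lie_algebra_add lie_algebra_scaleR linear_add[OF F(1)] linear_scale[OF F(1)])
    qed
    then show ?thesis by simp
  qed
  then show ?thesis using that F(1) by (auto simp: linear_conv_bounded_linear)
qed

text \<open>This is \<open>D_Ad\<close> along \<open>E ((1 / real k) *\<^sub>R X)\<close>,
  differentiated at 0; the bounded linear extension carries \<open>D\<close> through the
  limit.\<close>

lemma D_bracket:
  assumes X: "X \<in> \<gg>" and Y: "Y \<in> \<gg>"
  shows "D (bracket X Y) = bracket (D X) (D Y)"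
proof -
  obtain F where F: "bounded_linear F" "\<And>X. X \<in> \<gg> \<Longrightarrow> D X = F X"
    using D_linear_extension by blast
  interpret F: bounded_linear F by (rule F(1))
  have DX: "D X \<in> \<gg>" by (rule D_props[OF X])
  define q where "q k = mat_exp ((1 / real k) *\<^sub>R X) ** Y ** mat_exp (- ((1 / real k) *\<^sub>R X))" for k
  have q: "q k = Ad G p (E ((1 / real k) *\<^sub>R X)) Y" for k
    using X by (simp add: q_def Ad_E lie_algebra_scaleR)
  have "F (q k) = Ad G p (E ((1 / real k) *\<^sub>R D X)) (D Y)" for k
  proof -
    have "Ad G p (E ((1 / real k) *\<^sub>R X)) Y \<in> \<gg>"
      by (rule lie_algebra_Ad[OF E_scaleR_closed[OF X] Y])
    then have "F (q k) = D (Ad G p (E ((1 / real k) *\<^sub>R X)) Y)"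
      by (simp only: q F(2))
    also have "\<dots> = Ad G p (E ((1 / real k) *\<^sub>R D X)) (D Y)"
      by (simp only: D_Ad[OF E_scaleR_closed[OF X] Y] D_props(2)[OF X])
    finally show ?thesis .
  qed
  then have Fq: "F (q k) = mat_exp ((1 / real k) *\<^sub>R D X) ** D Y ** mat_exp (- ((1 / real k) *\<^sub>R D X))" for k
    using DX by (simp add: Ad_E lie_algebra_scaleR)
  have "(\<lambda>k. F (real k *\<^sub>R (q k - Y))) \<longlonglongrightarrow> F (bracket X Y)"
    unfolding q_def by (rule F.tendsto[OF mat_exp_conj_sequence])
  moreover have "F (real k *\<^sub>R (q k - Y)) = real k *\<^sub>R (mat_exp ((1 / real k) *\<^sub>R D X) ** D Y ** mat_exp (- ((1 / real k) *\<^sub>R D X)) - D Y)" for k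
    by (simp add: F.scaleR F.diff Fq F(2)[OF Y])
  ultimately have "(\<lambda>k. real k *\<^sub>R (mat_exp ((1 / real k) *\<^sub>R D X) ** D Y ** mat_exp (- ((1 / real k) *\<^sub>R D X)) - D Y))
      \<longlonglongrightarrow> F (bracket X Y)" by simp
  from LIMSEQ_unique[OF this mat_exp_conj_sequence] show ?thesis
    using F(2)[OF lie_algebra_bracket[OF X Y]] by simp
qed

end

section \<open>Traces and the Killing form\<close>

lemma some_basis:
  fixes V :: "'v::euclidean_space set"
  assumes "subspace V"
  shows "independent (some_basis V)" "span (some_basis V) = V" "finite (some_basis V)"
proof -
  obtain B where "B \<subseteq> V" "independent B" "V \<subseteq> span B" using basis_exists[of V] by metis
  then have "independent B \<and> span B = V"
    using assms by (simp add: span_minimal subset_antisym)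
  then have *: "independent (some_basis V) \<and> span (some_basis V) = V"
    unfolding some_basis_def by (rule someI)
  then show "independent (some_basis V)" "span (some_basis V) = V" by auto
  then show "finite (some_basis V)" by (simp add: independent_imp_finite)
qed

text \<open>The basis in \<open>trace_on\<close> is arbitrary but the same on both sides, so both
  traces are the same double sum over it.\<close>

lemma trace_on_commute:
  fixes V :: "'v::euclidean_space set"
  assumes V: "subspace V" and f: "linear f" "\<And>x. x \<in> V \<Longrightarrow> f x \<in> V" and g: "linear g" "\<And>x. x \<in> V \<Longrightarrow> g x \<in> V"
  shows "trace_on V (\<lambda>x. f (g x)) = trace_on V (\<lambda>x. g (f x))"
proof -
  define B where "B = some_basis V"
  note B = some_basis[OF V, folded B_def]
  have BV: "b \<in> V" if "b \<in> B" for b using that B(2) span_superset[of B] by blast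
  have expand: "representation B (h (k b)) b = (\<Sum>c\<in>B. representation B (k b) c * representation B (h c) b)"
    if "linear h" "\<And>x. x \<in> V \<Longrightarrow> h x \<in> V" "\<And>x. x \<in> V \<Longrightarrow> k x \<in> V" "b \<in> B" for h k :: "'v \<Rightarrow> 'v" and b
  proof -
    have "k b = (\<Sum>c\<in>B. representation B (k b) c *\<^sub>R c)"
      by (rule sum_representation_eq[OF B(1) _ B(3), symmetric]) (use that B(2) BV in auto)
    then have "h (k b) = (\<Sum>c\<in>B. representation B (k b) c *\<^sub>R h c)"
      by (metis (no_types, lifting) linear_sum[OF that(1)] linear_scale[OF that(1)] sum.cong)
    then have "representation B (h (k b)) = representation B (\<Sum>c\<in>B. representation B (k b) c *\<^sub>R h c)"
      by simp
    also have "\<dots> = (\<lambda>x. \<Sum>c\<in>B. representation B (representation B (k b) c *\<^sub>R h c) x)"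
      by (rule representation_sum[OF B(1)]) (use that B(2) BV in \<open>auto intro: span_scale\<close>)
    also have "\<dots> = (\<lambda>x. \<Sum>c\<in>B. representation B (k b) c * representation B (h c) x)"
      by (intro ext sum.cong refl) (use that B BV in \<open>auto simp: representation_scale\<close>)
    finally show ?thesis by simp
  qed
  have "trace_on V (\<lambda>x. f (g x)) = (\<Sum>b\<in>B. \<Sum>c\<in>B. representation B (g b) c * representation B (f c) b)"
    unfolding trace_on_def Let_def B_def[symmetric]
    by (intro sum.cong refl expand) (use f g in auto)
  also have "\<dots> = (\<Sum>c\<in>B. \<Sum>b\<in>B. representation B (f c) b * representation B (g b) c)"
    by (subst sum.swap) (simp add: mult.commute)
  also have "\<dots> = trace_on V (\<lambda>x. g (f x))"
    unfolding trace_on_def Let_def B_def[symmetric]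
    by (intro sum.cong refl expand[symmetric]) (use f g in auto)
  finally show ?thesis .
qed

lemma trace_on_add:
  fixes V :: "'v::euclidean_space set"
  assumes V: "subspace V" and "\<And>x. x \<in> V \<Longrightarrow> f x \<in> V" "\<And>x. x \<in> V \<Longrightarrow> g x \<in> V"
  shows "trace_on V (\<lambda>x. f x + g x) = trace_on V f + trace_on V g"
proof -
  note B = some_basis[OF V]
  have "b \<in> V" if "b \<in> some_basis V" for b using that B(2) span_superset[of "some_basis V"] by blast
  then show ?thesis
    unfolding trace_on_def Let_def sum.distrib[symmetric]
    by (intro sum.cong refl) (use B assms in \<open>simp add: representation_add\<close>)
qed

lemma trace_on_scaleR:
  fixes V :: "'v::euclidean_space set"
  assumes V: "subspace V" and "\<And>x. x \<in> V \<Longrightarrow> f x \<in> V"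
  shows "trace_on V (\<lambda>x. c *\<^sub>R f x) = c * trace_on V f"
proof -
  note B = some_basis[OF V]
  have "b \<in> V" if "b \<in> some_basis V" for b using that B(2) span_superset[of "some_basis V"] by blast
  then show ?thesis
    unfolding trace_on_def Let_def sum_distrib_left
    by (intro sum.cong refl) (use B assms in \<open>simp add: representation_scale\<close>)
qed

lemma linear_bracket: "linear (bracket (X :: real^'n^'n))"
  using bounded_linear_bracket by (rule bounded_linear.linear)

section \<open>The Killing form and its invariance\<close>

context reductive_section
begin

abbreviation B :: "real^'n^'n \<Rightarrow> real^'n^'n \<Rightarrow> real" where "B \<equiv> killing_form \<gg>"

lemma B_add_left: "X \<in> \<gg> \<Longrightarrow> Y \<in> \<gg> \<Longrightarrow> Z \<in> \<gg> \<Longrightarrow> B (X + Y) Z = B X Z + B Y Z"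
  unfolding killing_form_def bracket_add_left
  by (rule trace_on_add[OF lie_algebra_subspace]) (auto intro: lie_algebra_bracket)

lemma B_scaleR_left: "X \<in> \<gg> \<Longrightarrow> Z \<in> \<gg> \<Longrightarrow> B (c *\<^sub>R X) Z = c * B X Z"
  unfolding killing_form_def bracket_scaleR_left
  by (rule trace_on_scaleR[OF lie_algebra_subspace]) (auto intro: lie_algebra_bracket)

lemma B_commute: "X \<in> \<gg> \<Longrightarrow> Y \<in> \<gg> \<Longrightarrow> B X Y = B Y X"
  unfolding killing_form_def
  by (rule trace_on_commute[OF lie_algebra_subspace]) (auto intro: lie_algebra_bracket linear_bracket)

lemma B_add_right: "X \<in> \<gg> \<Longrightarrow> Y \<in> \<gg> \<Longrightarrow> Z \<in> \<gg> \<Longrightarrow> B Z (X + Y) = B Z X + B Z Y"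
  using B_add_left[of X Y Z] by (simp add: B_commute[of Z] lie_algebra_add)

lemma B_scaleR_right: "X \<in> \<gg> \<Longrightarrow> Z \<in> \<gg> \<Longrightarrow> B Z (c *\<^sub>R X) = c * B Z X"
  using B_scaleR_left[of X Z c] by (simp add: B_commute[of Z] lie_algebra_scaleR)

text \<open>With \<open>x\<close>, \<open>y\<close>, \<open>z\<close> the adjoint operators, the
  traces of \<open>[x, y] z\<close> and \<open>x [y, z]\<close> are compared; only the term
  \<open>y x z\<close> has to be rotated to \<open>x z y\<close>.\<close>

lemma B_bracket:
  assumes X: "X \<in> \<gg>" and Y: "Y \<in> \<gg>" and Z: "Z \<in> \<gg>"
  shows "B (bracket X Y) Z = B X (bracket Y Z)"
proof -
  define x y z where "x = bracket X" and "y = bracket Y" and "z = bracket Z"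
  have c: "\<And>W. W \<in> \<gg> \<Longrightarrow> x W \<in> \<gg>" "\<And>W. W \<in> \<gg> \<Longrightarrow> y W \<in> \<gg>" "\<And>W. W \<in> \<gg> \<Longrightarrow> z W \<in> \<gg>"
    using X Y Z by (auto simp: x_def y_def z_def intro: lie_algebra_bracket)
  have l: "linear x" "linear y" "linear z" by (auto simp: x_def y_def z_def linear_bracket)
  have l2: "linear (\<lambda>W. x (z W))"
    using linear_compose[OF l(3,1)] by (simp add: comp_def)
  have b: "bracket (bracket S T) W = bracket S (bracket T W) + (-1) *\<^sub>R bracket T (bracket S W)" for S T W :: "real^'n^'n"
    by (simp add: bracket_jacobi[of S T W])
  have "B (bracket X Y) Z = trace_on \<gg> (\<lambda>W. x (y (z W)) + (-1) *\<^sub>R y (x (z W)))"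
    unfolding killing_form_def b x_def y_def z_def ..
  also have "\<dots> = trace_on \<gg> (\<lambda>W. x (y (z W))) + trace_on \<gg> (\<lambda>W. (-1) *\<^sub>R y (x (z W)))"
    by (rule trace_on_add[OF lie_algebra_subspace]) (intro lie_algebra_scaleR c; assumption)+
  also have "trace_on \<gg> (\<lambda>W. (-1) *\<^sub>R y (x (z W))) = (-1) * trace_on \<gg> (\<lambda>W. y (x (z W)))"
    by (rule trace_on_scaleR[OF lie_algebra_subspace]) (intro c; assumption)
  also have "trace_on \<gg> (\<lambda>W. y (x (z W))) = trace_on \<gg> (\<lambda>W. x (z (y W)))"
    by (rule trace_on_commute[OF lie_algebra_subspace l(2) c(2) l2]) (assumption | rule c)+
  also have "(-1) * trace_on \<gg> (\<lambda>W. x (z (y W))) = trace_on \<gg> (\<lambda>W. (-1) *\<^sub>R x (z (y W)))"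
    by (rule trace_on_scaleR[OF lie_algebra_subspace, symmetric]) (intro c; assumption)
  also have "trace_on \<gg> (\<lambda>W. x (y (z W))) + \<dots> = trace_on \<gg> (\<lambda>W. x (y (z W)) + (-1) *\<^sub>R x (z (y W)))"
    by (rule trace_on_add[OF lie_algebra_subspace, symmetric]) (intro lie_algebra_scaleR c; assumption)+
  also have "\<dots> = B X (bracket Y Z)"
    unfolding killing_form_def b x_def y_def z_def bracket_add_right bracket_scaleR_right ..
  finally show ?thesis .
qed

lemma linear_Ad: "linear (Ad G p x)"
  by (rule linearI) (simp_all add: Ad_def mm.add_left mm.add_right mm.scaleR_left mm.scaleR_right)

lemma Ad_bracket:
  assumes "x \<in> carrier G"
  shows "Ad G p x (bracket Y Z) = bracket (Ad G p x Y) (Ad G p x Z)"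
proof -
  have "p x ** S ** p (inv x) ** (p x ** T ** p (inv x)) = p x ** (S ** T) ** p (inv x)" for S T
  proof -
    have "p x ** S ** p (inv x) ** (p x ** T ** p (inv x)) = p x ** S ** (p (inv x) ** p x) ** T ** p (inv x)"
      by (simp only: matrix_mul_assoc)
    then show ?thesis using assms by (simp add: matrix_mul_assoc)
  qed
  then show ?thesis by (simp add: Ad_def bracket_def mm.diff_left mm.diff_right)
qed

lemma Ad_mult:
  assumes "x \<in> carrier G" "y \<in> carrier G"
  shows "Ad G p (x \<otimes> y) Z = Ad G p x (Ad G p y Z)"
  using assms by (simp add: Ad_def p_mult inv_mult_group matrix_mul_assoc)

lemma Ad_one [simp]: "Ad G p \<one> Z = Z"
  by (simp add: Ad_def)

lemma Ad_inv_Ad [simp]: "x \<in> carrier G \<Longrightarrow> Ad G p (inv x) (Ad G p x Z) = Z"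
  by (simp add: Ad_mult[symmetric])

text \<open>\<open>Ad\<close> preserves brackets, so the operator for the transformed pair is a
  conjugate of the original one and has the same trace.\<close>

lemma B_Ad:
  assumes x: "x \<in> carrier G" and Y: "Y \<in> \<gg>" and Z: "Z \<in> \<gg>"
  shows "B (Ad G p x Y) (Ad G p x Z) = B Y Z"
proof -
  define a where "a = Ad G p x"
  define a' where "a' = Ad G p (inv x)"
  have a: "a (bracket S T) = bracket (a S) (a T)" "a (a' S) = S" "a' (a S) = S" for S T
    using x Ad_inv_Ad[of "inv x"] by (simp_all add: a_def a'_def Ad_bracket)
  have ag: "a S \<in> \<gg>" "a' S \<in> \<gg>" if "S \<in> \<gg>" for S
    using that x by (auto simp: a_def a'_def intro: lie_algebra_Ad)
  have lin: "linear a" "linear (\<lambda>W. bracket Y (bracket Z (a' W)))"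
    using linear_compose[OF linear_compose[OF linear_Ad linear_bracket] linear_bracket]
    by (auto simp: a_def a'_def linear_Ad comp_def)
  have "B (a Y) (a Z) = trace_on \<gg> (\<lambda>W. a (bracket Y (bracket Z (a' W))))"
    unfolding killing_form_def by (simp add: a)
  also have "\<dots> = trace_on \<gg> (\<lambda>W. bracket Y (bracket Z (a' (a W))))"
    by (rule trace_on_commute[OF lie_algebra_subspace lin(1) _ lin(2)])
       (auto intro!: ag lie_algebra_bracket Y Z)
  also have "\<dots> = B Y Z"
    unfolding killing_form_def by (simp only: a)
  finally show ?thesis by (simp only: a_def)
qed

end

section \<open>Integrality of sl(2) weights\<close>

lemma eigenvectors_independent:
  fixes f :: "'a::real_vector \<Rightarrow> 'a"
  assumes f: "linear f" and inj: "inj (m :: nat \<Rightarrow> real)"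
  shows "(\<And>k. k < n \<Longrightarrow> f (v k) = m k *\<^sub>R v k) \<Longrightarrow> (\<And>k. k < n \<Longrightarrow> v k \<noteq> 0)
      \<Longrightarrow> (\<Sum>k<n. c k *\<^sub>R v k) = 0 \<Longrightarrow> k < n \<Longrightarrow> c k = (0::real)"
proof (induction n arbitrary: c k)
  case (Suc n)
  have s: "(\<Sum>k<n. c k *\<^sub>R v k) = - (c n *\<^sub>R v n)"
    using Suc.prems(3) by (simp add: eq_neg_iff_add_eq_0)
  have "f (\<Sum>k<Suc n. c k *\<^sub>R v k) = (\<Sum>k<Suc n. (c k * m k) *\<^sub>R v k)"
    using Suc.prems(1) by (simp add: linear_sum[OF f] linear_add[OF f] linear_scale[OF f])
  then have "(\<Sum>k<Suc n. (c k * m k) *\<^sub>R v k) = 0"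
    using Suc.prems(3) linear_0[OF f] by simp
  then have "(\<Sum>k<n. (c k * m k) *\<^sub>R v k) - m n *\<^sub>R (\<Sum>k<n. c k *\<^sub>R v k) = 0"
    unfolding s by (simp add: mult.commute)
  moreover have "(\<Sum>k<n. (c k * (m k - m n)) *\<^sub>R v k) = (\<Sum>k<n. (c k * m k) *\<^sub>R v k) - m n *\<^sub>R (\<Sum>k<n. c k *\<^sub>R v k)"
    unfolding scaleR_sum_right sum_subtractf[symmetric]
    by (intro sum.cong refl) (simp add: right_diff_distrib scaleR_diff_left mult.commute)
  ultimately have "(\<Sum>k<n. (c k * (m k - m n)) *\<^sub>R v k) = 0" by simp
  then have z: "c j * (m j - m n) = 0" if "j < n" for j
    using that Suc.prems(1,2) by (intro Suc.IH) auto
  have c0: "c j = 0" if "j < n" for j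
    using z[OF that] that inj by (auto simp: inj_def)
  then have "c n *\<^sub>R v n = 0" using s by simp
  then have "c n = 0" using Suc.prems(2)[of n] by simp
  then show ?case using c0 Suc.prems(4) less_Suc_eq by blast
qed simp

text \<open>If none vanished, one more of these vectors than the dimension of the space would be
  independent.\<close>

lemma eigenvector_sequence_vanishes:
  fixes f :: "'a::euclidean_space \<Rightarrow> 'a"
  assumes f: "linear f" and inj: "inj m" and v: "\<And>k::nat. f (v k) = m k *\<^sub>R v k"
  shows "\<exists>k. v k = 0"
proof (rule ccontr)
  assume "\<not> (\<exists>k. v k = 0)"
  then have nz: "v k \<noteq> 0" for k by blast
  define n where "n = Suc DIM('a)"
  have ind: "c k = 0" if "(\<Sum>k<n. c k *\<^sub>R v k) = 0" "k < n" for c k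
    by (rule eigenvectors_independent[OF f inj v nz that])
  have injv: "inj_on v {..<n}"
  proof (rule inj_onI, rule ccontr)
    fix i j assume ij: "i \<in> {..<n}" "j \<in> {..<n}" "v i = v j" "i \<noteq> j"
    have "m i *\<^sub>R v i = f (v i)" by (rule v[symmetric])
    also have "\<dots> = f (v j)" by (simp only: ij(3))
    also have "\<dots> = m j *\<^sub>R v i" by (simp only: v ij(3))
    finally have "m i = m j" using nz[of i] by simp
    then show False using inj ij(4) by (auto simp: inj_def)
  qed
  have "independent (v ` {..<n})"
  proof (rule independent_if_scalars_zero)
    fix g x assume g: "(\<Sum>x\<in>v ` {..<n}. g x *\<^sub>R x) = 0" and x: "x \<in> v ` {..<n}"
    have "(\<Sum>k<n. g (v k) *\<^sub>R v k) = 0" using g by (simp add: sum.reindex[OF injv])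
    then show "g x = 0" using x ind[of "\<lambda>k. g (v k)"] by auto
  qed simp
  then have "card (v ` {..<n}) \<le> DIM('a)" by (rule independent_bound[THEN conjunct2])
  then show False using card_image[OF injv] by (simp add: n_def)
qed

lemma sl2_weight_integral:
  fixes H X Y W :: "real^'n^'n"
  assumes HX: "bracket H X = l *\<^sub>R X" and HY: "bracket H Y = - l *\<^sub>R Y" and XY: "bracket X Y = c *\<^sub>R H"
    and HW: "bracket H W = m *\<^sub>R W" and "W \<noteq> 0" "l \<noteq> 0" "c \<noteq> 0"
  obtains n :: int where "2 * m = of_int n * l"
proof -
  have up: "bracket H (bracket X V) = (t + l) *\<^sub>R bracket X V" if "bracket H V = t *\<^sub>R V" for t V
    using bracket_jacobi[of H X V] by (simp add: HX that bracket_scaleR_left bracket_scaleR_right scaleR_add_left)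
  have down: "bracket H (bracket Y V) = (t - l) *\<^sub>R bracket Y V" if "bracket H V = t *\<^sub>R V" for t V
    using bracket_jacobi[of H Y V]
    by (simp add: HY that bracket_minus_left bracket_scaleR_left bracket_scaleR_right scaleR_diff_left)
  \<comment> \<open>Raise \<open>W\<close> to a highest weight vector \<open>v k\<close>, of weight \<open>nu\<close>, then lower it until it vanishes.\<close>
  define v where "v k = (bracket X ^^ k) W" for k
  have v: "bracket H (v k) = (m + real k * l) *\<^sub>R v k" for k
  proof (induction k)
    case (Suc k)
    show ?case using up[OF Suc] by (simp add: v_def algebra_simps)
  qed (simp add: v_def HW)
  have "inj (\<lambda>k. m + real k * l)" using \<open>l \<noteq> 0\<close> by (auto simp: inj_def)
  from eigenvector_sequence_vanishes[OF linear_bracket this v]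
  have ex: "\<exists>k. v k = 0" .
  define K where "K = (LEAST k. v k = 0)"
  have vK: "v K = 0" unfolding K_def using ex by (rule LeastI_ex)
  have "K \<noteq> 0"
  proof
    assume "K = 0"
    then show False using vK \<open>W \<noteq> 0\<close> by (simp add: v_def)
  qed
  then obtain k where K: "K = Suc k" by (cases K) auto
  have vk: "v k \<noteq> 0" using not_less_Least[of k "\<lambda>k. v k = 0"] K by (simp add: K_def)
  have Xvk: "bracket X (v k) = 0" using vK by (simp add: K v_def)
  define nu where "nu = m + real k * l"
  define w where "w j = (bracket Y ^^ j) (v k)" for j
  have w: "bracket H (w j) = (nu - real j * l) *\<^sub>R w j" for j
  proof (induction j)
    case (Suc j)
    show ?case using down[OF Suc] by (simp add: w_def algebra_simps)
  qed (simp add: w_def nu_def v)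
  \<comment> \<open>The coefficient is \<open>c\<close> times the sum of the weights
    \<open>nu - i * l\<close> for \<open>i = 0, ..., j\<close>.\<close>
  have Xw: "bracket X (w (Suc j)) = (c * (real (Suc j) * nu - l * real j * real (Suc j) / 2)) *\<^sub>R w j" for j
  proof (induction j)
    case 0
    have "bracket X (w (Suc 0)) = bracket (bracket X Y) (w 0)"
      using bracket_jacobi[of X Y "v k"] Xvk by (simp add: w_def)
    also have "\<dots> = (c * nu) *\<^sub>R w 0"
      using w[of 0] by (simp add: XY bracket_scaleR_left)
    finally show ?case by simp
  next
    case (Suc j)
    have "bracket X (w (Suc (Suc j))) = bracket (bracket X Y) (w (Suc j)) + bracket Y (bracket X (w (Suc j)))"
      using bracket_jacobi[of X Y "w (Suc j)"] by (simp add: w_def)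
    also have "bracket (bracket X Y) (w (Suc j)) = (c * (nu - real (Suc j) * l)) *\<^sub>R w (Suc j)"
      by (simp only: XY bracket_scaleR_left w scaleR_scaleR)
    also have "bracket Y (bracket X (w (Suc j))) = (c * (real (Suc j) * nu - l * real j * real (Suc j) / 2)) *\<^sub>R w (Suc j)"
      unfolding Suc.IH bracket_scaleR_right by (simp add: w_def)
    also have "(c * (nu - real (Suc j) * l)) *\<^sub>R w (Suc j) +
        (c * (real (Suc j) * nu - l * real j * real (Suc j) / 2)) *\<^sub>R w (Suc j) =
        (c * (real (Suc (Suc j)) * nu - l * real (Suc j) * real (Suc (Suc j)) / 2)) *\<^sub>R w (Suc j)"
      unfolding scaleR_add_left[symmetric]
      by (rule arg_cong[of _ _ "\<lambda>t. t *\<^sub>R w (Suc j)"]) (simp add: field_simps)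
    finally show ?case .
  qed
  have "inj (\<lambda>j. nu - real j * l)" using \<open>l \<noteq> 0\<close> by (auto simp: inj_def)
  from eigenvector_sequence_vanishes[OF linear_bracket this w]
  have ex': "\<exists>j. w j = 0" .
  define J where "J = (LEAST j. w j = 0)"
  have wJ: "w J = 0" unfolding J_def using ex' by (rule LeastI_ex)
  have "J \<noteq> 0"
  proof
    assume "J = 0"
    then show False using wJ vk by (simp add: w_def)
  qed
  then obtain j where J: "J = Suc j" by (cases J) auto
  have wj: "w j \<noteq> 0" using not_less_Least[of j "\<lambda>k. w k = 0"] J by (simp add: J_def)
  \<comment> \<open>At the lower end of the string \<open>w (Suc j)\<close> is 0 and
    \<open>w j\<close> is not, so this coefficient vanishes and \<open>2 * nu = l * j\<close>;
    undoing the \<open>k\<close> raising steps subtracts \<open>2 * k * l\<close>.\<close>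
  have "(c * (real (Suc j) * nu - l * real j * real (Suc j) / 2)) *\<^sub>R w j = 0"
    using Xw[of j] wJ by (simp only: J bracket_zero)
  then have "real (Suc j) * nu - l * real j * real (Suc j) / 2 = 0"
    using wj \<open>c \<noteq> 0\<close> by simp
  then have "real (Suc j) * (2 * nu - l * real j) = 0"
    by (simp add: algebra_simps)
  then have "2 * nu = l * real j" by (simp del: of_nat_Suc)
  then have "2 * m = of_int (int j - 2 * int k) * l" by (simp add: nu_def algebra_simps)
  then show ?thesis by (rule that)
qed

section \<open>Restricted roots in rank one\<close>

text \<open>The line spanned by \<open>H\<close> is the maximal abelian subspace \<open>\<aa>\<close>; the last assumption is its maximality.
  A linear functional on \<open>\<aa>\<close> is represented by its value \<open>l\<close> at \<open>H\<close>, and \<open>rs l\<close> is its root space.\<close>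

locale rank_one = reductive_cartan G p R \<sigma> \<epsilon> U K \<theta>
  for G :: "('g::topological_space, 'm) monoid_scheme" (structure)
    and p :: "'g \<Rightarrow> real^'n^'n" and R \<sigma> \<epsilon> U K \<theta> +
  fixes H :: "real^'n^'n"
  assumes H_mem: "H \<in> \<gg>" and D_H: "D H = - H" and H_nonzero: "H \<noteq> 0"
    and centralizer: "\<And>T. T \<in> \<gg> \<Longrightarrow> D T = - T \<Longrightarrow> bracket H T = 0 \<Longrightarrow> \<exists>c. T = c *\<^sub>R H"
begin

definition rs :: "real \<Rightarrow> (real^'n^'n) set" where
  "rs l = {X \<in> \<gg>. bracket H X = l *\<^sub>R X}"

definition Q :: "real^'n^'n \<Rightarrow> real" where "Q X = - B X (D X)"

definition h :: real where "h = B H H"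

lemma rs_mem: "X \<in> rs l \<Longrightarrow> X \<in> \<gg>"
  by (simp add: rs_def)

lemma rs_eigen: "X \<in> rs l \<Longrightarrow> bracket H X = l *\<^sub>R X"
  by (simp add: rs_def)

lemma rs_zero [simp]: "0 \<in> rs l"
  by (simp add: rs_def lie_algebra_zero)

lemma rs_add: "X \<in> rs l \<Longrightarrow> Y \<in> rs l \<Longrightarrow> X + Y \<in> rs l"
  by (simp add: rs_def lie_algebra_add bracket_add_right scaleR_add_right)

lemma rs_scaleR: "X \<in> rs l \<Longrightarrow> c *\<^sub>R X \<in> rs l"
  by (simp add: rs_def lie_algebra_scaleR bracket_scaleR_right)

lemma rs_minus: "X \<in> rs l \<Longrightarrow> - X \<in> rs l"
  using rs_scaleR[of X l "-1"] by simp

lemma rs_subspace: "subspace (rs l)"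
  by (simp add: subspace_def rs_add rs_scaleR)

lemma rs_D:
  assumes X: "X \<in> rs l" shows "D X \<in> rs (- l)"
proof -
  have "D (bracket H X) = bracket (D H) (D X)" by (rule D_bracket[OF H_mem rs_mem[OF X]])
  then have "l *\<^sub>R D X = - bracket H (D X)"
    by (simp only: rs_eigen[OF X] D_scaleR[OF rs_mem[OF X]] D_H bracket_minus_left)
  then have "bracket H (D X) = - (l *\<^sub>R D X)" by simp
  then show ?thesis using D_props(1)[OF rs_mem[OF X]] by (simp add: rs_def)
qed

lemma rs_bracket:
  assumes X: "X \<in> rs l" and Y: "Y \<in> rs m" shows "bracket X Y \<in> rs (l + m)"
  using lie_algebra_bracket[OF rs_mem[OF X] rs_mem[OF Y]] bracket_jacobi[of H X Y] rs_eigen[OF X] rs_eigen[OF Y]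
  by (simp add: rs_def bracket_scaleR_left bracket_scaleR_right scaleR_add_left)

lemma B_rs_orthogonal:
  assumes X: "X \<in> rs l" and Y: "Y \<in> rs m" and "l + m \<noteq> 0"
  shows "B X Y = 0"
proof -
  have "B (bracket X H) Y = B X (bracket H Y)"
    by (rule B_bracket[OF rs_mem[OF X] H_mem rs_mem[OF Y]])
  moreover have "bracket X H = (- l) *\<^sub>R X" using rs_eigen[OF X] by (simp add: bracket_commute[of X])
  ultimately have "- l * B X Y = m * B X Y"
    by (simp only: rs_eigen[OF Y] B_scaleR_left[OF rs_mem[OF X] rs_mem[OF Y]] B_scaleR_right[OF rs_mem[OF Y] rs_mem[OF X]])
  then have "(l + m) * B X Y = 0" by (simp add: algebra_simps)
  then show ?thesis using assms(3) by simp
qed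

lemma H_rs: "H \<in> rs 0"
  by (simp add: rs_def H_mem)

lemma Q_pos: "X \<in> \<gg> \<Longrightarrow> X \<noteq> 0 \<Longrightarrow> Q X > 0"
  unfolding Q_def by (rule killing_pos)

lemma Q_scaleR: "X \<in> \<gg> \<Longrightarrow> Q (c *\<^sub>R X) = c\<^sup>2 * Q X"
  using D_props(1)[of X]
  by (simp add: Q_def D_scaleR B_scaleR_left B_scaleR_right lie_algebra_scaleR power2_eq_square)

lemma Q_zero [simp]: "Q 0 = 0"
  using Q_scaleR[OF lie_algebra_zero, of 0] by simp

lemma Q_nonneg: "X \<in> \<gg> \<Longrightarrow> Q X \<ge> 0"
  using Q_pos[of X] by (cases "X = 0") auto

lemma h_pos: "h > 0"
proof -
  have "Q H = h"
    using B_scaleR_right[OF H_mem H_mem, of "-1"] by (simp add: Q_def h_def D_H)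
  then show ?thesis using Q_pos[OF H_mem H_nonzero] by simp
qed

text \<open>The bracket has weight 0 and is negated by \<open>D\<close>, so maximality of
  \<open>\<aa>\<close> puts it on the line of \<open>H\<close>; pairing with \<open>H\<close> under
  \<open>B\<close> gives the factor. For \<open>l \<noteq> 0\<close> and \<open>Z \<noteq> 0\<close>
  it is nonzero, as the sl(2) argument requires.\<close>

lemma bracket_root_D:
  assumes Z: "Z \<in> rs l"
  shows "bracket Z (D Z) = (- (l * Q Z) / h) *\<^sub>R H"
proof -
  have Zg: "Z \<in> \<gg>" and DZ: "D Z \<in> \<gg>" using rs_mem[OF Z] D_props(1) by auto
  define T where "T = bracket Z (D Z)"
  have T: "T \<in> rs 0" using rs_bracket[OF Z rs_D[OF Z]] by (simp add: T_def)
  have "D T = bracket (D Z) (D (D Z))" unfolding T_def by (rule D_bracket[OF Zg DZ])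
  also have "\<dots> = - T" unfolding T_def D_D[OF Zg] by (rule bracket_commute)
  finally obtain c where c: "T = c *\<^sub>R H"
    using centralizer[OF rs_mem[OF T]] rs_eigen[OF T] by auto
  have "c * h = B H T" using B_scaleR_right[OF H_mem H_mem] by (simp add: c h_def)
  also have "\<dots> = B (bracket H Z) (D Z)" unfolding T_def by (rule B_bracket[OF H_mem Zg DZ, symmetric])
  also have "\<dots> = - l * Q Z"
    using rs_eigen[OF Z] B_scaleR_left[OF Zg DZ] by (simp add: Q_def)
  finally have "c = - (l * Q Z) / h" using h_pos by (simp add: field_simps)
  then show ?thesis using c by (simp add: T_def)
qed

lemma root_ratio:
  assumes Z: "Z \<in> rs l" "Z \<noteq> 0" and W: "W \<in> rs m" "W \<noteq> 0" and l: "l \<noteq> 0"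
  obtains n :: int where "2 * m = of_int n * l"
proof (rule sl2_weight_integral[OF rs_eigen[OF Z(1)] _ bracket_root_D[OF Z(1)] rs_eigen[OF W(1)] W(2) l])
  show "bracket H (D Z) = - l *\<^sub>R D Z" using rs_eigen[OF rs_D[OF Z(1)]] .
  show "- (l * Q Z) / h \<noteq> 0" using l h_pos Q_pos[OF rs_mem[OF Z(1)] Z(2)] by simp
qed (rule that)

text \<open>The integers \<open>2 * m / l\<close> and \<open>2 * l / m\<close> are positive with
  product 4, and 3 does not divide 4.\<close>

lemma root_ratio_cases:
  assumes Z: "Z \<in> rs l" "Z \<noteq> 0" and W: "W \<in> rs m" "W \<noteq> 0" and l: "l > 0" "m > 0"
  shows "m = l / 2 \<or> m = l \<or> m = 2 * l"
proof -
  obtain n :: int where n: "2 * m = of_int n * l" by (rule root_ratio[OF Z W]) (use l in auto)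
  obtain k :: int where k: "2 * l = of_int k * m" by (rule root_ratio[OF W Z]) (use l in auto)
  have "0 < of_int n * l" "0 < of_int k * m" using n k l by linarith+
  then have pos: "n > 0" "k > 0" using l by (simp_all add: zero_less_mult_iff)
  have "4 * m = of_int n * (2 * l)" using n by simp
  then have "4 * m = of_int n * of_int k * m" by (simp only: k mult.assoc)
  then have "of_int (n * k) = (4::real)" using l by simp
  then have nk: "n * k = 4" by (metis of_int_eq_iff of_int_numeral)
  then have "n dvd 4" by (rule dvdI[OF sym])
  then have "n \<le> 4" by (rule zdvd_imp_le) simp
  then have "n = 1 \<or> n = 2 \<or> n = 3 \<or> n = 4" using pos by linarith
  moreover have "n \<noteq> 3"
  proof
    assume "n = 3"
    then have "3 * k = 4" using nk by simp
    then show False by presburger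
  qed
  ultimately show ?thesis using n by auto
qed

text \<open>If some positive root has its half among the roots, that half is \<open>a\<close>.
  Otherwise a positive root is the only one, since the ratios 2 and 1/2 are excluded. Without
  positive roots any \<open>a\<close> works, and 1 is taken.\<close>

lemma root_classification:
  obtains a where "a > 0" "\<And>l X. 0 < l \<Longrightarrow> X \<in> rs l \<Longrightarrow> X \<noteq> 0 \<Longrightarrow> l = a \<or> l = 2 * a"
proof (cases "\<exists>l>0. \<exists>X\<in>rs l. X \<noteq> 0")
  case False
  then show ?thesis using that[of 1] by auto
next
  case True
  then obtain l0 X0 where l0: "l0 > 0" "X0 \<in> rs l0" "X0 \<noteq> 0" by auto
  show ?thesis
  proof (cases "\<exists>l>0. (\<exists>X\<in>rs l. X \<noteq> 0) \<and> (\<exists>X\<in>rs (l/2). X \<noteq> 0)")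
    case True
    then obtain l X Y where l: "l > 0" "X \<in> rs l" "X \<noteq> 0" "Y \<in> rs (l/2)" "Y \<noteq> 0" by auto
    show ?thesis
    proof (rule that)
      show "l / 2 > 0" using l by simp
      fix m Z assume m: "0 < m" "Z \<in> rs m" "Z \<noteq> 0"
      show "m = l / 2 \<or> m = 2 * (l / 2)"
        using root_ratio_cases[OF l(2,3) m(2,3) l(1) m(1)] root_ratio_cases[OF l(4,5) m(2,3) _ m(1)] l(1) by auto
    qed
  next
    case False
    show ?thesis
    proof (rule that[OF l0(1)])
      fix m Z assume m: "0 < m" "Z \<in> rs m" "Z \<noteq> 0"
      have "m \<noteq> l0 / 2" using False l0 m by auto
      moreover have "m \<noteq> 2 * l0"
      proof
        assume "m = 2 * l0"
        then have "X0 \<in> rs (m / 2)" using l0(2) by simp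
        then show False using False l0(3) m by blast
      qed
      ultimately show "m = l0 \<or> m = 2 * l0"
        using root_ratio_cases[OF l0(2,3) m(2,3) l0(1) m(1)] by auto
    qed
  qed
qed

end

section \<open>The nilpotent algebra of the positive root spaces\<close>

locale rank_one_roots = rank_one G p R \<sigma> \<epsilon> U K \<theta> H
  for G :: "('g::topological_space, 'm) monoid_scheme" (structure)
    and p :: "'g \<Rightarrow> real^'n^'n" and R \<sigma> \<epsilon> U K \<theta> H +
  fixes a :: real
  assumes a_pos: "a > 0" and roots: "\<And>l X. 0 < l \<Longrightarrow> X \<in> rs l \<Longrightarrow> X \<noteq> 0 \<Longrightarrow> l = a \<or> l = 2 * a"
begin

text \<open>The Lie algebra of \<open>\<theta> N\<close>.\<close>

definition nn :: "(real^'n^'n) set" where "nn = {X + Y | X Y. X \<in> rs a \<and> Y \<in> rs (2 * a)}"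

lemma rs_high:
  assumes "X \<in> rs l" "l > 2 * a" shows "X = 0"
  using roots[of l X] assms a_pos by force

lemma nn_subset: "V \<in> nn \<Longrightarrow> V \<in> \<gg>"
  by (auto simp: nn_def intro: lie_algebra_add rs_mem)

lemma rs_1_nn: "X \<in> rs a \<Longrightarrow> X \<in> nn"
  unfolding nn_def using rs_zero[of "2 * a"] by force

lemma rs_2_nn: "Y \<in> rs (2 * a) \<Longrightarrow> Y \<in> nn"
  unfolding nn_def using rs_zero[of a] by force

lemma nn_subspace: "subspace nn"
  unfolding subspace_def
proof (intro conjI ballI allI)
  show "0 \<in> nn" using rs_1_nn[OF rs_zero] .
  fix x y c assume x: "x \<in> nn"
  obtain X Y where X: "x = X + Y" "X \<in> rs a" "Y \<in> rs (2 * a)" using x by (auto simp: nn_def)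
  show "c *\<^sub>R x \<in> nn"
    unfolding X(1) scaleR_add_right nn_def using X rs_scaleR by blast
  assume y: "y \<in> nn"
  obtain X' Y' where Y: "y = X' + Y'" "X' \<in> rs a" "Y' \<in> rs (2 * a)" using y by (auto simp: nn_def)
  have "x + y = (X + X') + (Y + Y')" by (simp add: X Y algebra_simps)
  then show "x + y \<in> nn" unfolding nn_def using X Y rs_add by blast
qed

lemma bracket_rs_12:
  assumes "X \<in> rs a" "Y \<in> rs (2 * a)" shows "bracket X Y = 0"
  by (rule rs_high[OF rs_bracket[OF assms]]) (use a_pos in simp)

lemma bracket_nn_rs2:
  assumes "V \<in> nn" "Y \<in> rs (2 * a)" shows "bracket V Y = 0"
proof -
  obtain X X' where X: "V = X + X'" "X \<in> rs a" "X' \<in> rs (2 * a)" using assms by (auto simp: nn_def)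
  have "bracket X' Y = 0"
    by (rule rs_high[OF rs_bracket[OF X(3) assms(2)]]) (use a_pos in simp)
  then show ?thesis using bracket_rs_12[OF X(2) assms(2)] by (simp add: X bracket_add_left)
qed

lemma bracket_nn:
  assumes "V \<in> nn" "V' \<in> nn" shows "bracket V V' \<in> rs (2 * a)"
proof -
  obtain X Y where X: "V = X + Y" "X \<in> rs a" "Y \<in> rs (2 * a)" using assms by (auto simp: nn_def)
  obtain X' Y' where X': "V' = X' + Y'" "X' \<in> rs a" "Y' \<in> rs (2 * a)" using assms by (auto simp: nn_def)
  have "bracket Y X' = 0"
    using bracket_rs_12[OF X'(2) X(3)] bracket_commute[of Y X'] by simp
  then have "bracket V X' = bracket X X'" by (simp add: X bracket_add_left)
  then have "bracket V V' = bracket X X'"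
    using bracket_nn_rs2[OF assms(1) X'(3)] by (simp add: X' bracket_add_right)
  then show ?thesis using rs_bracket[OF X(2) X'(2)] by simp
qed

lemma conj_nn:
  assumes "V \<in> nn" "V' \<in> nn"
  shows "mat_exp V ** V' ** mat_exp (- V) = V' + bracket V V'"
proof -
  have "bracket V (bracket V V') = 0" by (rule bracket_nn_rs2[OF assms(1) bracket_nn[OF assms]])
  then show ?thesis using mat_exp_conj_nilpotent[of V V'] by simp
qed

section \<open>Injectivity of the exponential on \<open>nn\<close>\<close>

lemma mat_exp_dilation:
  assumes "X \<in> rs a" "Y \<in> rs (2 * a)"
  shows "mat_exp (t *\<^sub>R H) ** mat_exp (X + Y) ** mat_exp (- (t *\<^sub>R H)) =
    mat_exp (exp (t * a) *\<^sub>R X) ** mat_exp ((exp (t * a))\<^sup>2 *\<^sub>R Y)"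
proof -
  have "mat_exp (t *\<^sub>R H) ** mat_exp (X + Y) ** mat_exp (- (t *\<^sub>R H)) =
      mat_exp (mat_exp (t *\<^sub>R H) ** (X + Y) ** mat_exp (- (t *\<^sub>R H)))"
    by (rule mat_exp_conj[symmetric]) simp_all
  also have "mat_exp (t *\<^sub>R H) ** (X + Y) ** mat_exp (- (t *\<^sub>R H)) = exp (t * a) *\<^sub>R X + exp (t * (2 * a)) *\<^sub>R Y"
    unfolding mm.add_left mm.add_right
    using rs_eigen[OF assms(1)] rs_eigen[OF assms(2)]
    by (intro arg_cong2[where f = "(+)"] mat_exp_conj_eigen) (simp_all add: bracket_scaleR_left)
  also have "exp (t * (2 * a)) = (exp (t * a))\<^sup>2"
    using exp_double[of "t * a"] by (simp add: mult.left_commute)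
  also have "mat_exp (exp (t * a) *\<^sub>R X + (exp (t * a))\<^sup>2 *\<^sub>R Y) =
      mat_exp (exp (t * a) *\<^sub>R X) ** mat_exp ((exp (t * a))\<^sup>2 *\<^sub>R Y)"
    by (rule mat_exp_add) (use bracket_rs_12[OF assms] in \<open>simp add: bracket_def mm.scaleR_left mm.scaleR_right\<close>)
  finally show ?thesis .
qed

text \<open>Conjugation by \<open>exp (t H)\<close> dilates \<open>X + Y\<close> to \<open>c X + c\<^sup>2 Y\<close>, and the derivative at \<open>c = 0\<close> isolates \<open>X\<close>.\<close>

lemma mat_exp_inj_nn:
  assumes V: "V \<in> nn" "V' \<in> nn" and eq: "mat_exp V = mat_exp V'"
  shows "V = V'"
proof -
  obtain X Y where X: "V = X + Y" "X \<in> rs a" "Y \<in> rs (2 * a)" using V by (auto simp: nn_def)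
  obtain X' Y' where X': "V' = X' + Y'" "X' \<in> rs a" "Y' \<in> rs (2 * a)" using V by (auto simp: nn_def)
  have main: "mat_exp (c *\<^sub>R X) ** mat_exp (c\<^sup>2 *\<^sub>R Y) = mat_exp (c *\<^sub>R X') ** mat_exp (c\<^sup>2 *\<^sub>R Y')" if "c > 0" for c
  proof -
    have c: "exp (ln c / a * a) = c" using that a_pos by simp
    show ?thesis
      using mat_exp_dilation[OF X(2,3), of "ln c / a"] mat_exp_dilation[OF X'(2,3), of "ln c / a"]
        eq[unfolded X(1) X'(1)]
      by (simp only: c)
  qed
  have lim: "(\<lambda>k. real k *\<^sub>R (mat_exp ((1 / real k) *\<^sub>R S) ** mat_exp ((1 / real k)\<^sup>2 *\<^sub>R T) - mat 1)) \<longlonglongrightarrow> S"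
    for S T :: "real^'n^'n"
  proof -
    have "((\<lambda>c::real. c\<^sup>2) has_real_derivative 0) (at 0)"
      by (auto intro!: derivative_eq_intros)
    then have "((\<lambda>c::real. c\<^sup>2) has_vector_derivative 0) (at 0)"
      by (simp only: has_real_derivative_iff_has_vector_derivative)
    from vector_diff_chain_at[OF this has_vector_derivative_mat_exp[of T "0\<^sup>2" UNIV]]
    have "((\<lambda>c. mat_exp (c\<^sup>2 *\<^sub>R T)) has_vector_derivative 0 *\<^sub>R (T ** mat_exp (0\<^sup>2 *\<^sub>R T))) (at 0)"
      by (simp only: comp_def)
    from mm.has_vector_derivative[OF has_vector_derivative_mat_exp[of S 0 UNIV] this]
    have "((\<lambda>c. mat_exp (c *\<^sub>R S) ** mat_exp (c\<^sup>2 *\<^sub>R T)) has_vector_derivative S) (at 0)"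
      by simp
    from has_vector_derivative_imp_sequence[OF this] show ?thesis by simp
  qed
  have "\<forall>\<^sub>F k in sequentially. real k *\<^sub>R (mat_exp ((1 / real k) *\<^sub>R X) ** mat_exp ((1 / real k)\<^sup>2 *\<^sub>R Y) - mat 1) =
      real k *\<^sub>R (mat_exp ((1 / real k) *\<^sub>R X') ** mat_exp ((1 / real k)\<^sup>2 *\<^sub>R Y') - mat 1)"
    using eventually_gt_at_top[of 0] by eventually_elim (simp only: main of_nat_0_less_iff zero_less_divide_1_iff)
  from LIMSEQ_unique[OF Lim_transform_eventually[OF lim this] lim]
  have XX: "X = X'" .
  \<comment> \<open>The first factors are now equal and cancel, and \<open>c\<^sup>2\<close> runs
    through all positive reals.\<close>
  have eqY: "mat_exp (t *\<^sub>R Y) = mat_exp (t *\<^sub>R Y')" if "0 < t" for t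
  proof -
    define c where "c = sqrt t"
    have c: "c > 0" "c\<^sup>2 = t" using that by (auto simp: c_def)
    have cancel: "mat_exp (- (c *\<^sub>R X)) ** (mat_exp (c *\<^sub>R X) ** S) = S" for S
      by (simp only: matrix_mul_assoc mat_exp_minus_left matrix_mul_lid)
    have "mat_exp (c *\<^sub>R X) ** mat_exp (c\<^sup>2 *\<^sub>R Y) = mat_exp (c *\<^sub>R X) ** mat_exp (c\<^sup>2 *\<^sub>R Y')"
      using main[OF c(1)] unfolding XX .
    then have "mat_exp (c\<^sup>2 *\<^sub>R Y) = mat_exp (c\<^sup>2 *\<^sub>R Y')" by (metis cancel)
    then show ?thesis by (simp only: c(2))
  qed
  have YY: "Y = Y'"
    by (rule mat_exp_eq_near_zero_imp_eq[OF zero_less_one eqY])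
  show ?thesis by (simp only: X(1) X'(1) XX YY)
qed

text \<open>Needed for the Lie algebra of \<open>N\<close>. Choose \<open>V t\<close> in
  \<open>nn\<close> with the same exponential as \<open>t *\<^sub>R W\<close>. Injectivity turns
  commuting exponentials into commuting, hence additive, elements \<open>V t\<close>. As
  \<open>V\<close> is not known to be continuous, it is evaluated only at the times
  \<open>1/k\<close>, which already determine the derivative at 0 and give
  \<open>W = V 1\<close>.\<close>

lemma mat_exp_line_in_nn:
  assumes W: "\<And>t. mat_exp (t *\<^sub>R W) \<in> mat_exp ` nn"
  shows "W \<in> nn"
proof -
  have "\<forall>t. \<exists>V. V \<in> nn \<and> mat_exp (t *\<^sub>R W) = mat_exp V" using W by blast
  then obtain V where V: "\<And>t. V t \<in> nn" "\<And>t. mat_exp (t *\<^sub>R W) = mat_exp (V t)" by metis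
  have add: "V (s + t) = V s + V t" for s t
  proof -
    have 1: "mat_exp (V s) ** mat_exp (V t) = mat_exp (V (s + t))" for s t
      by (simp only: V(2)[symmetric] mat_exp_scaleR_add)
    have "mat_exp (V s) ** mat_exp (V t) = mat_exp (V t) ** mat_exp (V s)"
      by (simp only: 1 add.commute)
    then have "mat_exp (V s) ** mat_exp (V t) ** mat_exp (- V s) = mat_exp (V t) ** (mat_exp (V s) ** mat_exp (- V s))"
      by (simp only: matrix_mul_assoc)
    moreover have "mat_exp (V s) ** mat_exp (V t) ** mat_exp (- V s) = mat_exp (mat_exp (V s) ** V t ** mat_exp (- V s))"
      by (rule mat_exp_conj[symmetric]) simp_all
    ultimately have "mat_exp (V t + bracket (V s) (V t)) = mat_exp (V t)"
      by (simp add: conj_nn V(1))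
    moreover have "V t + bracket (V s) (V t) \<in> nn"
      using nn_subspace V(1) rs_2_nn[OF bracket_nn] by (simp add: subspace_add)
    ultimately have "V t + bracket (V s) (V t) = V t" using mat_exp_inj_nn V(1) by blast
    then have "bracket (V s) (V t) = 0" by simp
    then have "mat_exp (V s + V t) = mat_exp (V s) ** mat_exp (V t)"
      by (intro mat_exp_add) (simp add: bracket_def)
    also have "\<dots> = mat_exp (V (s + t))" by (rule 1)
    finally have "mat_exp (V s + V t) = mat_exp (V (s + t))" .
    moreover have "V s + V t \<in> nn" using nn_subspace V(1) by (simp add: subspace_add)
    ultimately show ?thesis using mat_exp_inj_nn V(1) by metis
  qed
  have V0: "V 0 = 0" using add[of 0 0] by simp
  have mult: "V (real k * t) = real k *\<^sub>R V t" for k t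
  proof (induction k)
    case (Suc k)
    have "real (Suc k) * t = real k * t + t" by (simp add: distrib_right)
    then have "V (real (Suc k) * t) = real k *\<^sub>R V t + V t" by (simp only: add Suc)
    then show ?case by (simp add: scaleR_add_left)
  qed (simp add: V0)
  have D: "(\<lambda>k. real k *\<^sub>R (mat_exp ((1 / real k) *\<^sub>R Z) - mat 1)) \<longlonglongrightarrow> Z" for Z :: "real^'n^'n"
    using has_vector_derivative_imp_sequence[OF has_vector_derivative_mat_exp[of Z 0 UNIV]] by simp
  have "\<forall>\<^sub>F k in sequentially. real k *\<^sub>R (mat_exp ((1 / real k) *\<^sub>R W) - mat 1) =
      real k *\<^sub>R (mat_exp ((1 / real k) *\<^sub>R V 1) - mat 1)"
    using eventually_gt_at_top[of 0]
  proof eventually_elim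
    case (elim k)
    have "real k *\<^sub>R V (1 / real k) = V 1" using mult[of k "1 / real k"] elim by simp
    then have "(1 / real k) *\<^sub>R V 1 = (1 / real k) *\<^sub>R (real k *\<^sub>R V (1 / real k))" by simp
    then have "V (1 / real k) = (1 / real k) *\<^sub>R V 1" using elim by simp
    then show ?case by (simp only: V(2))
  qed
  from LIMSEQ_unique[OF Lim_transform_eventually[OF D this] D]
  have "W = V 1" .
  then show ?thesis using V(1) by simp
qed

end

section \<open>The Iwasawa projection on the commutator subgroup\<close>

context rank_one_roots
begin

lemma K_closed: "k \<in> K \<Longrightarrow> k \<in> carrier G"
  by (simp add: fixed_K)

lemma K_inv: "k \<in> K \<Longrightarrow> inv k \<in> K"
  by (simp add: fixed_K theta_inv)

lemma Q_Ad_K: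
  assumes "k \<in> K" "W \<in> \<gg>" shows "Q (Ad G p k W) = Q W"
proof -
  have k: "k \<in> carrier G" "\<theta> k = k" using assms(1) by (simp_all add: fixed_K)
  show ?thesis
    unfolding Q_def D_Ad[OF k(1) assms(2)] k(2)
    by (simp only: B_Ad[OF k(1) assms(2) D_props(1)[OF assms(2)]])
qed

text \<open>The inverse of \<open>E V\<close> fixes \<open>F\<close>, that of the factor in
  \<open>A\<close> scales it by \<open>exp (- 2 * a * s)\<close>, and that of \<open>k\<close>
  preserves \<open>Q\<close>; \<open>Q\<close> squares the scale.\<close>

lemma Q_iwasawa:
  assumes V: "V \<in> nn" and k: "k \<in> K" and x: "x = E V \<otimes> E (s *\<^sub>R H) \<otimes> k" and F: "F \<in> rs (2 * a)"
  shows "Q (Ad G p (inv x) F) = exp (- 4 * a * s) * Q F"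
proof -
  note Vg = nn_subset[OF V] and kG = K_closed[OF k] and Fg = rs_mem[OF F]
  have sH: "s *\<^sub>R H \<in> \<gg>" by (rule lie_algebra_scaleR[OF H_mem])
  have "inv x = inv k \<otimes> (inv (E (s *\<^sub>R H)) \<otimes> inv (E V))"
    unfolding x using Vg kG sH by (simp add: inv_mult_group)
  also have "\<dots> = inv k \<otimes> (E (- (s *\<^sub>R H)) \<otimes> E (- V))"
    by (simp only: E_minus[OF Vg] E_minus[OF sH])
  finally have "Ad G p (inv x) F = Ad G p (inv k) (Ad G p (E (- (s *\<^sub>R H))) (Ad G p (E (- V)) F))"
    using lie_algebra_minus[OF Vg] lie_algebra_minus[OF sH] kG by (simp add: Ad_mult)
  also have "Ad G p (E (- V)) F = F"
    using mat_exp_conj_eigen[of "- V" F 0] bracket_nn_rs2[OF V F] lie_algebra_minus[OF Vg]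
    by (simp add: Ad_E bracket_minus_left)
  also have "Ad G p (E (- (s *\<^sub>R H))) F = exp (- (s * (2 * a))) *\<^sub>R F"
    unfolding Ad_E[OF lie_algebra_minus[OF sH]]
    by (rule mat_exp_conj_eigen) (simp add: bracket_minus_left bracket_scaleR_left rs_eigen[OF F])
  finally have "Q (Ad G p (inv x) F) = Q (Ad G p (inv k) (exp (- (s * (2 * a))) *\<^sub>R F))"
    by (simp only:)
  also have "\<dots> = (exp (- (s * (2 * a))))\<^sup>2 * Q F"
    by (simp only: Q_Ad_K[OF K_inv[OF k] lie_algebra_scaleR[OF Fg]] Q_scaleR[OF Fg])
  also have "(exp (- (s * (2 * a))))\<^sup>2 = exp (- 4 * a * s)"
    using exp_double[of "- (s * (2 * a))"] by (simp add: mult.commute mult.left_commute)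
  finally show ?thesis .
qed

text \<open>The exponential series acting on \<open>Z\<close> stops after the quadratic term and
  leaves \<open>Z + c H + d Y\<close>. The three terms have different weights, hence are orthogonal
  for the form of \<open>Q\<close>, and their values of \<open>Q\<close> add up.\<close>

lemma Q_theta_E:
  assumes Z: "Z \<in> rs (2 * a)"
  shows "Q (Ad G p (inv (\<theta> (E Z))) Z) = (1 + 2 * a\<^sup>2 * Q Z / h)\<^sup>2 * Q Z"
proof -
  define Y where "Y = D Z"
  define c where "c = - (2 * a * Q Z) / h"
  \<comment> \<open>Bracketing \<open>c *\<^sub>R H\<close> with \<open>- Y\<close> gives
    \<open>- 2 * a * c\<close> times \<open>Y\<close>; the 1/2 of the exponential series leaves
    \<open>d\<close>, which equals \<open>2 * a\<^sup>2 * Q Z / h\<close>.\<close>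
  define d where "d = - (a * c)"
  have Zg: "Z \<in> \<gg>" by (rule rs_mem[OF Z])
  have Y: "Y \<in> rs (- (2 * a))" unfolding Y_def by (rule rs_D[OF Z])
  have Yg: "Y \<in> \<gg>" by (rule rs_mem[OF Y])
  have DY: "D Y = Z" using Zg by (simp add: Y_def)
  have ZY: "bracket Z Y = c *\<^sub>R H" unfolding Y_def c_def by (rule bracket_root_D[OF Z])
  have 1: "bracket (- Y) Z = c *\<^sub>R H"
    using ZY bracket_commute[of Z Y] by (simp add: bracket_minus_left)
  have "bracket Y H = (2 * a) *\<^sub>R Y"
    using rs_eigen[OF Y] bracket_commute[of Y H] by simp
  then have "bracket (- Y) (c *\<^sub>R H) = (2 * d) *\<^sub>R Y"
    by (simp add: bracket_minus_left bracket_scaleR_right d_def)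
  then have 2: "bracket (- Y) (bracket (- Y) Z) = (2 * d) *\<^sub>R Y"
    by (simp only: 1)
  have 3: "bracket (- Y) (bracket (- Y) (bracket (- Y) Z)) = 0"
    by (simp only: 2) (simp add: bracket_minus_left bracket_scaleR_right)
  define W where "W = Z + (c *\<^sub>R H + d *\<^sub>R Y)"
  have "inv (\<theta> (E Z)) = E (- Y)"
    using Zg Yg by (simp add: theta_E E_minus Y_def[symmetric])
  then have "Ad G p (inv (\<theta> (E Z))) Z = mat_exp (- Y) ** Z ** mat_exp (- (- Y))"
    by (simp only: Ad_E[OF lie_algebra_minus[OF Yg]])
  also have "\<dots> = W"
    using mat_exp_conj_nilpotent[OF 3] unfolding 2 unfolding 1 by (simp add: W_def algebra_simps)
  finally have AdW: "Ad G p (inv (\<theta> (E Z))) Z = W" .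
  have cH: "c *\<^sub>R H \<in> \<gg>" "(- c) *\<^sub>R H \<in> \<gg>" by (rule lie_algebra_scaleR[OF H_mem])+
  have dY: "d *\<^sub>R Y \<in> \<gg>" by (rule lie_algebra_scaleR[OF Yg])
  have dZ: "d *\<^sub>R Z \<in> \<gg>" by (rule lie_algebra_scaleR[OF Zg])
  have "D W = Y + (c *\<^sub>R (- H) + d *\<^sub>R Z)"
    unfolding W_def D_add[OF Zg lie_algebra_add[OF cH(1) dY]] D_add[OF cH(1) dY] D_scaleR[OF H_mem] D_scaleR[OF Yg] DY D_H
    by (simp only: Y_def)
  then have DW: "D W = Y + ((- c) *\<^sub>R H + d *\<^sub>R Z)" by simp
  have B: "B Z Y = - Q Z" "B Y Z = - Q Z" "B H H = h" "B Z H = 0" "B H Z = 0" "B Y H = 0" "B H Y = 0" "B Z Z = 0" "B Y Y = 0"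
    using B_commute[OF Yg Zg] a_pos B_rs_orthogonal[OF Z H_rs] B_rs_orthogonal[OF H_rs Z] B_rs_orthogonal[OF Y H_rs]
      B_rs_orthogonal[OF H_rs Y] B_rs_orthogonal[OF Z Z] B_rs_orthogonal[OF Y Y]
    by (simp_all add: Q_def Y_def h_def)
  \<comment> \<open>Since \<open>c\<^sup>2 * h = 2 * d * Q Z\<close>, the sum is
    \<open>(1 + d)\<^sup>2 * Q Z\<close>.\<close>
  have "Q W = Q Z + c\<^sup>2 * h + d\<^sup>2 * Q Z"
    unfolding Q_def[of W] DW unfolding W_def
    by (simp only: B_add_left B_add_right B_scaleR_left B_scaleR_right lie_algebra_add Zg Yg H_mem cH dY dZ B)
       (simp add: power2_eq_square algebra_simps)
  also have "\<dots> = (1 + 2 * a\<^sup>2 * Q Z / h)\<^sup>2 * Q Z"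
    using h_pos by (simp add: c_def d_def field_simps power2_eq_square power4_eq_xxxx)
  finally show ?thesis by (simp only: AdW)
qed

lemma iwasawa_height:
  assumes "V \<in> nn" "k \<in> K" and x: "\<theta> (E Z) = E V \<otimes> E (s *\<^sub>R H) \<otimes> k"
    and Z: "Z \<in> rs (2 * a)" and F: "F \<in> rs (2 * a)" "F \<noteq> 0"
  shows "exp (- 2 * a * s) = 1 + 2 * a\<^sup>2 * Q Z / h"
proof (cases "Z = 0")
  case True
  \<comment> \<open>For \<open>Z = 0\<close> the test vector \<open>Z\<close> carries no
    information; a nonzero \<open>F\<close> shows that the height is 1.\<close>
  have "Q F = exp (- 4 * a * s) * Q F"
    using Q_iwasawa[OF assms(1-3) F(1)] True by simp
  then have "exp (- 4 * a * s) = 1" using Q_pos[OF rs_mem[OF F(1)] F(2)] by simp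
  then show ?thesis using True by simp
next
  case False
  have q: "Q Z > 0" using Q_pos[OF rs_mem[OF Z] False] .
  have "exp (- 4 * a * s) * Q Z = (1 + 2 * a\<^sup>2 * Q Z / h)\<^sup>2 * Q Z"
    by (rule trans[OF Q_iwasawa[OF assms(1-3) Z, symmetric] Q_theta_E[OF Z]])
  then have "exp (- 4 * a * s) = (1 + 2 * a\<^sup>2 * Q Z / h)\<^sup>2" using q by simp
  moreover have "exp (- 4 * a * s) = (exp (- 2 * a * s))\<^sup>2"
    using exp_double[of "- 2 * a * s"] by (simp add: mult.assoc)
  ultimately have "(exp (- 2 * a * s))\<^sup>2 = (1 + 2 * a\<^sup>2 * Q Z / h)\<^sup>2" by simp
  moreover have "0 \<le> 1 + 2 * a\<^sup>2 * Q Z / h" using q h_pos by simp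
  ultimately show ?thesis by (simp add: power2_eq_iff_nonneg)
qed

text \<open>\<open>B\<close> and \<open>D\<close> behave linearly only on \<open>\<gg>\<close>.
  Composed with a linear projection onto \<open>\<gg>\<close> they give a bilinear form on all
  matrices, which is continuous.\<close>

lemma Q_continuous_extension:
  obtains q :: "real^'n^'n \<Rightarrow> real" where "continuous_on UNIV q" "\<And>X. X \<in> \<gg> \<Longrightarrow> Q X = q X"
proof -
  obtain S where S: "S \<subseteq> \<gg>" "independent S" "\<gg> \<subseteq> span S" by (rule basis_exists[of \<gg>])
  have spanS: "span S = \<gg>" using S(1,3) lie_algebra_subspace by (simp add: span_minimal subset_antisym)
  obtain \<pi> where \<pi>: "linear \<pi>" "\<forall>x\<in>S. \<pi> x = id x" "range \<pi> = span (id ` S)"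
    using linear_independent_extend_subspace[OF S(2), of id] by blast
  have \<pi>g: "\<pi> X \<in> \<gg>" for X using \<pi>(3) spanS by auto
  have \<pi>id: "\<pi> X = X" if "X \<in> \<gg>" for X
    using linear_eq_on_span[OF \<pi>(1) linear_id, of S X] \<pi>(2) that spanS by auto
  have "bilinear (\<lambda>X Y. - B (\<pi> X) (D (\<pi> Y)))"
    unfolding bilinear_def linear_iff
    by (auto simp: linear_add[OF \<pi>(1)] linear_scale[OF \<pi>(1)] \<pi>g D_props(1) D_add D_scaleR
        B_add_left B_add_right B_scaleR_left B_scaleR_right)
  then have "bounded_bilinear (\<lambda>X Y. - B (\<pi> X) (D (\<pi> Y)))"
    by (simp add: bilinear_conv_bounded_bilinear)
  then have "continuous_on UNIV (\<lambda>X. - B (\<pi> X) (D (\<pi> X)))"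
    by (rule bounded_bilinear.continuous_on) (rule continuous_on_id)+
  then show ?thesis by (rule that) (simp add: Q_def \<pi>id)
qed

text \<open>The source of measurability for the height: the Iwasawa decomposition is a mere
  bijection and gives no continuity of its factors.\<close>

lemma Q_Ad_continuous:
  assumes F: "F \<in> \<gg>"
  shows "continuous_on (carrier G) (\<lambda>x. Q (Ad G p (inv x) F))"
proof -
  obtain q where q: "continuous_on UNIV q" "\<And>X. X \<in> \<gg> \<Longrightarrow> Q X = q X"
    using Q_continuous_extension by blast
  have "continuous_on (carrier G) (\<lambda>x. p (inv x))"
    by (rule continuous_on_compose2[OF p_continuous inv_continuous]) auto
  then have "continuous_on (carrier G) (\<lambda>x. q (p (inv x) ** F ** p x))"
    by (intro continuous_on_compose2[OF q(1)] mm.continuous_on continuous_on_const p_continuous) auto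
  then show ?thesis
  proof (rule continuous_on_eq)
    fix x assume x: "x \<in> carrier G"
    then show "q (p (inv x) ** F ** p x) = Q (Ad G p (inv x) F)"
      using q(2)[OF lie_algebra_Ad[OF _ F], of "inv x"] by (simp add: Ad_def)
  qed
qed

text \<open>Since \<open>\<theta>\<close> negates weights, the claim is that \<open>D W\<close> lies
  in \<open>nn\<close>. A one-parameter subgroup inside \<open>N\<close> does not come from a line
  in \<open>nn\<close> by definition; \<open>mat_exp_line_in_nn\<close> shows that it does.\<close>

lemma lie_algebra_N: "lie_algebra G p (\<theta> ` E ` nn) = {X + Y | X Y. X \<in> rs (- a) \<and> Y \<in> rs (- (2 * a))}"
proof (intro equalityI subsetI)
  fix W assume "W \<in> lie_algebra G p (\<theta> ` E ` nn)"
  then obtain \<gamma> where \<gamma>: "one_parameter_subgroup G p W \<gamma>" "range \<gamma> \<subseteq> \<theta> ` E ` nn"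
    by (auto simp: lie_algebra_def)
  have Wg: "W \<in> \<gg>" using \<gamma>(1) by (auto simp: lie_algebra_def one_parameter_subgroup_def)
  note DW = D_props(1)[OF Wg]
  have "mat_exp (t *\<^sub>R D W) \<in> mat_exp ` nn" for t
  proof -
    have "E (t *\<^sub>R W) \<in> \<theta> ` E ` nn" using \<gamma> E_scaleR_one_parameter by auto
    then obtain V where V: "V \<in> nn" "E (t *\<^sub>R W) = \<theta> (E V)" by blast
    have "E (t *\<^sub>R D W) = \<theta> (E (t *\<^sub>R W))" by (simp only: D_props(2)[OF Wg])
    also have "\<dots> = E V" using V nn_subset by simp
    finally have "p (E (t *\<^sub>R D W)) = p (E V)" by simp
    then have "mat_exp (t *\<^sub>R D W) = mat_exp V" using nn_subset[OF V(1)] DW by (simp add: p_E_scaleR p_E)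
    then show ?thesis using V(1) by blast
  qed
  then have "D W \<in> nn" by (rule mat_exp_line_in_nn)
  then obtain X Y where X: "D W = X + Y" "X \<in> rs a" "Y \<in> rs (2 * a)" by (auto simp: nn_def)
  have "W = D X + D Y" using D_D[OF Wg] X D_add[OF rs_mem rs_mem] by metis
  then show "W \<in> {X + Y | X Y. X \<in> rs (- a) \<and> Y \<in> rs (- (2 * a))}"
    using rs_D X(2,3) by blast
next
  fix W assume "W \<in> {X + Y | X Y. X \<in> rs (- a) \<and> Y \<in> rs (- (2 * a))}"
  then obtain X Y where X: "W = X + Y" "X \<in> rs (- a)" "Y \<in> rs (- (2 * a))" by auto
  have Wg: "W \<in> \<gg>" using X lie_algebra_add rs_mem by blast
  have "D W = D X + D Y" using X D_add rs_mem by simp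
  moreover have "D X \<in> rs a" "D Y \<in> rs (2 * a)" using rs_D[OF X(2)] rs_D[OF X(3)] by simp_all
  ultimately have DW: "D W \<in> nn" by (auto simp: nn_def)
  have "E (t *\<^sub>R W) \<in> \<theta> ` E ` nn" for t
  proof -
    have "\<theta> (E (t *\<^sub>R D W)) = E (t *\<^sub>R W)" using D_props[OF D_props(1)[OF Wg]] Wg by simp
    moreover have "t *\<^sub>R D W \<in> nn" using DW nn_subspace by (simp add: subspace_scale)
    ultimately show ?thesis by (metis imageI)
  qed
  then show "W \<in> lie_algebra G p (\<theta> ` E ` nn)"
    unfolding lie_algebra_def using E_one_parameter[OF Wg] by blast
qed

text \<open>The Lie algebra of \<open>\<theta> [N, N]\<close>.\<close>

definition zz :: "(real^'n^'n) set" where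
  "zz = span {bracket X Y | X Y. X \<in> nn \<and> Y \<in> nn}"

section \<open>The commutator subgroup of \<open>N\<close>\<close>

lemma zz_subspace: "subspace zz"
  by (simp add: zz_def)

lemma zz_rs: "zz \<subseteq> rs (2 * a)"
  unfolding zz_def by (rule span_minimal[OF _ rs_subspace]) (auto intro: bracket_nn)

lemma zz_nn: "Z \<in> zz \<Longrightarrow> Z \<in> nn"
  using zz_rs rs_2_nn by blast

lemma E_add_rs2:
  assumes "X \<in> rs (2 * a)" "Y \<in> rs (2 * a)" shows "E (X + Y) = E X \<otimes> E Y"
  by (rule E_add[OF rs_mem[OF assms(1)] rs_mem[OF assms(2)] bracket_nn_rs2[OF rs_2_nn[OF assms(1)] assms(2)]])

text \<open>Brackets are central in \<open>nn\<close>, so conjugation by \<open>E X\<close> only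
  adds \<open>bracket X Y\<close> to \<open>Y\<close>, and the two summands commute.\<close>

lemma commutator_nn:
  assumes "X \<in> nn" "Y \<in> nn"
  shows "E X \<otimes> E Y \<otimes> inv (E X) \<otimes> inv (E Y) = E (bracket X Y)"
proof -
  note Xg = nn_subset[OF assms(1)] and Yg = nn_subset[OF assms(2)]
  have b: "bracket X Y \<in> rs (2 * a)" by (rule bracket_nn[OF assms])
  have "E X \<otimes> E Y \<otimes> inv (E X) = E (Y + bracket X Y)"
    using E_Ad[OF E_closed[OF Xg] Yg] conj_nn[OF assms] by (simp add: Ad_E[OF Xg])
  also have "\<dots> = E (bracket X Y + Y)" by (simp add: add.commute)
  also have "\<dots> = E (bracket X Y) \<otimes> E Y"
    by (rule E_add[OF rs_mem[OF b] Yg]) (use bracket_nn_rs2[OF assms(2) b] bracket_commute[of "bracket X Y" Y] in simp)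
  finally show ?thesis using Yg rs_mem[OF b] by (simp add: m_assoc)
qed

text \<open>\<open>derived\<close> is generated by commutators, without closure. This already gives
  all of \<open>zz\<close>: \<open>E\<close> is additive there, and a scalar multiple of a bracket
  is again a bracket.\<close>

lemma derived_N: "derived G (\<theta> ` E ` nn) = \<theta> ` E ` zz"
proof -
  have comm: "\<theta> (E X) \<otimes> \<theta> (E Y) \<otimes> inv (\<theta> (E X)) \<otimes> inv (\<theta> (E Y)) = \<theta> (E (bracket X Y))"
    if "X \<in> nn" "Y \<in> nn" for X Y
    using that nn_subset[OF that(1)] nn_subset[OF that(2)]
    by (simp only: commutator_nn[symmetric] theta_mult theta_inv E_closed inv_closed m_closed)
  have set: "derived_set G (\<theta> ` E ` nn) = {\<theta> (E (bracket X Y)) | X Y. X \<in> nn \<and> Y \<in> nn}"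
    by (auto simp: comm)
  have cl: "\<theta> (E Z) \<in> carrier G" if "Z \<in> zz" for Z
    using that zz_nn nn_subset by simp
  have sub: "subgroup (\<theta> ` E ` zz) G"
  proof
    show "\<theta> ` E ` zz \<subseteq> carrier G" using cl by auto
    show "\<one> \<in> \<theta> ` E ` zz"
      using subspace_0[OF zz_subspace] by (metis E_zero imageI theta_one)
    fix x y assume "x \<in> \<theta> ` E ` zz" "y \<in> \<theta> ` E ` zz"
    then obtain X Y where X: "X \<in> zz" "x = \<theta> (E X)" and Y: "Y \<in> zz" "y = \<theta> (E Y)" by auto
    have g: "X \<in> \<gg>" "Y \<in> \<gg>" using X Y zz_nn nn_subset by auto
    have "x \<otimes> y = \<theta> (E (X + Y))"
      using E_add_rs2[OF subsetD[OF zz_rs X(1)] subsetD[OF zz_rs Y(1)]] g by (simp add: X Y theta_mult)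
    then show "x \<otimes> y \<in> \<theta> ` E ` zz" using subspace_add[OF zz_subspace X(1) Y(1)] by blast
    have "inv x = \<theta> (E (- X))" using X g by (simp add: E_minus theta_inv)
    then show "inv x \<in> \<theta> ` E ` zz" using subspace_neg[OF zz_subspace X(1)] by blast
  qed
  show ?thesis
  proof
    have "derived_set G (\<theta> ` E ` nn) \<subseteq> \<theta> ` E ` zz"
      unfolding set zz_def by (auto intro!: imageI span_base)
    then show "derived G (\<theta> ` E ` nn) \<subseteq> \<theta> ` E ` zz"
      unfolding derived_def by (rule generate_subgroup_incl[OF _ sub])
    show "\<theta> ` E ` zz \<subseteq> derived G (\<theta> ` E ` nn)"
    proof clarify
      fix Z assume "Z \<in> zz"
      then have "Z \<in> zz \<and> \<theta> (E Z) \<in> derived G (\<theta> ` E ` nn)"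
        unfolding zz_def
      proof (induction rule: span_induct_alt)
        case base
        then show ?case by (simp add: derived_def generate.one span_zero)
      next
        case (step c x y)
        then obtain X Y where X: "x = bracket X Y" "X \<in> nn" "Y \<in> nn" by auto
        have cX: "c *\<^sub>R X \<in> nn" using X(2) nn_subspace by (simp add: subspace_scale)
        have cx: "c *\<^sub>R x = bracket (c *\<^sub>R X) Y" by (simp add: X bracket_scaleR_left)
        have xz: "c *\<^sub>R x \<in> zz" unfolding zz_def by (rule span_scale[OF span_base[OF step(1)]])
        have yz: "y \<in> zz" using step by (simp add: zz_def)
        have "\<theta> (E (c *\<^sub>R x)) \<in> derived G (\<theta> ` E ` nn)"
          unfolding derived_def set cx using cX X(3) by (intro generate.incl) blast
        moreover have "\<theta> (E (c *\<^sub>R x + y)) = \<theta> (E (c *\<^sub>R x)) \<otimes> \<theta> (E y)"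
          using E_add_rs2[OF subsetD[OF zz_rs xz] subsetD[OF zz_rs yz]] nn_subset[OF zz_nn[OF xz]] nn_subset[OF zz_nn[OF yz]]
          by (simp add: theta_mult)
        ultimately have "\<theta> (E (c *\<^sub>R x + y)) \<in> derived G (\<theta> ` E ` nn)"
          using step unfolding derived_def by (simp add: generate.eng)
        moreover have "c *\<^sub>R x + y \<in> zz" using xz yz zz_subspace by (simp add: subspace_add)
        ultimately show ?case by (simp add: zz_def)
      qed
      then show "\<theta> (E Z) \<in> derived G (\<theta> ` E ` nn)" by simp
    qed
  qed
qed

end

section \<open>Determinants over finite index sets\<close>

text \<open>The Leibniz sum in \<open>det_on\<close>, separated from the basis that indexes it
  there.\<close>

definition detS :: "'i set \<Rightarrow> ('i \<Rightarrow> 'i \<Rightarrow> real) \<Rightarrow> real" where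
  "detS I A = (\<Sum>\<sigma> | \<sigma> permutes I. of_int (sign \<sigma>) * (\<Prod>i\<in>I. A i (\<sigma> i)))"

lemma detS_permuted_rows:
  assumes I: "finite I" and t: "\<tau> permutes I"
  shows "detS I (\<lambda>i j. A (\<tau> i) j) = of_int (sign \<tau>) * detS I A"
proof -
  have pt: "permutation \<tau>" using I t by (auto simp: permutation_permutes)
  have "detS I (\<lambda>i j. A (\<tau> i) j) = (\<Sum>\<rho> | \<rho> permutes I. of_int (sign (\<rho> \<circ> \<tau>)) * (\<Prod>i\<in>I. A (\<tau> i) ((\<rho> \<circ> \<tau>) i)))"
    unfolding detS_def by (rule sum_permutations_compose_right[OF t])
  also have "\<dots> = (\<Sum>\<rho> | \<rho> permutes I. of_int (sign \<tau>) * (of_int (sign \<rho>) * (\<Prod>i\<in>I. A i (\<rho> i))))"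
  proof (intro sum.cong refl)
    fix \<rho> assume "\<rho> \<in> {\<rho>. \<rho> permutes I}"
    then have pr: "permutation \<rho>" using I by (auto simp: permutation_permutes)
    have "(\<Prod>i\<in>I. A (\<tau> i) (\<rho> (\<tau> i))) = (\<Prod>i\<in>I. A i (\<rho> i))"
      by (rule prod.reindex_bij_betw[OF permutes_imp_bij[OF t]])
    then show "of_int (sign (\<rho> \<circ> \<tau>)) * (\<Prod>i\<in>I. A (\<tau> i) ((\<rho> \<circ> \<tau>) i)) =
        of_int (sign \<tau>) * (of_int (sign \<rho>) * (\<Prod>i\<in>I. A i (\<rho> i)))"
      by (simp add: sign_compose[OF pr pt])
  qed
  finally show ?thesis by (simp add: detS_def sum_distrib_left)
qed

lemma detS_equal_rows:
  assumes I: "finite I" and ij: "i \<in> I" "j \<in> I" "i \<noteq> j" and eq: "\<And>k. A i k = A j k"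
  shows "detS I A = 0"
proof -
  define \<tau> where "\<tau> = Transposition.transpose i j"
  have t: "\<tau> permutes I" unfolding \<tau>_def by (rule permutes_swap_id[OF ij(1,2)])
  have "(\<lambda>k l. A (\<tau> k) l) = A"
    by (intro ext) (auto simp: \<tau>_def Transposition.transpose_def eq)
  moreover have "sign \<tau> = -1" unfolding \<tau>_def using ij(3) by (simp add: sign_swap_id)
  ultimately show ?thesis using detS_permuted_rows[OF I t, of A] by simp
qed

text \<open>Expanding the product of sums gives a sum over all maps \<open>g\<close> from
  \<open>I\<close> to itself. A map that is not injective repeats a row and contributes 0; the
  others are permutations.\<close>

lemma detS_mult:
  assumes I: "finite I"
  shows "detS I (\<lambda>i j. \<Sum>k\<in>I. A i k * B k j) = detS I A * detS I B"
proof -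
  define c where "c g = (\<Prod>i\<in>I. A i (g i))" for g
  define d where "d g = detS I (\<lambda>i j. B (g i) j)" for g
  have "detS I (\<lambda>i j. \<Sum>k\<in>I. A i k * B k j) =
      (\<Sum>\<sigma> | \<sigma> permutes I. \<Sum>g\<in>PiE I (\<lambda>_. I). of_int (sign \<sigma>) * (c g * (\<Prod>i\<in>I. B (g i) (\<sigma> i))))"
    unfolding detS_def
    by (intro sum.cong refl) (simp add: prod_sum_PiE I c_def prod.distrib sum_distrib_left)
  also have "\<dots> = (\<Sum>g\<in>PiE I (\<lambda>_. I). c g * d g)"
    unfolding d_def detS_def sum_distrib_left by (subst sum.swap) (simp add: mult.left_commute)
  also have "\<dots> = (\<Sum>g\<in>{g\<in>PiE I (\<lambda>_. I). inj_on g I}. c g * d g)"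
  proof (rule sum.mono_neutral_right)
    show "finite (PiE I (\<lambda>_. I))" using I by (simp add: finite_PiE)
    show "\<forall>g\<in>PiE I (\<lambda>_. I) - {g \<in> PiE I (\<lambda>_. I). inj_on g I}. c g * d g = 0"
    proof
      fix g assume "g \<in> PiE I (\<lambda>_. I) - {g \<in> PiE I (\<lambda>_. I). inj_on g I}"
      then obtain i j where ij: "i \<in> I" "j \<in> I" "i \<noteq> j" "g i = g j" by (auto simp: inj_on_def)
      have "d g = 0" unfolding d_def by (rule detS_equal_rows[OF I ij(1-3)]) (simp add: ij(4))
      then show "c g * d g = 0" by simp
    qed
  qed auto
  also have "\<dots> = (\<Sum>\<tau> | \<tau> permutes I. c \<tau> * (of_int (sign \<tau>) * detS I B))"
  \<comment> \<open>Extensional maps are \<open>undefined\<close> outside \<open>I\<close>,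
    permutations are the identity there; the two restrictions translate.\<close>
  proof (rule sum.reindex_bij_witness[where i = "\<lambda>\<tau>. restrict \<tau> I" and j = "\<lambda>g. restrict_id g I"])
    fix g assume "g \<in> {g \<in> PiE I (\<lambda>_. I). inj_on g I}"
    then have g: "g \<in> PiE I (\<lambda>_. I)" "inj_on g I" by auto
    then have "g ` I = I" using I by (intro endo_inj_surj) auto
    then have "bij_betw g I I" using g by (simp add: bij_betw_def)
    then show p: "restrict_id g I \<in> {\<tau>. \<tau> permutes I}" by (simp add: permutes_restrict_id)
    show "restrict (restrict_id g I) I = g"
      using g by (auto simp: restrict_id_def PiE_def extensional_def fun_eq_iff)
    have "c (restrict_id g I) = c g" by (simp add: c_def)
    moreover have "d g = d (restrict_id g I)" by (simp add: d_def detS_def)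
    ultimately show "c (restrict_id g I) * (of_int (sign (restrict_id g I)) * detS I B) = c g * d g"
      using p detS_permuted_rows[OF I, of "restrict_id g I" B] by (simp add: d_def)
  next
    fix \<tau> assume "\<tau> \<in> {\<tau>. \<tau> permutes I}"
    then have t: "\<tau> permutes I" by simp
    show "restrict_id (restrict \<tau> I) I = \<tau>"
      using t by (auto simp: restrict_id_def fun_eq_iff permutes_not_in)
    show "restrict \<tau> I \<in> {g \<in> PiE I (\<lambda>_. I). inj_on g I}"
      using t by (auto simp: permutes_in_image inj_on_def dest: permutes_inj[THEN injD])
  qed
  also have "\<dots> = detS I A * detS I B"
    by (simp add: detS_def c_def sum_distrib_right mult.assoc mult.left_commute)
  finally show ?thesis .
qed

lemma detS_diagonal:
  assumes I: "finite I"
  shows "detS I (\<lambda>i j. if i = j then e i else 0) = (\<Prod>i\<in>I. e i)"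
proof -
  have "detS I (\<lambda>i j. if i = j then e i else 0) =
      (\<Sum>\<sigma>\<in>{id}. of_int (sign \<sigma>) * (\<Prod>i\<in>I. if i = \<sigma> i then e i else 0))"
    unfolding detS_def
  proof (rule sum.mono_neutral_right)
    show "finite {\<sigma>. \<sigma> permutes I}" using I by (simp add: finite_permutations)
    show "{id} \<subseteq> {\<sigma>. \<sigma> permutes I}" by (simp add: permutes_id)
    show "\<forall>\<sigma>\<in>{\<sigma>. \<sigma> permutes I} - {id}. of_int (sign \<sigma>) * (\<Prod>i\<in>I. if i = \<sigma> i then e i else 0) = 0"
    proof
      fix \<sigma> assume s: "\<sigma> \<in> {\<sigma>. \<sigma> permutes I} - {id}"
      then obtain i where i: "\<sigma> i \<noteq> i" by (auto simp: fun_eq_iff)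
      then have "i \<in> I" using s permutes_not_in by fastforce
      then have "(\<Prod>i\<in>I. if i = \<sigma> i then e i else 0) = 0"
        using I i by (auto intro!: prod_zero bexI[of _ i])
      then show "of_int (sign \<sigma>) * (\<Prod>i\<in>I. if i = \<sigma> i then e i else 0) = 0" by simp
    qed
  qed
  then show ?thesis by (simp add: sign_id)
qed

text \<open>The definition of the determinant on a subspace picks an arbitrary basis \<open>B\<close>; the matrix \<open>P\<close> of the
  base change intertwines the matrix \<open>M\<close> of \<open>f\<close> with a diagonal one.\<close>

lemma det_on_eigenbasis:
  fixes V :: "'v::euclidean_space set"
  assumes V: "subspace V" and C: "independent C" "span C = V"
    and f: "linear f" and e: "\<And>c. c \<in> C \<Longrightarrow> f c = e c *\<^sub>R c"
  shows "det_on V f = (\<Prod>c\<in>C. e c)"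
proof -
  define B where "B = some_basis V"
  note B = some_basis[OF V, folded B_def]
  have finC: "finite C" using C(1) by (rule independent_imp_finite)
  have "card B = card C"
    using B(1,2) C by (metis dim_span_eq_card_independent dim_span)
  \<comment> \<open>Indexing \<open>C\<close> by \<open>B\<close> makes the base change a square
    matrix over a single index set.\<close>
  then obtain \<phi> where \<phi>: "bij_betw \<phi> B C"
    using B(3) finC finite_same_card_bij by blast
  have BV: "b \<in> V" if "b \<in> B" for b using that B(2) span_superset by blast
  have CV: "c \<in> V" if "c \<in> C" for c using that C(2) span_superset by blast
  have \<phi>C: "\<phi> b \<in> C" if "b \<in> B" for b using \<phi> that by (auto simp: bij_betw_def)
  have fV: "f x \<in> V" if "x \<in> V" for x
  proof -
    have "f x \<in> span (f ` C)" using that C(2) linear_span_image[OF f] by blast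
    also have "\<dots> \<subseteq> V"
    proof (rule span_minimal[OF _ V], clarify)
      fix c assume "c \<in> C"
      then show "f c \<in> V" using subspace_scale[OF V CV] by (simp add: e)
    qed
    finally show ?thesis .
  qed
  define M where "M b b' = representation B (f b) b'" for b b'
  define P where "P b b' = representation C b (\<phi> b')" for b b'
  define P' where "P' b b' = representation B (\<phi> b) b'" for b b'
  have expB: "(\<Sum>b\<in>B. representation B x b *\<^sub>R b) = x" if "x \<in> V" for x
    by (rule sum_representation_eq[OF B(1) _ B(3)]) (use that B(2) in auto)
  have expC: "(\<Sum>b\<in>B. representation C x (\<phi> b) *\<^sub>R \<phi> b) = x" if "x \<in> V" for x
  proof -
    have "(\<Sum>c\<in>C. representation C x c *\<^sub>R c) = x"
      by (rule sum_representation_eq[OF C(1) _ finC]) (use that C(2) in auto)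
    then show ?thesis using sum.reindex_bij_betw[OF \<phi>, of "\<lambda>c. representation C x c *\<^sub>R c"] by simp
  qed
  have repsum: "representation S (\<Sum>b\<in>B. k b *\<^sub>R g b) = (\<lambda>y. \<Sum>b\<in>B. k b * representation S (g b) y)"
    if "independent S" "\<And>b. b \<in> B \<Longrightarrow> g b \<in> span S" for S k and g :: "'v \<Rightarrow> 'v"
    using that by (subst representation_sum) (auto simp: span_scale representation_scale intro!: ext sum.cong)
  have PP': "(\<Sum>k\<in>B. P i k * P' k j) = (if i = j then 1 else 0)" if "i \<in> B" for i j
  proof -
    have "(\<Sum>k\<in>B. P i k * P' k j) = representation B (\<Sum>k\<in>B. representation C i (\<phi> k) *\<^sub>R \<phi> k) j"
      unfolding P_def P'_def using B(2) CV \<phi>C by (subst repsum[OF B(1)]) auto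
    also have "\<dots> = representation B i j" by (simp add: expC BV that)
    finally show ?thesis using that B(1) by (simp add: representation_basis)
  qed
  have MP: "(\<Sum>k\<in>B. M i k * P k j) = (\<Sum>k\<in>B. P i k * (if k = j then e (\<phi> k) else 0))" if "i \<in> B" "j \<in> B" for i j
  proof -
    have "(\<Sum>k\<in>B. M i k * P k j) = representation C (\<Sum>k\<in>B. representation B (f i) k *\<^sub>R k) (\<phi> j)"
      unfolding M_def P_def using C(2) BV by (subst repsum[OF C(1)]) auto
    also have "\<dots> = representation C (f i) (\<phi> j)" by (simp add: expB fV BV that)
    also have "f i = f (\<Sum>k\<in>B. representation C i (\<phi> k) *\<^sub>R \<phi> k)" by (simp add: expC BV that)
    also have "\<dots> = (\<Sum>k\<in>B. (representation C i (\<phi> k) * e (\<phi> k)) *\<^sub>R \<phi> k)"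
      by (simp add: linear_sum[OF f] linear_scale[OF f] e \<phi>C)
    also have "representation C \<dots> (\<phi> j) = (\<Sum>k\<in>B. (representation C i (\<phi> k) * e (\<phi> k)) * representation C (\<phi> k) (\<phi> j))"
      using \<phi>C by (subst repsum[OF C(1)]) (auto intro: span_base)
    also have "\<dots> = (\<Sum>k\<in>B. P i k * (if k = j then e (\<phi> k) else 0))"
    proof (intro sum.cong refl)
      fix k assume k: "k \<in> B"
      have "\<phi> k = \<phi> j \<longleftrightarrow> k = j" "\<phi> j = \<phi> k \<longleftrightarrow> k = j" using \<phi> k that by (auto simp: bij_betw_def inj_on_def)
      then show "(representation C i (\<phi> k) * e (\<phi> k)) * representation C (\<phi> k) (\<phi> j) = P i k * (if k = j then e (\<phi> k) else 0)"
        using C(1) \<phi>C[OF k] by (simp add: representation_basis P_def)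
    qed
    finally show ?thesis .
  qed
  have cong: "detS B X = detS B Y" if "\<And>i j. i \<in> B \<Longrightarrow> j \<in> B \<Longrightarrow> X i j = Y i j" for X Y
    unfolding detS_def using that
    by (intro sum.cong refl arg_cong2[where f = "(*)"] prod.cong) (auto simp: permutes_in_image)
  have "detS B P * detS B P' = detS B (\<lambda>i j. if i = j then 1 else 0)"
    unfolding detS_mult[OF B(3), symmetric] by (rule cong) (simp add: PP')
  then have P0: "detS B P \<noteq> 0" using detS_diagonal[OF B(3), of "\<lambda>_. 1"] by auto
  have "detS B M * detS B P = detS B P * detS B (\<lambda>i j. if i = j then e (\<phi> i) else 0)"
    unfolding detS_mult[OF B(3), symmetric] by (rule cong) (rule MP)
  then have "detS B M = (\<Prod>b\<in>B. e (\<phi> b))"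
    using P0 detS_diagonal[OF B(3), of "\<lambda>b. e (\<phi> b)"] by (simp add: mult.commute)
  also have "\<dots> = (\<Prod>c\<in>C. e c)" by (rule prod.reindex_bij_betw[OF \<phi>])
  finally show ?thesis by (simp add: det_on_def detS_def M_def B_def Let_def)
qed

lemma det_on_two_eigenspaces:
  fixes V1 V2 :: "'v::euclidean_space set"
  assumes V1: "subspace V1" and V2: "subspace V2" and int: "V1 \<inter> V2 \<subseteq> {0}" and f: "linear f"
    and f1: "\<And>x. x \<in> V1 \<Longrightarrow> f x = c1 *\<^sub>R x" and f2: "\<And>x. x \<in> V2 \<Longrightarrow> f x = c2 *\<^sub>R x"
  shows "det_on {x + y | x y. x \<in> V1 \<and> y \<in> V2} f = c1 ^ dim V1 * c2 ^ dim V2"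
proof -
  obtain C1 where C1: "C1 \<subseteq> V1" "independent C1" "V1 \<subseteq> span C1" "card C1 = dim V1" by (rule basis_exists)
  obtain C2 where C2: "C2 \<subseteq> V2" "independent C2" "V2 \<subseteq> span C2" "card C2 = dim V2" by (rule basis_exists)
  have s: "span C1 = V1" "span C2 = V2"
    using C1 C2 V1 V2 by (simp_all add: span_minimal subset_antisym)
  have fin: "finite C1" "finite C2" using C1 C2 by (simp_all add: independent_imp_finite)
  have disj: "C1 \<inter> C2 = {}"
  proof (rule ccontr)
    assume "C1 \<inter> C2 \<noteq> {}"
    then have "0 \<in> C1" using C1(1) C2(1) int by blast
    then show False using C1(2) dependent_zero by blast
  qed
  have V: "{x + y | x y. x \<in> V1 \<and> y \<in> V2} = span (C1 \<union> C2)"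
    by (auto simp: span_Un s set_plus_def)
  have ind: "independent (C1 \<union> C2)"
  proof (rule independent_if_scalars_zero)
    show "finite (C1 \<union> C2)" using fin by simp
    fix g x assume g: "(\<Sum>x\<in>C1 \<union> C2. g x *\<^sub>R x) = 0" and x: "x \<in> C1 \<union> C2"
    define y where "y = (\<Sum>x\<in>C1. g x *\<^sub>R x)"
    define z where "z = (\<Sum>x\<in>C2. g x *\<^sub>R x)"
    have yz: "y + z = 0" using g by (simp add: y_def z_def sum.union_disjoint[OF fin disj])
    have "y \<in> V1" unfolding y_def using C1(1) V1 by (intro subspace_sum subspace_scale) auto
    moreover have "z \<in> V2" unfolding z_def using C2(1) V2 by (intro subspace_sum subspace_scale) auto
    then have "y \<in> V2" using yz V2 subspace_neg by (metis add_eq_0_iff minus_minus)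
    ultimately have "y = 0" using int by auto
    moreover then have "z = 0" using yz by simp
    ultimately show "g x = 0"
      using x independentD[OF C1(2) fin(1) order_refl, of g x] independentD[OF C2(2) fin(2) order_refl, of g x]
      by (auto simp: y_def z_def)
  qed
  define e where "e c = (if c \<in> C1 then c1 else c2)" for c
  have "det_on (span (C1 \<union> C2)) f = (\<Prod>c\<in>C1 \<union> C2. e c)"
    by (rule det_on_eigenbasis[OF subspace_span ind refl f]) (use C1(1) C2(1) f1 f2 in \<open>auto simp: e_def\<close>)
  also have "\<dots> = (\<Prod>c\<in>C1. e c) * (\<Prod>c\<in>C2. e c)"
    by (rule prod.union_disjoint[OF fin disj])
  also have "(\<Prod>c\<in>C1. e c) = c1 ^ dim V1" by (simp add: e_def C1(4))
  also have "(\<Prod>c\<in>C2. e c) = (\<Prod>c\<in>C2. c2)" using disj by (intro prod.cong) (auto simp: e_def)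
  also have "\<dots> = c2 ^ dim V2" by (simp add: C2(4))
  finally show ?thesis by (simp only: V)
qed

section \<open>Integrability from polynomial volume growth\<close>

lemma integrable_if_volume_growth:
  fixes f J :: "'a \<Rightarrow> real"
  assumes f: "f \<in> borel_measurable \<mu>" and J: "J \<in> borel_measurable \<mu>"
    and growth: "\<And>r. 1 \<le> r \<Longrightarrow> emeasure \<mu> {x \<in> space \<mu>. J x \<le> r} \<le> ennreal (C * r powr d)"
    and bound: "\<And>x. x \<in> space \<mu> \<Longrightarrow> \<bar>f x\<bar> \<le> M * max 1 (J x) powr (- s)"
    and "d < s" "0 \<le> s" "0 \<le> C" "0 \<le> M"
  shows "integrable \<mu> f"
proof (rule integrableI_bounded[OF f])
  define A where "A k = {x \<in> space \<mu>. J x \<le> 2 ^ k}" for k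
  have A: "A k \<in> sets \<mu>" for k unfolding A_def using J by measurable
  \<comment> \<open>On the shell between the radii \<open>2\<^bsup>k-1\<^esup>\<close> and \<open>2\<^sup>k\<close> the function is at most \<open>c k\<close>.\<close>
  define c where "c k = M * 2 powr s * (2 ^ k) powr (- s)" for k :: nat
  have c0: "0 \<le> c k" for k using \<open>0 \<le> M\<close> by (simp add: c_def)
  have pt: "ennreal (norm (f x)) \<le> (\<Sum>k. ennreal (c k) * indicator (A k) x)" if x: "x \<in> space \<mu>" for x
  proof -
    obtain n :: nat where "J x < 2 ^ n" using real_arch_pow[of 2 "J x"] by auto
    then have ex: "\<exists>k::nat. J x \<le> 2 ^ k" by (intro exI[of _ n]) simp
    define k where "k = (LEAST k::nat. J x \<le> 2 ^ k)"
    have k: "J x \<le> 2 ^ k" unfolding k_def by (rule LeastI_ex[OF ex])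
    \<comment> \<open>For \<open>k = 0\<close> the bound uses the 1 in \<open>max\<close>; for
      larger \<open>k\<close> minimality gives \<open>J x > 2 ^ k / 2\<close>.\<close>
    have "max 1 (J x) powr (- s) \<le> (2 ^ k / 2) powr (- s)"
    proof (cases k)
      case 0
      then show ?thesis using \<open>0 \<le> s\<close> by (intro powr_mono2') auto
    next
      case (Suc j)
      then have "\<not> J x \<le> 2 ^ j" using not_less_Least[of j "\<lambda>k. J x \<le> 2 ^ k"] by (simp add: k_def)
      then show ?thesis using \<open>0 \<le> s\<close> Suc by (intro powr_mono2') auto
    qed
    also have "\<dots> = 2 powr s * (2 ^ k) powr (- s)"
      by (simp add: powr_divide powr_minus field_simps)
    finally have "M * max 1 (J x) powr (- s) \<le> c k"
      unfolding c_def mult.assoc using \<open>0 \<le> M\<close> by (rule mult_left_mono)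
    then have "norm (f x) \<le> c k" using bound[OF x] by simp
    then have *: "ennreal (norm (f x)) \<le> ennreal (c k) * indicator (A k) x"
      using x k by (simp add: A_def ennreal_leI)
    define g :: "nat \<Rightarrow> ennreal" where "g i = ennreal (c i) * indicator (A i) x" for i
    have "sum g {k} \<le> suminf g" by (rule sum_le_suminf) (auto intro: summableI)
    then have "g k \<le> suminf g" by simp
    then show ?thesis using * unfolding g_def by (rule order_trans[rotated])
  qed
  \<comment> \<open>The term of index \<open>k\<close> is at most a constant times
    \<open>2 powr (k * (d - s))\<close>, so the series is geometric with ratio
    \<open>q\<close>.\<close>
  define q where "q = (2::real) powr (d - s)"
  have q: "0 \<le> q" "q < 1" using \<open>d < s\<close> powr_less_mono[of "d - s" 0 2] by (simp_all add: q_def)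
  define b where "b = M * 2 powr s * C"
  have b0: "0 \<le> b" using \<open>0 \<le> M\<close> \<open>0 \<le> C\<close> by (simp add: b_def)
  have "(\<integral>\<^sup>+x. ennreal (norm (f x)) \<partial>\<mu>) \<le> (\<integral>\<^sup>+x. (\<Sum>k. ennreal (c k) * indicator (A k) x) \<partial>\<mu>)"
    by (rule nn_integral_mono) (rule pt)
  also have "\<dots> = (\<Sum>k. \<integral>\<^sup>+x. ennreal (c k) * indicator (A k) x \<partial>\<mu>)"
    using A by (intro nn_integral_suminf) auto
  also have "\<dots> = (\<Sum>k. ennreal (c k) * emeasure \<mu> (A k))"
    using A by (simp add: nn_integral_cmult_indicator)
  also have "\<dots> \<le> (\<Sum>k. ennreal (b * q ^ k))"
  proof (rule suminf_le)
    fix k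
    have "ennreal (c k) * emeasure \<mu> (A k) \<le> ennreal (c k) * ennreal (C * (2 ^ k) powr d)"
      unfolding A_def by (intro mult_left_mono growth) auto
    also have "\<dots> = ennreal (c k * (C * (2 ^ k) powr d))"
      using c0 \<open>0 \<le> C\<close> by (simp add: ennreal_mult)
    also have "c k * (C * (2 ^ k) powr d) = b * ((2 ^ k) powr (- s) * (2 ^ k) powr d)"
      by (simp add: c_def b_def)
    also have "(2 ^ k) powr (- s) * (2 ^ k) powr d = (2 ^ k) powr (d - s)"
      by (simp add: powr_add[symmetric])
    also have "\<dots> = q ^ k"
    proof -
      have "((2::real) ^ k) powr (d - s) = (2 powr real k) powr (d - s)" by (simp add: powr_realpow)
      also have "\<dots> = (2 powr (d - s)) powr real k" by (simp only: powr_powr mult.commute)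
      also have "\<dots> = q ^ k" unfolding q_def by (rule powr_realpow) simp
      finally show ?thesis .
    qed
    finally show "ennreal (c k) * emeasure \<mu> (A k) \<le> ennreal (b * q ^ k)" .
  qed (auto intro: summableI)
  also have "\<dots> = ennreal (\<Sum>k. b * q ^ k)"
    using q b0 by (intro suminf_ennreal2) (auto intro!: summable_mult summable_geometric)
  also have "\<dots> < \<infinity>" by simp
  finally show "(\<integral>\<^sup>+x. ennreal (norm (f x)) \<partial>\<mu>) < \<infinity>" .
qed

lemma subspace_ball_covering:
  fixes V :: "'v::euclidean_space set"
  assumes V: "subspace V" and "0 < \<rho>"
  obtains C where "0 \<le> C" "\<forall>r\<ge>1. \<exists>F. finite F \<and> F \<subseteq> V \<and> real (card F) \<le> C * r ^ dim V \<and>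
      (\<forall>Z\<in>V. norm Z \<le> r \<longrightarrow> (\<exists>w\<in>F. norm (Z - w) \<le> \<rho>))"
proof -
  obtain S where S: "S \<subseteq> V" "pairwise orthogonal S" "\<And>x. x \<in> S \<Longrightarrow> norm x = 1" "independent S" "card S = dim V" "span S = V"
    by (rule orthonormal_basis_subspace[OF V]) blast
  have fin: "finite S" using S(4) by (rule independent_imp_finite)
  \<comment> \<open>There are \<open>dim V\<close> coordinates with error at most
    \<open>\<delta>\<close> each; the added 1 covers dimension 0.\<close>
  define \<delta> where "\<delta> = \<rho> / (real (dim V) + 1)"
  have \<delta>: "0 < \<delta>" using assms(2) by (simp add: \<delta>_def add_nonneg_pos)
  \<comment> \<open>Each coordinate takes \<open>2 * L + 1\<close> values, and
    \<open>L \<le> r / \<delta> + 2\<close> with \<open>r \<ge> 1\<close> bounds this by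
    \<open>(2 / \<delta> + 5) * r\<close>.\<close>
  define C where "C = (2 / \<delta> + 5) ^ dim V"
  show ?thesis
  proof
    show "0 \<le> C" using \<delta> by (simp add: C_def)
    show "\<forall>r\<ge>1. \<exists>F. finite F \<and> F \<subseteq> V \<and> real (card F) \<le> C * r ^ dim V \<and>
      (\<forall>Z\<in>V. norm Z \<le> r \<longrightarrow> (\<exists>w\<in>F. norm (Z - w) \<le> \<rho>))"
    proof (intro allI impI)
      fix r :: real assume r: "1 \<le> r"
      define L where "L = \<lceil>r / \<delta>\<rceil> + 1"
      have L: "r / \<delta> + 1 \<le> of_int L" "of_int L \<le> r / \<delta> + 2" "0 \<le> L"
      proof -
        show "r / \<delta> + 1 \<le> of_int L" "of_int L \<le> r / \<delta> + 2" unfolding L_def by linarith+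
        have "0 \<le> r / \<delta>" using r \<delta> by simp
        then show "0 \<le> L" unfolding L_def by linarith
      qed
      \<comment> \<open>The centres are the lattice points with coordinates in \<open>\<delta> {-L..L}\<close> in an orthonormal basis.\<close>
    define w where "w m = (\<Sum>b\<in>S. (\<delta> * of_int (m b)) *\<^sub>R b)" for m :: "'v \<Rightarrow> int"
      define F where "F = w ` PiE S (\<lambda>_. {-L..L})"
      have finP: "finite (PiE S (\<lambda>_. {-L..L}))" using fin by (intro finite_PiE) auto
      have "card F \<le> card (PiE S (\<lambda>_. {-L..L}))" unfolding F_def by (rule card_image_le[OF finP])
      also have "\<dots> = nat (2 * L + 1) ^ dim V"
        using fin by (simp add: card_PiE S(5) algebra_simps)
      finally have "real (card F) \<le> (2 * of_int L + 1) ^ dim V"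
        using L(3) by (simp add: of_nat_le_iff[symmetric, where 'a = real] del: of_nat_le_iff)
      also have "\<dots> \<le> ((2 / \<delta> + 5) * r) ^ dim V"
      proof (rule power_mono)
        have "2 * of_int L + 1 \<le> 2 * (r / \<delta>) + 5" using L(2) by linarith
        also have "\<dots> \<le> 2 * (r / \<delta>) + 5 * r" using r by simp
        also have "\<dots> = (2 / \<delta> + 5) * r" by (simp add: algebra_simps)
        finally show "2 * of_int L + 1 \<le> (2 / \<delta> + 5) * r" .
        show "0 \<le> 2 * real_of_int L + 1" using L(3) by simp
      qed
      also have "\<dots> = C * r ^ dim V" by (simp add: C_def power_mult_distrib)
      finally have card: "real (card F) \<le> C * r ^ dim V" .
      have FV: "F \<subseteq> V"
        unfolding F_def w_def using S(1) V by (auto intro!: subspace_sum subspace_scale)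
      have cover: "\<exists>w\<in>F. norm (Z - w) \<le> \<rho>" if Z: "Z \<in> V" "norm Z \<le> r" for Z
      proof -
        define m where "m = restrict (\<lambda>b. \<lfloor>(Z \<bullet> b) / \<delta>\<rfloor>) S"
        have "m \<in> PiE S (\<lambda>_. {-L..L})"
        proof (rule PiE_I)
          fix b assume b: "b \<in> S"
          have "\<bar>Z \<bullet> b\<bar> \<le> r" using Cauchy_Schwarz_ineq2[of Z b] S(3)[OF b] Z(2) by simp
          then have "\<bar>(Z \<bullet> b) / \<delta>\<bar> \<le> r / \<delta>" using \<delta> by (simp add: abs_divide abs_of_pos divide_right_mono)
          then have "- of_int L \<le> (Z \<bullet> b) / \<delta>" "(Z \<bullet> b) / \<delta> < of_int L + 1" using L(1) by linarith+
          then show "m b \<in> {-L..L}" using b by (simp add: m_def le_floor_iff floor_le_iff)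
        qed (simp add: m_def)
        then have wF: "w m \<in> F" by (simp add: F_def)
        have "Z = (\<Sum>b\<in>S. (Z \<bullet> b) *\<^sub>R b)"
          using orthonormal_basis_expand[OF S(2,3) _ fin, of Z] S(6) Z(1) by simp
        then have "Z - w m = (\<Sum>b\<in>S. (Z \<bullet> b) *\<^sub>R b) - w m" by simp
        also have "\<dots> = (\<Sum>b\<in>S. ((Z \<bullet> b) - \<delta> * of_int (m b)) *\<^sub>R b)"
          by (simp add: w_def sum_subtractf scaleR_diff_left)
        finally have "norm (Z - w m) \<le> (\<Sum>b\<in>S. norm (((Z \<bullet> b) - \<delta> * of_int (m b)) *\<^sub>R b))"
          using norm_sum by metis
        also have "\<dots> \<le> (\<Sum>b\<in>S. \<delta>)"
        proof (rule sum_mono)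
          fix b assume b: "b \<in> S"
          define t where "t = (Z \<bullet> b) / \<delta>"
          have t: "Z \<bullet> b = \<delta> * t" using \<delta> by (simp add: t_def)
          have "\<bar>t - of_int \<lfloor>t\<rfloor>\<bar> \<le> 1" by linarith
          then have "\<delta> * \<bar>t - of_int \<lfloor>t\<rfloor>\<bar> \<le> \<delta>" using \<delta> by simp
          then have "\<bar>\<delta> * t - \<delta> * of_int \<lfloor>t\<rfloor>\<bar> \<le> \<delta>"
            using \<delta> by (simp add: right_diff_distrib[symmetric] abs_mult)
          then show "norm (((Z \<bullet> b) - \<delta> * of_int (m b)) *\<^sub>R b) \<le> \<delta>"
            using b S(3)[OF b] by (simp add: m_def t_def[symmetric]) (simp add: t)
        qed
        also have "\<dots> \<le> \<rho>"
        proof -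
          have "real (dim V) * \<rho> \<le> \<rho> * (real (dim V) + 1)" using assms(2) by (simp add: algebra_simps)
          then show ?thesis by (simp add: S(5) \<delta>_def divide_le_eq add_nonneg_pos)
        qed
        finally show ?thesis using wF by blast
      qed
      have "finite F" using finP by (simp add: F_def)
      then show "\<exists>F. finite F \<and> F \<subseteq> V \<and> real (card F) \<le> C * r ^ dim V \<and>
        (\<forall>Z\<in>V. norm Z \<le> r \<longrightarrow> (\<exists>w\<in>F. norm (Z - w) \<le> \<rho>))"
        using FV card cover by blast
    qed
  qed
qed

text \<open>The inequality \<open>1 + b * ln y \<le> y powr b\<close> is raised to the power
  \<open>n\<close>, with \<open>b\<close> so small that \<open>b * n \<le> \<eta>\<close>; the
  logarithmic factor thus costs an arbitrarily small power.\<close>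

lemma log_powr_le_powr:
  fixes r \<eta> :: real
  assumes "0 < \<eta>"
  obtains C where "0 < C" "\<And>y. 1 \<le> y \<Longrightarrow> (1 + ln y) powr r \<le> C * y powr \<eta>"
proof -
  \<comment> \<open>A positive exponent above \<open>r\<close>, so that negative \<open>r\<close> is
    not a separate case.\<close>
  define n where "n = \<bar>r\<bar> + 1"
  have n: "0 < n" "r \<le> n" by (auto simp: n_def)
  define b where "b = min 1 (\<eta> / n)"
  have b: "0 < b" "b \<le> 1" "b * n \<le> \<eta>" using assms n by (auto simp: b_def min_def field_simps)
  show ?thesis
  proof
    show "0 < (1 / b) powr n" using b by simp
    fix y :: real assume y: "1 \<le> y"
    have l: "0 \<le> ln y" using y by simp
    have "b * (1 + ln y) \<le> 1 + b * ln y" using b by (simp add: distrib_left)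
    also have "\<dots> \<le> exp (b * ln y)" by (rule exp_ge_add_one_self)
    also have "\<dots> = y powr b" using y by (simp add: powr_def)
    finally have 1: "1 + ln y \<le> (1 / b) * y powr b" using b by (simp add: field_simps)
    have "(1 + ln y) powr r \<le> (1 + ln y) powr n" using l n by (intro powr_mono) auto
    also have "\<dots> \<le> ((1 / b) * y powr b) powr n" using 1 l n by (intro powr_mono2) auto
    also have "\<dots> = (1 / b) powr n * y powr (b * n)"
    proof -
      have "((1 / b) * y powr b) powr n = (1 / b) powr n * (y powr b) powr n"
        by (rule powr_mult)
      then show ?thesis by (simp only: powr_powr)
    qed
    also have "\<dots> \<le> (1 / b) powr n * y powr \<eta>"
      using y b by (intro mult_left_mono powr_mono) auto
    finally show "(1 + ln y) powr r \<le> (1 / b) powr n * y powr \<eta>" .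
  qed
qed

section \<open>Volume growth of the commutator subgroup\<close>

lemma haar_measureD:
  assumes "haar_measure G S \<mu>"
  shows "sets \<mu> = sets (restrict_space borel S)"
    and "x \<in> S \<Longrightarrow> T \<in> sets \<mu> \<Longrightarrow> emeasure \<mu> (x <#\<^bsub>G\<^esub> T) = emeasure \<mu> T"
    and "compact T \<Longrightarrow> T \<subseteq> S \<Longrightarrow> emeasure \<mu> T < \<infinity>"
proof -
  note D = assms[unfolded haar_measure_def]
  show "sets \<mu> = sets (restrict_space borel S)" using D by (rule conjunct1)
  show "x \<in> S \<Longrightarrow> T \<in> sets \<mu> \<Longrightarrow> emeasure \<mu> (x <#\<^bsub>G\<^esub> T) = emeasure \<mu> T"
    by (rule D[THEN conjunct2, THEN conjunct2, THEN conjunct1, rule_format])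
  show "compact T \<Longrightarrow> T \<subseteq> S \<Longrightarrow> emeasure \<mu> T < \<infinity>"
    by (rule D[THEN conjunct2, THEN conjunct2, THEN conjunct2, THEN conjunct1, rule_format])
qed

context rank_one_roots
begin

text \<open>Near 0 the map \<open>E\<close> is \<open>\<sigma>\<close> after \<open>mat_exp\<close>.
  This local continuity is enough to make one small ball compact.\<close>

lemma E_continuous_near_zero:
  obtains d where "0 < d" "continuous_on {X \<in> \<gg>. norm X < d} E"
proof -
  obtain d where d: "0 < d" "\<And>X. X \<in> \<gg> \<Longrightarrow> norm X < d \<Longrightarrow> norm (mat_exp X - mat 1) < \<epsilon> \<and> E X = \<sigma> (mat_exp X)"
    using E_local by blast
  have R: "mat_exp X \<in> R" if "X \<in> \<gg>" for X
    using p_in_R[OF E_closed[OF that]] that by (simp add: p_E)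
  have "continuous_on {X \<in> \<gg>. norm X < d} (\<lambda>X. \<sigma> (mat_exp X))"
  proof (rule continuous_on_compose2[OF section_continuous])
    show "continuous_on {X \<in> \<gg>. norm X < d} mat_exp"
      by (intro continuous_on_mat_exp continuous_on_id)
    show "mat_exp ` {X \<in> \<gg>. norm X < d} \<subseteq> {M \<in> R. norm (M - mat 1) < \<epsilon>}"
      using d(2) R by auto
  qed
  then have "continuous_on {X \<in> \<gg>. norm X < d} E"
    by (rule continuous_on_eq) (use d(2) in auto)
  then show ?thesis using d(1) that by blast
qed

text \<open>The constants are the extrema of \<open>Q\<close> on the compact unit sphere of
  \<open>zz\<close>; homogeneity does the rest.\<close>

lemma Q_norm_equivalence:
  obtains m M where "0 < m" "0 < M" "\<And>Z. Z \<in> zz \<Longrightarrow> m * (norm Z)\<^sup>2 \<le> Q Z" "\<And>Z. Z \<in> zz \<Longrightarrow> Q Z \<le> M * (norm Z)\<^sup>2"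
proof (cases "zz \<subseteq> {0}")
  case True
  then show ?thesis using that[of 1 1] by force
next
  case False
  obtain q where q: "continuous_on UNIV q" "\<And>X. X \<in> \<gg> \<Longrightarrow> Q X = q X"
    using Q_continuous_extension by blast
  have zg: "Z \<in> \<gg>" if "Z \<in> zz" for Z using that zz_rs rs_mem by blast
  define S where "S = zz \<inter> sphere 0 1"
  have S: "compact S"
    unfolding S_def by (rule closed_Int_compact[OF closed_subspace[OF zz_subspace] compact_sphere])
  obtain Z0 where Z0: "Z0 \<in> zz" "Z0 \<noteq> 0" using False by blast
  have unit: "(1 / norm Z) *\<^sub>R Z \<in> S" if "Z \<in> zz" "Z \<noteq> 0" for Z
    unfolding S_def using that zz_subspace by (simp add: subspace_scale)
  have ne: "S \<noteq> {}" using unit[OF Z0] by blast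
  have cont: "continuous_on S q" using q(1) continuous_on_subset by blast
  obtain X1 where X1: "X1 \<in> S" "\<And>Y. Y \<in> S \<Longrightarrow> q X1 \<le> q Y" using continuous_attains_inf[OF S ne cont] by blast
  obtain X2 where X2: "X2 \<in> S" "\<And>Y. Y \<in> S \<Longrightarrow> q Y \<le> q X2" using continuous_attains_sup[OF S ne cont] by blast
  have X1g: "X1 \<in> \<gg>" "X1 \<noteq> 0" and X2g: "X2 \<in> \<gg>" "X2 \<noteq> 0" using X1(1) X2(1) zg by (auto simp: S_def)
  have pos: "0 < q X1" "0 < q X2" using Q_pos[OF X1g] Q_pos[OF X2g] q(2) X1g X2g by simp_all
  have scale: "Q Z = (norm Z)\<^sup>2 * q ((1 / norm Z) *\<^sub>R Z)" if "Z \<in> zz" "Z \<noteq> 0" for Z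
    using that q(2)[OF lie_algebra_scaleR[OF zg[OF that(1)]], of "1 / norm Z"] Q_scaleR[OF zg[OF that(1)], of "1 / norm Z"]
    by (simp add: power_divide field_simps)
  show ?thesis
  proof (rule that[OF pos])
    fix Z assume Z: "Z \<in> zz"
    show "q X1 * (norm Z)\<^sup>2 \<le> Q Z"
    proof (cases "Z = 0")
      case False
      have "q X1 * (norm Z)\<^sup>2 \<le> q ((1 / norm Z) *\<^sub>R Z) * (norm Z)\<^sup>2"
        by (intro mult_right_mono X1(2) unit Z False) simp
      then show ?thesis by (simp only: scale[OF Z False] mult.commute)
    qed simp
    show "Q Z \<le> q X2 * (norm Z)\<^sup>2"
    proof (cases "Z = 0")
      case False
      have "q ((1 / norm Z) *\<^sub>R Z) * (norm Z)\<^sup>2 \<le> q X2 * (norm Z)\<^sup>2"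
        by (intro mult_right_mono X2(2) unit Z False) simp
      then show ?thesis by (simp only: scale[OF Z False] mult.commute)
    qed simp
  qed
qed

text \<open>A ball of radius \<open>r\<close> is covered by at most a constant times
  \<open>r ^ dim zz\<close> left translates of one small compact ball, all of the same finite
  measure. The hypothesis on translates of \<open>J\<close> makes the translated balls
  measurable.\<close>

lemma haar_volume_growth:
  assumes haar: "haar_measure G (\<theta> ` E ` zz) \<mu>"
    and J: "J \<in> borel_measurable \<mu>" and JE: "\<And>Z. Z \<in> zz \<Longrightarrow> J (\<theta> (E Z)) = sqrt (Q Z)"
    and J_translate: "\<And>x. x \<in> \<theta> ` E ` zz \<Longrightarrow> (\<lambda>y. J (inv x \<otimes> y)) \<in> borel_measurable \<mu>"
  obtains C where "0 \<le> C"
    "\<And>r. 1 \<le> r \<Longrightarrow> emeasure \<mu> {x \<in> space \<mu>. J x \<le> r} \<le> ennreal (C * r powr real (dim zz))"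
proof -
  define W where "W = \<theta> ` E ` zz"
  have sets_\<mu>: "sets \<mu> = sets (restrict_space borel W)"
    and inv_\<mu>: "\<And>x S. x \<in> W \<Longrightarrow> S \<in> sets \<mu> \<Longrightarrow> emeasure \<mu> (x <# S) = emeasure \<mu> S"
    and comp_\<mu>: "\<And>S. compact S \<Longrightarrow> S \<subseteq> W \<Longrightarrow> emeasure \<mu> S < \<infinity>"
    using haar_measureD[OF haar[folded W_def]] by blast+
  have space_\<mu>: "space \<mu> = W"
    using sets_eq_imp_space_eq[OF sets_\<mu>] by (simp add: space_restrict_space)
  have zg: "Z \<in> \<gg>" if "Z \<in> zz" for Z using that zz_rs rs_mem by blast
  obtain m M where m: "0 < m" "0 < M" "\<And>Z. Z \<in> zz \<Longrightarrow> m * (norm Z)\<^sup>2 \<le> Q Z" "\<And>Z. Z \<in> zz \<Longrightarrow> Q Z \<le> M * (norm Z)\<^sup>2"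
    using Q_norm_equivalence by blast
  obtain d where d: "0 < d" "continuous_on {X \<in> \<gg>. norm X < d} E"
    using E_continuous_near_zero by blast
  \<comment> \<open>Then \<open>sqrt (Q Z) \<le> \<rho>\<close> forces
    \<open>norm Z \<le> d / 2\<close>, inside the range where \<open>E\<close> is
    continuous.\<close>
  define \<rho> where "\<rho> = sqrt m * d / 2"
  have \<rho>: "0 < \<rho>" using m(1) d(1) by (simp add: \<rho>_def)
  define ball where "ball r = {x \<in> space \<mu>. J x \<le> r}" for r
  have ball_eq: "ball r = \<theta> ` E ` {Z \<in> zz. sqrt (Q Z) \<le> r}" for r
    unfolding ball_def space_\<mu> W_def by (auto simp: JE)
  have norm_le: "norm Z \<le> r / sqrt m" if Z: "Z \<in> zz" "sqrt (Q Z) \<le> r" for Z r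
  proof -
    have "sqrt m * norm Z = sqrt (m * (norm Z)\<^sup>2)" by (simp add: real_sqrt_mult)
    also have "\<dots> \<le> sqrt (Q Z)" using m(3)[OF Z(1)] by simp
    finally show ?thesis using Z(2) m(1) by (simp add: field_simps)
  qed
  have "compact (ball \<rho>)"
  proof -
    obtain q where q: "continuous_on UNIV q" "\<And>X. X \<in> \<gg> \<Longrightarrow> Q X = q X"
      using Q_continuous_extension by blast
    define T where "T = {Z \<in> zz. sqrt (Q Z) \<le> \<rho>}"
    have small: "norm Z \<le> d / 2" if "Z \<in> T" for Z
      using norm_le[of Z \<rho>] that m(1) by (simp add: T_def \<rho>_def)
    have "T = zz \<inter> {Z. sqrt (q Z) \<le> \<rho>}" using q(2) zg by (auto simp: T_def)
    moreover have "closed {Z. sqrt (q Z) \<le> \<rho>}"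
      by (intro closed_Collect_le continuous_intros q(1))
    ultimately have "closed T" using closed_subspace[OF zz_subspace] by (simp add: closed_Int)
    moreover have "bounded T" using small by (rule boundedI)
    ultimately have "compact T" by (simp add: compact_eq_bounded_closed)
    moreover have "continuous_on T (\<lambda>Z. \<theta> (E Z))"
    proof (rule continuous_on_compose2[OF theta_continuous])
      show "continuous_on T E"
        by (rule continuous_on_subset[OF d(2)]) (use small zg d(1) in \<open>force simp: T_def\<close>)
    qed (use zg in \<open>auto simp: T_def\<close>)
    ultimately have "compact ((\<lambda>Z. \<theta> (E Z)) ` T)" by (rule compact_continuous_image[rotated])
    then show ?thesis by (simp add: ball_eq T_def image_image)
  qed
  then have fin: "emeasure \<mu> (ball \<rho>) < \<infinity>"
    by (rule comp_\<mu>) (auto simp: ball_def space_\<mu>)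
  define c0 where "c0 = measure \<mu> (ball \<rho>)"
  have c0: "emeasure \<mu> (ball \<rho>) = ennreal c0" "0 \<le> c0"
    using emeasure_eq_ennreal_measure[of \<mu> "ball \<rho>"] fin by (auto simp: c0_def)
  have ball_sets: "ball r \<in> sets \<mu>" for r
    unfolding ball_def by (rule J[unfolded borel_measurable_iff_le, rule_format])
  \<comment> \<open>A difference of norm at most \<open>\<rho> / sqrt M\<close> has
    \<open>sqrt Q\<close> at most \<open>\<rho>\<close>.\<close>
  have "0 < \<rho> / sqrt M" using \<rho> m(2) by simp
  then obtain C where C: "0 \<le> C" "\<forall>r\<ge>1. \<exists>F. finite F \<and> F \<subseteq> zz \<and> real (card F) \<le> C * r ^ dim zz \<and>
      (\<forall>Z\<in>zz. norm Z \<le> r \<longrightarrow> (\<exists>w\<in>F. norm (Z - w) \<le> \<rho> / sqrt M))"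
    by (rule subspace_ball_covering[OF zz_subspace])
  \<comment> \<open>The summand \<open>1 / sqrt m\<close> converts a radius for
    \<open>sqrt Q\<close> into one for the norm; the 1 keeps \<open>b * r\<close> at least 1, as the
    covering requires.\<close>
  define b where "b = 1 + 1 / sqrt m"
  have b: "1 \<le> b" using m(1) by (simp add: b_def)
  show ?thesis
  proof
    show "0 \<le> C * b ^ dim zz * c0" using C(1) b c0 by simp
    fix r :: real assume r: "1 \<le> r"
    have "1 * 1 \<le> b * r" using b r by (intro mult_mono) auto
    then obtain F where F: "finite F" "F \<subseteq> zz" "real (card F) \<le> C * (b * r) ^ dim zz"
      "\<And>Z. Z \<in> zz \<Longrightarrow> norm Z \<le> b * r \<Longrightarrow> \<exists>w\<in>F. norm (Z - w) \<le> \<rho> / sqrt M"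
      using C(2)[rule_format, of "b * r"] by auto
    have cosets: "\<theta> (E w) <# ball \<rho> \<in> sets \<mu>" if w: "w \<in> zz" for w
    proof -
      have x: "\<theta> (E w) \<in> W" "\<theta> (E w) \<in> carrier G" using w zg by (auto simp: W_def)
      have Wc: "y \<in> carrier G" if "y \<in> W" for y using that zg by (auto simp: W_def)
      have Winv: "inv (\<theta> (E w)) \<otimes> y \<in> W" if y: "y \<in> W" for y
      proof -
        obtain Z where Z: "Z \<in> zz" "y = \<theta> (E Z)" using y by (auto simp: W_def)
        have "E (- w + Z) = E (- w) \<otimes> E Z"
          by (rule E_add_rs2) (use w Z zz_rs rs_minus in auto)
        then have "inv (\<theta> (E w)) \<otimes> y = \<theta> (E (- w + Z))"
          using w Z zg by (simp add: E_minus theta_inv theta_mult)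
        moreover have "- w + Z \<in> zz" using w Z zz_subspace by (intro subspace_add subspace_neg)
        ultimately show ?thesis by (auto simp: W_def)
      qed
      have Wmult: "\<theta> (E w) \<otimes> y \<in> W" if y: "y \<in> W" for y
      proof -
        obtain Z where Z: "Z \<in> zz" "y = \<theta> (E Z)" using y by (auto simp: W_def)
        have "E (w + Z) = E w \<otimes> E Z" by (rule E_add_rs2) (use w Z zz_rs in auto)
        then have "\<theta> (E w) \<otimes> y = \<theta> (E (w + Z))" using w Z zg by (simp add: theta_mult)
        moreover have "w + Z \<in> zz" using w Z zz_subspace by (intro subspace_add)
        ultimately show ?thesis by (auto simp: W_def)
      qed
      have "\<theta> (E w) <# ball \<rho> = {y \<in> space \<mu>. J (inv (\<theta> (E w)) \<otimes> y) \<le> \<rho>}"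
      proof (intro equalityI subsetI)
        fix y assume "y \<in> \<theta> (E w) <# ball \<rho>"
        then obtain z where z: "z \<in> ball \<rho>" "y = \<theta> (E w) \<otimes> z" by (auto simp: l_coset_def)
        then have zW: "z \<in> W" by (simp add: ball_def space_\<mu>)
        have "inv (\<theta> (E w)) \<otimes> y = z" using x(2) Wc[OF zW] z(2) by (simp add: m_assoc[symmetric])
        then show "y \<in> {y \<in> space \<mu>. J (inv (\<theta> (E w)) \<otimes> y) \<le> \<rho>}"
          using z Wmult[OF zW] by (simp add: ball_def space_\<mu>)
      next
        fix y assume y: "y \<in> {y \<in> space \<mu>. J (inv (\<theta> (E w)) \<otimes> y) \<le> \<rho>}"
        then have yW: "y \<in> W" by (simp add: space_\<mu>)
        have "inv (\<theta> (E w)) \<otimes> y \<in> ball \<rho>" using y Winv[OF yW] by (simp add: ball_def space_\<mu>)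
        moreover have "y = \<theta> (E w) \<otimes> (inv (\<theta> (E w)) \<otimes> y)"
          using x(2) Wc[OF yW] by (simp add: m_assoc[symmetric])
        ultimately show "y \<in> \<theta> (E w) <# ball \<rho>" unfolding l_coset_def by blast
      qed
      also have "\<dots> \<in> sets \<mu>"
        by (rule J_translate[OF x(1)[unfolded W_def], unfolded borel_measurable_iff_le, rule_format])
      finally show ?thesis .
    qed
    have "ball r \<subseteq> (\<Union>w\<in>F. \<theta> (E w) <# ball \<rho>)"
    proof
      fix x assume "x \<in> ball r"
      then obtain Z where Z: "Z \<in> zz" "sqrt (Q Z) \<le> r" "x = \<theta> (E Z)" by (auto simp: ball_eq)
      have "norm Z \<le> r / sqrt m" by (rule norm_le[OF Z(1,2)])
      also have "\<dots> \<le> b * r" using r by (simp add: b_def distrib_right)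
      finally obtain w where w: "w \<in> F" "norm (Z - w) \<le> \<rho> / sqrt M" using F(4)[OF Z(1)] by blast
      have wz: "w \<in> zz" using w(1) F(2) by blast
      have Zw: "Z - w \<in> zz" using Z(1) wz zz_subspace by (simp add: subspace_diff)
      have "sqrt (Q (Z - w)) \<le> sqrt (M * (norm (Z - w))\<^sup>2)" using m(4)[OF Zw] by simp
      also have "\<dots> = sqrt M * norm (Z - w)" by (simp add: real_sqrt_mult)
      also have "\<dots> \<le> \<rho>" using w(2) m(2) by (simp add: field_simps)
      finally have "\<theta> (E (Z - w)) \<in> ball \<rho>" using Zw by (auto simp: ball_eq)
      moreover have "E (w + (Z - w)) = E w \<otimes> E (Z - w)"
        by (rule E_add_rs2) (use wz Zw zz_rs in auto)
      then have "x = \<theta> (E w) \<otimes> \<theta> (E (Z - w))" using wz Zw zg Z(3) by (simp add: theta_mult)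
      ultimately show "x \<in> (\<Union>w\<in>F. \<theta> (E w) <# ball \<rho>)" using w(1) by (auto simp: l_coset_def)
    qed
    then have "emeasure \<mu> (ball r) \<le> emeasure \<mu> (\<Union>w\<in>F. \<theta> (E w) <# ball \<rho>)"
      using cosets F(1,2) by (intro emeasure_mono) auto
    also have "\<dots> \<le> (\<Sum>w\<in>F. emeasure \<mu> (\<theta> (E w) <# ball \<rho>))"
      using cosets F(1,2) by (intro emeasure_subadditive_finite) auto
    also have "\<dots> = (\<Sum>w\<in>F. ennreal c0)"
      using F(2) by (intro sum.cong refl) (auto simp: c0(1)[symmetric] W_def intro!: inv_\<mu> ball_sets)
    also have "\<dots> = ennreal (real (card F) * c0)"
      using c0(2) by (simp add: ennreal_mult ennreal_of_nat_eq_real_of_nat)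
    also have "\<dots> \<le> ennreal (C * b ^ dim zz * c0 * r powr real (dim zz))"
    proof (rule ennreal_leI)
      have "real (card F) * c0 \<le> C * (b * r) ^ dim zz * c0" using F(3) c0(2) by (rule mult_right_mono)
      also have "\<dots> = C * b ^ dim zz * c0 * r powr real (dim zz)"
        using r by (simp add: power_mult_distrib powr_realpow)
      finally show "real (card F) * c0 \<le> C * b ^ dim zz * c0 * r powr real (dim zz)" .
    qed
    finally show "emeasure \<mu> {x \<in> space \<mu>. J x \<le> r} \<le> ennreal (C * b ^ dim zz * c0 * r powr real (dim zz))"
      by (simp only: ball_def)
  qed
qed

text \<open>The weights on the Lie algebra of \<open>N\<close> are \<open>- a\<close> and
  \<open>- (2 * a)\<close>. One halving of the exponent comes from the square root, the other from
  writing the result as a power of the height \<open>exp (- 2 * a * s)\<close>.\<close>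

lemma rho_power_E:
  "rho_power G p (\<theta> ` E ` nn) (E (s *\<^sub>R H)) =
    exp (- 2 * a * s) powr ((real (dim (rs (- a))) + 2 * real (dim (rs (- (2 * a))))) / 4)"
proof -
  have sH: "s *\<^sub>R H \<in> \<gg>" by (rule lie_algebra_scaleR[OF H_mem])
  have eig: "Ad G p (E (s *\<^sub>R H)) X = exp (s * l) *\<^sub>R X" if "X \<in> rs l" for X l
    unfolding Ad_E[OF sH] by (rule mat_exp_conj_eigen) (simp add: bracket_scaleR_left rs_eigen[OF that])
  have int: "rs (- a) \<inter> rs (- (2 * a)) \<subseteq> {0}"
  proof
    fix X assume "X \<in> rs (- a) \<inter> rs (- (2 * a))"
    then have "(- a) *\<^sub>R X = (- (2 * a)) *\<^sub>R X" using rs_eigen by (metis Int_iff)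
    then have "(- a - - (2 * a)) *\<^sub>R X = 0" by (simp only: scaleR_diff_left diff_self)
    then show "X \<in> {0}" using a_pos by simp
  qed
  have "det_on (lie_algebra G p (\<theta> ` E ` nn)) (Ad G p (E (s *\<^sub>R H))) =
      exp (s * (- a)) ^ dim (rs (- a)) * exp (s * (- (2 * a))) ^ dim (rs (- (2 * a)))"
    unfolding lie_algebra_N
    by (rule det_on_two_eigenspaces[OF rs_subspace rs_subspace int linear_Ad eig eig])
  also have "\<dots> = exp (- a * s * (real (dim (rs (- a))) + 2 * real (dim (rs (- (2 * a))))))"
    by (simp add: exp_of_nat_mult[symmetric] exp_add[symmetric] algebra_simps)
  finally have det: "det_on (lie_algebra G p (\<theta> ` E ` nn)) (Ad G p (E (s *\<^sub>R H))) =
      exp (- a * s * (real (dim (rs (- a))) + 2 * real (dim (rs (- (2 * a))))))" .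
  have sq: "sqrt (exp t) = exp (t / 2)" for t :: real
    by (rule real_sqrt_unique) (simp_all add: exp_double[symmetric])
  show ?thesis
    unfolding rho_power_def det sq by (simp add: powr_def field_simps)
qed

end

section \<open>The Iwasawa projection and the convergence of the integral\<close>

locale rank_one_iwasawa = rank_one_roots G p R \<sigma> \<epsilon> U K \<theta> H a
  for G :: "('g::topological_space, 'm) monoid_scheme" (structure)
    and p :: "'g \<Rightarrow> real^'n^'n" and R \<sigma> \<epsilon> U K \<theta> H a +
  assumes iwasawa: "bij_betw (\<lambda>(v, x, k). v \<otimes> x \<otimes> k) ((E ` nn) \<times> (range (\<lambda>s. E (s *\<^sub>R H))) \<times> K) (carrier G)"
begin

lemma iwasawa_exists:
  assumes "x \<in> carrier G"
  obtains V s k where "V \<in> nn" "k \<in> K" "x = E V \<otimes> E (s *\<^sub>R H) \<otimes> k"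
    "iwasawa_A G (E ` nn) (range (\<lambda>s. E (s *\<^sub>R H))) K x = E (s *\<^sub>R H)"
proof -
  define f where "f = (\<lambda>(v, x, k). v \<otimes> x \<otimes> k)"
  define S where "S = (E ` nn) \<times> (range (\<lambda>s. E (s *\<^sub>R H))) \<times> K"
  have bij: "inj_on f S" "f ` S = carrier G" using iwasawa by (auto simp: bij_betw_def f_def S_def)
  have "x \<in> f ` S" using assms bij(2) by simp
  then obtain V s k where V: "V \<in> nn" "k \<in> K" "x = E V \<otimes> E (s *\<^sub>R H) \<otimes> k"
    by (auto simp: f_def S_def)
  have "iwasawa_A G (E ` nn) (range (\<lambda>s. E (s *\<^sub>R H))) K x = E (s *\<^sub>R H)"
    unfolding iwasawa_A_def
  proof (rule the_equality)
    show "E (s *\<^sub>R H) \<in> range (\<lambda>s. E (s *\<^sub>R H)) \<and> (\<exists>v\<in>E ` nn. \<exists>k\<in>K. x = v \<otimes> E (s *\<^sub>R H) \<otimes> k)"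
      using V by blast
    fix y assume y: "y \<in> range (\<lambda>s. E (s *\<^sub>R H)) \<and> (\<exists>v\<in>E ` nn. \<exists>k\<in>K. x = v \<otimes> y \<otimes> k)"
    then obtain v k' where v: "v \<in> E ` nn" "k' \<in> K" "x = v \<otimes> y \<otimes> k'" by blast
    have "f (v, y, k') = f (E V, E (s *\<^sub>R H), k)" using v(3) V(3) by (simp add: f_def)
    moreover have "(v, y, k') \<in> S" "(E V, E (s *\<^sub>R H), k) \<in> S" using v y V by (auto simp: S_def)
    ultimately have "(v, y, k') = (E V, E (s *\<^sub>R H), k)" using bij(1) by (meson inj_onD)
    then show "y = E (s *\<^sub>R H)" by simp
  qed
  then show ?thesis using V that by blast
qed

text \<open>If \<open>rs a\<close> were 0, \<open>nn\<close> would be abelian and \<open>zz\<close>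
  trivial. The injective \<open>D\<close> transports dimensions to the negative weights, which are
  those of \<open>N\<close>. The two facts give the gap \<open>dim zz < 2 * e\<close> in
  \<open>integrable_height\<close>.\<close>

lemma dim_zz_less:
  assumes "zz \<noteq> {0}"
  shows "0 < dim (rs (- a))" "dim zz \<le> dim (rs (- (2 * a)))"
proof -
  have "rs a \<noteq> {0}"
  proof
    assume "rs a = {0}"
    then have "nn \<subseteq> rs (2 * a)" by (auto simp: nn_def)
    then have "bracket X Y = 0" if "X \<in> nn" "Y \<in> nn" for X Y
      using bracket_nn_rs2[OF that(1)] that(2) by blast
    then have "{bracket X Y | X Y. X \<in> nn \<and> Y \<in> nn} \<subseteq> {0}" by blast
    then have "zz \<subseteq> {0}" unfolding zz_def by (rule span_minimal) (rule subspace_single_0)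
    moreover have "0 \<in> zz" by (rule subspace_0[OF zz_subspace])
    ultimately have "zz = {0}" by blast
    then show False using assms by simp
  qed
  then obtain X where X: "X \<in> rs a" "X \<noteq> 0" using rs_zero by blast
  have "D X \<in> rs (- a)" by (rule rs_D[OF X(1)])
  moreover have "D X \<noteq> 0"
  proof
    assume "D X = 0"
    then have "X = D 0" using D_D[OF rs_mem[OF X(1)]] by simp
    then show False using X(2) D_scaleR[OF lie_algebra_zero, of 0] by simp
  qed
  ultimately have "\<not> rs (- a) \<subseteq> {0}" by blast
  then show "0 < dim (rs (- a))" using dim_eq_0 by (metis gr0I)
  obtain F where F: "bounded_linear F" "\<And>X. X \<in> \<gg> \<Longrightarrow> D X = F X" using D_linear_extension by blast
  have inj: "inj_on F (span zz)"
  proof (rule inj_onI)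
    fix X Y assume XY: "X \<in> span zz" "Y \<in> span zz" "F X = F Y"
    then have g: "X \<in> \<gg>" "Y \<in> \<gg>"
      using zz_rs rs_mem span_eq_iff[THEN iffD2, OF zz_subspace] by blast+
    then have "D X = D Y" using XY(3) by (simp only: F(2))
    then have "D (D X) = D (D Y)" by (rule arg_cong)
    then show "X = Y" by (simp only: D_D[OF g(1)] D_D[OF g(2)])
  qed
  have "dim zz = dim (F ` zz)"
    by (rule dim_image_eq[OF bounded_linear.linear[OF F(1)] inj, symmetric])
  also have "\<dots> \<le> dim (rs (- (2 * a)))"
    by (rule dim_subset) (use zz_rs rs_D rs_mem F(2) in fastforce)
  finally show "dim zz \<le> dim (rs (- (2 * a)))" .
qed

lemma integrable_height:
  assumes haar: "haar_measure G (derived G (\<theta> ` E ` nn)) \<mu>"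
  shows "integrable \<mu> (\<lambda>n. let y = rho_power G p (\<theta> ` E ` nn) (iwasawa_A G (E ` nn) (range (\<lambda>s. E (s *\<^sub>R H))) K n)
           in inverse y * (1 + ln y) powr r)" (is "integrable \<mu> ?f")
proof -
  define W where "W = \<theta> ` E ` zz"
  note haar' = haar[unfolded derived_N]
  have sets_\<mu>: "sets \<mu> = sets (restrict_space borel W)"
    and comp_\<mu>: "\<And>S. compact S \<Longrightarrow> S \<subseteq> W \<Longrightarrow> emeasure \<mu> S < \<infinity>"
    using haar_measureD[OF haar'[folded W_def]] by blast+
  have space_\<mu>: "space \<mu> = W"
    using sets_eq_imp_space_eq[OF sets_\<mu>] by (simp add: space_restrict_space)
  have zg: "Z \<in> \<gg>" if "Z \<in> zz" for Z using that zz_rs rs_mem by blast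
  have WG: "W \<subseteq> carrier G" using zg by (auto simp: W_def)
  show ?thesis
  \<comment> \<open>A trivial commutator subgroup is a point of finite measure, and then there need
    not be a nonzero \<open>F\<close> to measure heights with.\<close>
  proof (cases "zz = {0}")
    case True
    then have W1: "W = {\<one>}" by (simp add: W_def)
    have "emeasure \<mu> (space \<mu>) < \<infinity>" unfolding space_\<mu> by (rule comp_\<mu>) (simp_all add: W1)
    then interpret finite_measure \<mu> by (intro finite_measureI) auto
    have "integrable \<mu> (\<lambda>x. ?f \<one>)" by (rule integrable_const)
    then show ?thesis
      by (rule Bochner_Integration.integrable_cong[THEN iffD1, rotated 2]) (auto simp: space_\<mu> W1)
  next
    case False
    then obtain F where F: "F \<in> rs (2 * a)" "F \<noteq> 0" using zz_rs subspace_0[OF zz_subspace] by blast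
    define \<kappa> where "\<kappa> = 2 * a\<^sup>2 / h"
    have \<kappa>: "0 < \<kappa>" using a_pos h_pos by (simp add: \<kappa>_def)
    define e where "e = (real (dim (rs (- a))) + 2 * real (dim (rs (- (2 * a))))) / 4"
    \<comment> \<open>By \<open>Q_iwasawa\<close> the ratio is \<open>exp (- 4 * a * s)\<close>, so
      on the commutator subgroup \<open>w\<close> is the height, expressed without the
      decomposition, and \<open>J\<close> solves
      \<open>w = 1 + \<kappa> * J\<^sup>2\<close>.\<close>
    define w where "w x = sqrt (Q (Ad G p (inv x) F) / Q F)" for x
    define J where "J x = sqrt ((w x - 1) / \<kappa>)" for x
    define g where "g t = inverse (t powr e) * (1 + ln (t powr e)) powr r" for t
    have QF: "0 < Q F" by (rule Q_pos[OF rs_mem[OF F(1)] F(2)])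
    have main: "w (\<theta> (E Z)) = 1 + \<kappa> * Q Z" "?f (\<theta> (E Z)) = g (w (\<theta> (E Z)))" if Z: "Z \<in> zz" for Z
    proof -
      obtain V s k where V: "V \<in> nn" "k \<in> K" "\<theta> (E Z) = E V \<otimes> E (s *\<^sub>R H) \<otimes> k"
        "iwasawa_A G (E ` nn) (range (\<lambda>s. E (s *\<^sub>R H))) K (\<theta> (E Z)) = E (s *\<^sub>R H)"
        using iwasawa_exists[OF theta_closed[OF E_closed[OF zg[OF Z]]]] by blast
      have hgt: "exp (- 2 * a * s) = 1 + \<kappa> * Q Z"
        using iwasawa_height[OF V(1-3) subsetD[OF zz_rs Z] F] by (simp add: \<kappa>_def)
      have "Q (Ad G p (inv (\<theta> (E Z))) F) / Q F = exp (- 4 * a * s)"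
        using Q_iwasawa[OF V(1-3) F(1)] QF by simp
      also have "\<dots> = (exp (- 2 * a * s))\<^sup>2" using exp_double[of "- 2 * a * s"] by (simp add: mult.assoc)
      finally have w: "w (\<theta> (E Z)) = exp (- 2 * a * s)" by (simp add: w_def)
      then show "w (\<theta> (E Z)) = 1 + \<kappa> * Q Z" using hgt by simp
      show "?f (\<theta> (E Z)) = g (w (\<theta> (E Z)))"
        unfolding V(4) rho_power_E w g_def e_def Let_def ..
    qed
    have JE: "J (\<theta> (E Z)) = sqrt (Q Z)" if "Z \<in> zz" for Z
      using main(1)[OF that] \<kappa> by (simp add: J_def)
    have w_cont: "continuous_on (carrier G) w"
      unfolding w_def using QF by (intro continuous_intros Q_Ad_continuous rs_mem[OF F(1)]) auto
    have meas: "u \<in> borel_measurable \<mu>" if "continuous_on W u" for u :: "'g \<Rightarrow> real"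
      using borel_measurable_continuous_on_restrict[OF that] measurable_cong_sets[OF sets_\<mu> refl] by blast
    have w_meas: "w \<in> borel_measurable \<mu>" by (rule meas[OF continuous_on_subset[OF w_cont WG]])
    then have J_meas: "J \<in> borel_measurable \<mu>" unfolding J_def by measurable
    have g_meas: "(\<lambda>x. g (w x)) \<in> borel_measurable \<mu>" unfolding g_def using w_meas by measurable
    have J_translate: "(\<lambda>y. J (inv x \<otimes> y)) \<in> borel_measurable \<mu>" if x: "x \<in> \<theta> ` E ` zz" for x
    proof -
      have xG: "x \<in> carrier G" using x WG by (auto simp: W_def)
      have "continuous_on W (\<lambda>y. w (inv x \<otimes> y))"
      proof (rule continuous_on_compose2[OF w_cont])
        show "continuous_on W (\<lambda>y. inv x \<otimes> y)"
          using WG xG by (intro mult_continuous_on continuous_on_const continuous_on_id) auto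
      qed (use WG xG in auto)
      then have "(\<lambda>y. w (inv x \<otimes> y)) \<in> borel_measurable \<mu>" by (rule meas)
      then show ?thesis unfolding J_def by measurable
    qed
    obtain C where C: "0 \<le> C"
      "\<And>r. 1 \<le> r \<Longrightarrow> emeasure \<mu> {x \<in> space \<mu>. J x \<le> r} \<le> ennreal (C * r powr real (dim zz))"
      using haar_volume_growth[OF haar' J_meas JE J_translate] by blast
    have dims: "0 < dim (rs (- a))" "dim zz \<le> dim (rs (- (2 * a)))" using dim_zz_less[OF False] by auto
    have gap: "real (dim zz) < 2 * e" using dims by (simp add: e_def)
    have e: "0 < e" using gap by (smt (verit) of_nat_0_le_iff)
    \<comment> \<open>The midpoint of \<open>dim zz\<close> and \<open>2 * e\<close>: above the
      growth exponent of the volume and below the decay exponent, with room left for the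
      logarithm.\<close>
    define s where "s = (real (dim zz) + 2 * e) / 2"
    have s: "real (dim zz) < s" "0 \<le> s" "s < 2 * e" using gap by (auto simp: s_def)
    \<comment> \<open>Chosen so that \<open>t powr (- e)\<close> times
      \<open>t powr (e * \<eta>)\<close> is \<open>t powr (- s / 2)\<close>, where \<open>t\<close>
      is at least a constant times \<open>(max 1 J)\<^sup>2\<close>.\<close>
    define \<eta> where "\<eta> = 1 - s / (2 * e)"
    have \<eta>: "0 < \<eta>" "e * (\<eta> - 1) = - s / 2" using s(3) e by (auto simp: \<eta>_def field_simps)
    obtain c where c: "0 < c" "\<And>y. 1 \<le> y \<Longrightarrow> (1 + ln y) powr r \<le> c * y powr \<eta>"
      using log_powr_le_powr[OF \<eta>(1)] by blast
    \<comment> \<open>The minimum with 1 gives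
      \<open>\<kappa>' * (1 + Q Z) \<le> 1 + \<kappa> * Q Z\<close>.\<close>
    define \<kappa>' where "\<kappa>' = min 1 \<kappa>"
    have \<kappa>': "0 < \<kappa>'" "\<kappa>' \<le> 1" "\<kappa>' \<le> \<kappa>" using \<kappa> by (auto simp: \<kappa>'_def)
    have bound: "\<bar>?f x\<bar> \<le> (c * \<kappa>' powr (- s / 2)) * max 1 (J x) powr (- s)" if x: "x \<in> space \<mu>" for x
    proof -
      obtain Z where Z: "Z \<in> zz" "x = \<theta> (E Z)" using x by (auto simp: space_\<mu> W_def)
      have Q0: "0 \<le> Q Z" by (rule Q_nonneg[OF zg[OF Z(1)]])
      define t where "t = 1 + \<kappa> * Q Z"
      have t: "1 \<le> t" using \<kappa> Q0 by (simp add: t_def)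
      define y where "y = t powr e"
      have y: "1 \<le> y" using t e by (simp add: y_def ge_one_powr_ge_zero)
      define j where "j = max 1 (J x)"
      have j: "1 \<le> j" by (simp add: j_def)
      have "j\<^sup>2 \<le> 1 + Q Z" using Q0 by (auto simp: j_def JE[OF Z(1)] Z(2) max_def)
      then have "\<kappa>' * j\<^sup>2 \<le> \<kappa>' * (1 + Q Z)" using \<kappa>'(1) by simp
      also have "\<dots> \<le> t" unfolding t_def distrib_left using \<kappa>' Q0 by (intro add_mono mult_right_mono) auto
      finally have jt: "\<kappa>' * j\<^sup>2 \<le> t" .
      have "?f x = inverse y * (1 + ln y) powr r"
        by (simp only: Z(2) main(2)[OF Z(1)]) (simp only: main(1)[OF Z(1)] g_def t_def[symmetric] y_def[symmetric])
      then have "\<bar>?f x\<bar> = inverse y * (1 + ln y) powr r" using y by simp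
      also have "\<dots> \<le> inverse y * (c * y powr \<eta>)" using c(2)[OF y] y by (intro mult_left_mono) auto
      also have "\<dots> = c * y powr (\<eta> - 1)" using y by (simp add: powr_diff divide_inverse)
      also have "y powr (\<eta> - 1) = t powr (- s / 2)" by (simp only: y_def powr_powr \<eta>(2))
      also have "\<dots> \<le> (\<kappa>' * j\<^sup>2) powr (- s / 2)" using jt \<kappa>'(1) j s(2) by (intro powr_mono2') auto
      also have "\<dots> = \<kappa>' powr (- s / 2) * (j\<^sup>2) powr (- s / 2)" by (rule powr_mult)
      also have "(j\<^sup>2) powr (- s / 2) = j powr (- s)"
      proof -
        have "j\<^sup>2 = j powr 2" using j by (simp add: powr_numeral)
        then show ?thesis by (simp add: powr_powr)
      qed
      finally show ?thesis using c(1) by (simp add: j_def mult.assoc)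
    qed
    have f_meas: "?f \<in> borel_measurable \<mu>"
    proof (rule measurable_cong[THEN iffD2, OF _ g_meas])
      show "?f x = g (w x)" if "x \<in> space \<mu>" for x
        using that main(2) by (auto simp: space_\<mu> W_def)
    qed
    show ?thesis
      by (rule integrable_if_volume_growth[OF f_meas J_meas C(2) bound s(1,2) C(1) mult_nonneg_nonneg])
         (use c(1) in auto)
  qed
qed

end

section \<open>The main theorem\<close>

context reductive_cartan
begin

section \<open>Maximal abelian subspaces in split rank one\<close>

lemma minus_space: "cartan_minus_space G p \<theta> = {X \<in> \<gg>. D X = - X}"
  by (simp add: cartan_minus_space_def)

text \<open>\<open>split_rank\<close> is a \<open>Max\<close>, which says something only about a
  finite set.\<close>

lemma finite_abelian_dims: "finite {dim \<aa> | \<aa>. abelian_subspace (cartan_minus_space G p \<theta>) \<aa>}"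
proof (rule finite_subset)
  show "{dim \<aa> | \<aa>. abelian_subspace (cartan_minus_space G p \<theta>) \<aa>} \<subseteq> {..DIM(real^'n^'n)}"
    using dim_subset_UNIV by blast
qed simp

lemma abelian_dim_le_one:
  assumes "split_rank G p \<theta> = 1" "abelian_subspace (cartan_minus_space G p \<theta>) \<bb>"
  shows "dim \<bb> \<le> 1"
proof -
  have "dim \<bb> \<in> {dim \<aa> | \<aa>. abelian_subspace (cartan_minus_space G p \<theta>) \<aa>}"
    using assms(2) by blast
  from Max_ge[OF finite_abelian_dims this] show ?thesis
    using assms(1) by (simp only: split_rank_def)
qed

lemma abelian_dim_one_exists:
  assumes "split_rank G p \<theta> = 1"
  obtains \<bb> where "abelian_subspace (cartan_minus_space G p \<theta>) \<bb>" "dim \<bb> = 1"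
proof -
  let ?S = "{dim \<aa> | \<aa>. abelian_subspace (cartan_minus_space G p \<theta>) \<aa>}"
  have "abelian_subspace (cartan_minus_space G p \<theta>) {0}"
    using D_scaleR[OF lie_algebra_zero, of 0]
    by (auto simp: abelian_subspace_def minus_space lie_algebra_zero)
  then have "?S \<noteq> {}" by blast
  then have "Max ?S \<in> ?S" by (rule Max_in[OF finite_abelian_dims])
  then obtain \<bb> where "abelian_subspace (cartan_minus_space G p \<theta>) \<bb>" "dim \<bb> = split_rank G p \<theta>"
    unfolding split_rank_def by force
  then show ?thesis using that assms by simp
qed

lemma maximal_abelian_line:
  assumes rank: "split_rank G p \<theta> = 1" and max: "maximal_abelian_subspace (cartan_minus_space G p \<theta>) \<aa>"
    and H: "H \<in> \<aa>" "H \<noteq> 0"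
  shows "\<aa> = range (\<lambda>s. s *\<^sub>R H)"
proof -
  have ab: "abelian_subspace (cartan_minus_space G p \<theta>) \<aa>" and sub: "subspace \<aa>"
    using max by (auto simp: maximal_abelian_subspace_def abelian_subspace_def)
  have "independent {H}" using H(2) by simp
  then have "\<aa> \<subseteq> span {H}"
    by (rule card_ge_dim_independent[rotated]) (use abelian_dim_le_one[OF rank ab] H(1) in auto)
  moreover have "span {H} \<subseteq> \<aa>" using H(1) sub by (intro span_minimal) auto
  ultimately show ?thesis by (simp add: span_singleton full_SetCompr_eq)
qed

text \<open>Maximality under inclusion excludes the zero subspace, because it is contained in an
  abelian subspace of dimension 1.\<close>

lemma maximal_abelian_nonzero:
  assumes rank: "split_rank G p \<theta> = 1" and max: "maximal_abelian_subspace (cartan_minus_space G p \<theta>) \<aa>"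
  obtains H where "H \<in> \<aa>" "H \<noteq> 0"
proof -
  have sub: "subspace \<aa>" using max by (auto simp: maximal_abelian_subspace_def abelian_subspace_def)
  have "\<not> \<aa> \<subseteq> {0}"
  proof
    assume a: "\<aa> \<subseteq> {0}"
    obtain \<bb> where b: "abelian_subspace (cartan_minus_space G p \<theta>) \<bb>" "dim \<bb> = 1"
      using abelian_dim_one_exists[OF rank] by blast
    have "0 \<in> \<bb>" using b(1) by (simp add: abelian_subspace_def subspace_0)
    then have "\<aa> \<subseteq> \<bb>" using a by blast
    then have "\<bb> = \<aa>" using max b(1) by (auto simp: maximal_abelian_subspace_def)
    then have "dim \<bb> = 0" using a by (simp add: dim_eq_0)
    then show False using b(2) by simp
  qed
  then show ?thesis using that by blast
qed

text \<open>The span of \<open>H\<close> and \<open>T\<close> is abelian and contains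
  \<open>\<aa>\<close>, so maximality makes the two equal.\<close>

lemma maximal_abelian_centralizer:
  assumes rank: "split_rank G p \<theta> = 1" and max: "maximal_abelian_subspace (cartan_minus_space G p \<theta>) \<aa>"
    and H: "H \<in> \<aa>" "H \<noteq> 0"
    and T: "T \<in> \<gg>" "D T = - T" "bracket H T = 0"
  shows "\<exists>c. T = c *\<^sub>R H"
proof -
  have aH: "\<aa> = range (\<lambda>s. s *\<^sub>R H)" by (rule maximal_abelian_line[OF rank max H])
  have Hg: "H \<in> \<gg>" "D H = - H"
    using max H(1) by (auto simp: maximal_abelian_subspace_def abelian_subspace_def minus_space)
  have TH: "bracket T H = 0" using T(3) bracket_commute[of T H] by simp
  define \<bb> where "\<bb> = {s *\<^sub>R H + t *\<^sub>R T | s t. True}"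
  have "subspace \<bb>"
    unfolding subspace_def
  proof (intro conjI ballI allI)
    show "0 \<in> \<bb>" unfolding \<bb>_def by (auto intro!: exI[of _ 0])
    fix x y c assume x: "x \<in> \<bb>"
    obtain s t where st: "x = s *\<^sub>R H + t *\<^sub>R T" using x by (auto simp: \<bb>_def)
    have "c *\<^sub>R x = (c * s) *\<^sub>R H + (c * t) *\<^sub>R T" by (simp add: st scaleR_add_right)
    then show "c *\<^sub>R x \<in> \<bb>" unfolding \<bb>_def by blast
    assume y: "y \<in> \<bb>"
    obtain s' t' where st': "y = s' *\<^sub>R H + t' *\<^sub>R T" using y by (auto simp: \<bb>_def)
    have "x + y = (s + s') *\<^sub>R H + (t + t') *\<^sub>R T" by (simp add: st st' scaleR_add_left)
    then show "x + y \<in> \<bb>" unfolding \<bb>_def by blast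
  qed
  moreover have "\<bb> \<subseteq> cartan_minus_space G p \<theta>"
    using Hg T(1,2) by (auto simp: \<bb>_def minus_space lie_algebra_add lie_algebra_scaleR D_add D_scaleR)
  moreover have "bracket X Y = 0" if "X \<in> \<bb>" "Y \<in> \<bb>" for X Y
    using that T(3) TH
    by (auto simp: \<bb>_def bracket_add_left bracket_add_right bracket_scaleR_left bracket_scaleR_right)
  ultimately have "abelian_subspace (cartan_minus_space G p \<theta>) \<bb>" by (simp add: abelian_subspace_def)
  moreover have "\<aa> \<subseteq> \<bb>"
  proof
    fix x assume "x \<in> \<aa>"
    then obtain s where "x = s *\<^sub>R H + 0 *\<^sub>R T" by (auto simp: aH)
    then show "x \<in> \<bb>" unfolding \<bb>_def by blast
  qed
  ultimately have "\<bb> = \<aa>" using max by (auto simp: maximal_abelian_subspace_def)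
  moreover have "T = 0 *\<^sub>R H + 1 *\<^sub>R T" by simp
  then have "T \<in> \<bb>" unfolding \<bb>_def by blast
  ultimately show ?thesis by (auto simp: aH)
qed

end

context rank_one_roots
begin

text \<open>Without roots, \<open>0\<close> is a regular element too; this is the second alternative.\<close>

lemma positive_root_sum_nn:
  assumes aH: "\<aa> = range (\<lambda>s. s *\<^sub>R H)" and reg: "regular_element \<gg> \<aa> H'" and H': "H' = H \<or> H' = 0"
  shows "positive_root_sum \<gg> \<aa> H' = nn"
proof -
  have root_space: "root_space \<gg> \<aa> \<beta> = rs (\<beta> H)" if "linear \<beta>" for \<beta>
  proof (intro equalityI subsetI)
    fix X assume "X \<in> root_space \<gg> \<aa> \<beta>"
    moreover have "H \<in> \<aa>" unfolding aH using rangeI[of "\<lambda>s. s *\<^sub>R H" 1] by simp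
    ultimately show "X \<in> rs (\<beta> H)" by (auto simp: root_space_def rs_def)
  next
    fix X assume X: "X \<in> rs (\<beta> H)"
    then show "X \<in> root_space \<gg> \<aa> \<beta>"
      by (auto simp: root_space_def rs_def aH bracket_scaleR_left linear_scale[OF that])
  qed
  have functional: "\<exists>\<beta>. restricted_root \<gg> \<aa> \<beta> \<and> \<beta> H = l" if l: "l \<noteq> 0" "X \<in> rs l" "X \<noteq> 0" for l X
  proof -
    \<comment> \<open>Roots are functionals on all matrices, so the value \<open>l\<close> at
      \<open>H\<close> is extended by the inner product with \<open>H\<close>.\<close>
    define \<beta> where "\<beta> M = l * (M \<bullet> H) / (H \<bullet> H)" for M
    have lin: "linear \<beta>"
      by (rule linearI) (simp_all add: \<beta>_def inner_add_left distrib_left add_divide_distrib)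
    have bH: "\<beta> H = l" using H_nonzero by (simp add: \<beta>_def)
    have "H \<in> \<aa>" unfolding aH using rangeI[of "\<lambda>s. s *\<^sub>R H" 1] by simp
    then have "restricted_root \<gg> \<aa> \<beta>"
      unfolding restricted_root_def root_space[OF lin] bH using lin bH l by blast
    then show ?thesis using bH by blast
  qed
  show ?thesis
  proof (cases "H' = H")
    case True
    show ?thesis
    proof
      show "positive_root_sum \<gg> \<aa> H' \<subseteq> nn"
        unfolding positive_root_sum_def
      proof (rule span_minimal[OF _ nn_subspace], clarify)
        fix X \<beta> assume b: "restricted_root \<gg> \<aa> \<beta>" "0 < \<beta> H'" "X \<in> root_space \<gg> \<aa> \<beta>"
        then have X: "X \<in> rs (\<beta> H)" using root_space by (simp add: restricted_root_def)
        show "X \<in> nn"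
        proof (cases "X = 0")
          case False
          then have "\<beta> H = a \<or> \<beta> H = 2 * a" using roots[OF _ X] b(2) True by simp
          then show ?thesis using X rs_1_nn rs_2_nn by auto
        qed (simp add: subspace_0[OF nn_subspace])
      qed
      have rs_sub: "rs l \<subseteq> positive_root_sum \<gg> \<aa> H'" if "0 < l" for l
      proof
        fix X assume X: "X \<in> rs l"
        show "X \<in> positive_root_sum \<gg> \<aa> H'"
        proof (cases "X = 0")
          case False
          obtain \<beta> where b: "restricted_root \<gg> \<aa> \<beta>" "\<beta> H = l" using functional[OF _ X False] \<open>0 < l\<close> by auto
          have "X \<in> root_space \<gg> \<aa> \<beta>" using X root_space b by (simp add: restricted_root_def)
          then show ?thesis
            unfolding positive_root_sum_def using b \<open>0 < l\<close> True by (intro span_base) blast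
        qed (simp add: positive_root_sum_def span_zero)
      qed
      show "nn \<subseteq> positive_root_sum \<gg> \<aa> H'"
      proof
        fix V assume "V \<in> nn"
        then obtain X Y where V: "V = X + Y" "X \<in> rs a" "Y \<in> rs (2 * a)" by (auto simp: nn_def)
        have "X \<in> positive_root_sum \<gg> \<aa> H'" "Y \<in> positive_root_sum \<gg> \<aa> H'"
          using V rs_sub[of a] rs_sub[of "2 * a"] a_pos by auto
        then show "V \<in> positive_root_sum \<gg> \<aa> H'"
          unfolding V(1) positive_root_sum_def by (rule span_add)
      qed
    qed
  next
    case False
    then have H'0: "H' = 0" using H' by simp
    have no_roots: "\<not> restricted_root \<gg> \<aa> \<beta>" for \<beta>
    proof
      assume b: "restricted_root \<gg> \<aa> \<beta>"
      then have "\<beta> H' \<noteq> 0" using reg by (simp add: regular_element_def)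
      moreover have "\<beta> H' = 0" unfolding H'0 using b by (intro linear_0) (simp add: restricted_root_def)
      ultimately show False by simp
    qed
    have trivial: "X = 0" if "0 < l" "X \<in> rs l" for l X
      using functional[of l X] no_roots that by blast
    have "V = 0" if Vn: "V \<in> nn" for V
    proof -
      obtain X Y where V: "V = X + Y" "X \<in> rs a" "Y \<in> rs (2 * a)" using Vn by (auto simp: nn_def)
      have "X = 0" "Y = 0" using trivial[OF _ V(2)] trivial[OF _ V(3)] a_pos by simp_all
      then show ?thesis by (simp add: V(1))
    qed
    then have "nn = {0}" using subspace_0[OF nn_subspace] by auto
    moreover have "positive_root_sum \<gg> \<aa> H' = {0}" by (simp add: positive_root_sum_def no_roots)
    ultimately show ?thesis by simp
  qed
qed

end

lemma (in reductive_cartan) integrable_rho_power: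
  assumes rank: "split_rank G p \<theta> = 1" and iw: "iwasawa_decomposition G p \<theta> (\<theta> ` N) A K"
    and N: "N \<subseteq> carrier G" and haar: "haar_measure G (derived G N) \<mu>"
  shows "integrable \<mu> (\<lambda>n. let y = rho_power G p N (iwasawa_A G (\<theta> ` N) A K n)
           in inverse y * (1 + ln y) powr r)"
proof -
  obtain \<aa> H' where max: "maximal_abelian_subspace (cartan_minus_space G p \<theta>) \<aa>"
    and A: "A = E ` \<aa>" and reg: "regular_element \<gg> \<aa> H'"
    and V: "\<theta> ` N = E ` positive_root_sum \<gg> \<aa> H'"
    and bij: "bij_betw (\<lambda>(v, a, k). v \<otimes> a \<otimes> k) (\<theta> ` N \<times> A \<times> K) (carrier G)"
    using iw unfolding iwasawa_decomposition_def by blast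
  have H'a: "H' \<in> \<aa>" using reg by (simp add: regular_element_def)
  \<comment> \<open>The regular element itself spans \<open>\<aa>\<close> unless it is 0, which can
    happen only without roots; then any nonzero element of \<open>\<aa>\<close> serves.\<close>
  obtain H where H: "H \<in> \<aa>" "H \<noteq> 0" "H' = H \<or> H' = 0"
    using maximal_abelian_nonzero[OF rank max] H'a by metis
  have aH: "\<aa> = range (\<lambda>s. s *\<^sub>R H)" by (rule maximal_abelian_line[OF rank max H(1,2)])
  have Hm: "H \<in> \<gg>" "D H = - H"
    using max H(1) by (auto simp: maximal_abelian_subspace_def abelian_subspace_def minus_space)
  interpret rank_one G p R \<sigma> \<epsilon> U K \<theta> H
    by unfold_locales (use Hm H(2) maximal_abelian_centralizer[OF rank max H(1,2)] in auto)
  obtain a where a: "a > 0" "\<And>l X. 0 < l \<Longrightarrow> X \<in> rs l \<Longrightarrow> X \<noteq> 0 \<Longrightarrow> l = a \<or> l = 2 * a"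
    using root_classification by blast
  interpret rank_one_roots G p R \<sigma> \<epsilon> U K \<theta> H a
    by unfold_locales (fact a)+
  have nn: "\<theta> ` N = E ` nn" unfolding V positive_root_sum_nn[OF aH reg H(3)] ..
  have N': "N = \<theta> ` E ` nn"
  proof -
    have "\<theta> ` \<theta> ` N = N" using N by (force simp: image_image)
    then show ?thesis by (simp only: nn)
  qed
  have A': "A = range (\<lambda>s. E (s *\<^sub>R H))" unfolding A aH by (simp add: image_image)
  interpret rank_one_iwasawa G p R \<sigma> \<epsilon> U K \<theta> H a
    by unfold_locales (use bij in \<open>simp only: nn A'\<close>)
  show ?thesis
    using integrable_height[OF haar[unfolded N'], of r] unfolding nn A' unfolding N' .
qed

theorem mainTheorem2:
  fixes G :: "('g::topological_space, 'm) monoid_scheme"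
    and p :: "'g \<Rightarrow> real^'n^'n"
    and K P N A :: "'g set" and \<theta> :: "'g \<Rightarrow> 'g"
    and \<mu> :: "'g measure" and r :: real
  assumes "real_reductive_group G p" and "connected (carrier G)"
    and "finite (group_center G)"
    and "maximal_compact_subgroup G K" and "cartan_involution G p K \<theta>"
    and "split_rank G p \<theta> = 1"
    and "parabolic_subgroup G p P" and "P \<noteq> {\<one>\<^bsub>G\<^esub>}" and "P \<noteq> carrier G"
    and "unipotent_radical G p P N"
    and "iwasawa_decomposition G p \<theta> (\<theta> ` N) A K" and "A \<subseteq> normalizer G N"
    and "haar_measure G (derived G N) \<mu>"
  shows "integrable \<mu> (\<lambda>n. let a\<rho> = rho_power G p N (iwasawa_A G (\<theta> ` N) A K n)
           in inverse a\<rho> * (1 + ln a\<rho>) powr r)"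
proof -
  obtain R where R: "self_adjoint_algebraic_group R" "openin (top_of_set R) (p ` carrier G)"
    using assms(1) by (auto simp: real_reductive_group_def)
  interpret real_reductive G p R
    by unfold_locales (use assms(1) R in auto)
  obtain \<sigma> \<epsilon> U where sec: "reductive_section G p R \<sigma> \<epsilon> U"
  proof (rule local_section_exists)
    fix \<sigma> and \<epsilon> :: real and U
    assume "0 < \<epsilon>"
      "\<And>M. M \<in> R \<Longrightarrow> norm (M - mat 1) < \<epsilon> \<Longrightarrow> \<sigma> M \<in> carrier G \<and> p (\<sigma> M) = M"
      "continuous_on {M \<in> R. norm (M - mat 1) < \<epsilon>} \<sigma>"
      "\<And>M M'. M \<in> R \<Longrightarrow> norm (M - mat 1) < \<epsilon> \<Longrightarrow> M' \<in> R \<Longrightarrow> norm (M' - mat 1) < \<epsilon> \<Longrightarrow>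
        norm (M ** M' - mat 1) < \<epsilon> \<Longrightarrow> \<sigma> (M ** M') = \<sigma> M \<otimes>\<^bsub>G\<^esub> \<sigma> M'"
      "openin (top_of_set (carrier G)) U" "\<one>\<^bsub>G\<^esub> \<in> U"
      "\<And>x. x \<in> U \<Longrightarrow> norm (p x - mat 1) < \<epsilon> \<and> \<sigma> (p x) = x"
    then have "reductive_section G p R \<sigma> \<epsilon> U" by unfold_locales
    then show ?thesis by (rule that)
  qed
  interpret reductive_section G p R \<sigma> \<epsilon> U by (rule sec)
  interpret reductive_cartan G p R \<sigma> \<epsilon> U K \<theta>
    by unfold_locales (rule assms(5))
  have "N \<subseteq> P"
    using assms(10) normal_imp_subgroup[of N "G\<lparr>carrier := P\<rparr>"] subgroup.subset[of N "G\<lparr>carrier := P\<rparr>"]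
    by (auto simp: unipotent_radical_def connected_normal_unipotent_def)
  moreover have "P \<subseteq> carrier G" using assms(7) by (auto simp: parabolic_subgroup_def)
  ultimately have "N \<subseteq> carrier G" by blast
  then show ?thesis by (rule integrable_rho_power[OF assms(6,11) _ assms(13)])
qed

end
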